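(* Let $\varphi:\mathbb{D}\to\mathbb{D}$ be a holomorphic function such that there exists a parabolic semiflow $(\varphi_t)_{t\ge 0}$ with $\varphi=\varphi_1$, and let $\Omega$ be its Koenigs domain. (i) If $\Omega$ is contained in a half-plane, $\operatorname{int}(\overline{\Omega})=\Omega$ and $\sum_{n=1}^{\infty}\left(1-|\varphi_n(0)|\right)=\infty$, then $C_\varphi\in\mathcal{L}(H^p)$ has the functional commutant property for $1\le p<\infty$. In particular, there exist no non-trivial idempotents lying in $\{C_\varphi\}'$. (ii) If $\Omega$ is contained in a horizontal half-plane of the form $\{w\in\mathbb{C}:\operatorname{Im}(w)>-\eta\}$ with $\eta>0$, then the commutant $\{C_\varphi\}'$ of $C_\varphi\in\mathcal{L}(H^p)$, $1\le p<\infty$, is not abelian. In particular, $C_\varphi$ has neither the functional commutant property nor minimal commutant.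
   Context: $\mathbb{D}$ is the open unit disc of $\mathbb{C}$ and $\mathbb{T}$ the unit circle. For $1\le p<\infty$, $H^p$ is the Banach space of holomorphic $f:\mathbb{D}\to\mathbb{C}$ with $\|f\|_{H^p}=\left(\sup_{0<r<1}\int_0^{2\pi}|f(re^{i\theta})|^p\,d\theta\right)^{1/p}<\infty$. For holomorphic $\varphi:\mathbb{D}\to\mathbb{D}$, $C_\varphi f=f\circ\varphi$, a bounded operator on $H^p$. For a complex Banach space $X$, $\mathcal{L}(X)$ is the algebra of bounded linear operators on $X$. For $T\in\mathcal{L}(X)$, $\{T\}'=\{A\in\mathcal{L}(X):AT=TA\}$. $T$ has minimal commutant if the closure in the weak operator topology of $\operatorname{alg}(T)=\{q(T): q \text{ a complex polynomial}\}$ equals $\{T\}'$. A non-trivial idempotent is $J\in\mathcal{L}(X)$ with $J^2=J$, $J\ne 0$, $J\neq \mathrm{Id}_X$. For $G\subset\mathbb{C}$, $\mathcal{C}(G)$ is the algebra of all continuous functions $f:G\to\mathbb{C}$ with pointwise operations (no topology is considered). $T$ has the functional commutant property if there exist a connected subset $G\subset\mathbb{C}$, a subalgebra $\mathcal{A}\subseteq\mathcal{C}(G)$ and an algebra isomorphism $\Phi:\mathcal{A}\to\{T\}'$. Semiflows. A holomorphic semiflow is a family $(\varphi_t)_{t\ge0}$ of holomorphic self-maps of $\mathbb{D}$ with $\varphi_0(z)=z$, $\varphi_{t+s}=\varphi_t\circ\varphi_s$ for all $t,s\geq 0$, and $\varphi_t\to\varphi_s$ uniformly on compact subsets of $\mathbb{D}$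 as $t\to s$. (In particular, $\varphi_n$ is the $n$-th iterate of $\varphi=\varphi_1$ for $n\in\mathbb{N}$.) It is elliptic if $\varphi_{t_0}(z_0)=z_0$ for some $t_0>0$ and $z_0\in\mathbb{D}$. If it is not elliptic, there is a unique $\tau\in\mathbb{T}$ (the Denjoy–Wolff point) such that $\varphi_t\to\tau$ uniformly on compact subsets as $t\to\infty$, and there is $\alpha\le 0$ such that $\varphi_t'$ has non-tangential limit $e^{t\alpha}$ at $\tau$ for all $t\geq 0$; the semiflow is hyperbolic if $\alpha<0$ and parabolic if $\alpha=0$. For a non-elliptic semiflow there is a univalent function $h:\mathbb{D}\to\mathbb{C}$ (the Koenigs function), unique up to an additive constant, with $\varphi_t(z)=h^{-1}(h(z)+t)$ for all $z\in\mathbb{D}$, $t\ge0$. The Koenigs domain is $\Omega=h(\mathbb{D})$. Interior and closure are taken in $\mathbb{C}$. *)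

theory Defs
  imports
    "HOL-Complex_Analysis.Complex_Analysis"
    "HOL-Computational_Algebra.Polynomial"
    "HOL-Library.FuncSet"
begin

text \<open>
  A complex normed space is given by a set \<open>V\<close> of complex-valued functions, with the
  pointwise vector space operations, and a norm \<open>N\<close> on \<open>V\<close>.
  Operators on \<open>V\<close> are extensional (\<open>undefined\<close> off \<open>V\<close>), so that
  equality in HOL is equality of operators on \<open>V\<close>, and their product is
  \<^const>\<open>compose\<close>.
\<close>

definition linear_ops_on :: "('s \<Rightarrow> complex) set \<Rightarrow> (('s \<Rightarrow> complex) \<Rightarrow> 's \<Rightarrow> complex) set" where
  "linear_ops_on V = {T \<in> V \<rightarrow>\<^sub>E V.
     (\<forall>f\<in>V. \<forall>g\<in>V. T (\<lambda>s. f s + g s) = (\<lambda>s. T f s + T g s)) \<and>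
     (\<forall>c. \<forall>f\<in>V. T (\<lambda>s. c * f s) = (\<lambda>s. c * T f s))}"

definition bounded_ops :: "('s \<Rightarrow> complex) set \<Rightarrow> (('s \<Rightarrow> complex) \<Rightarrow> real) \<Rightarrow>
    (('s \<Rightarrow> complex) \<Rightarrow> 's \<Rightarrow> complex) set" where
  "bounded_ops V N = {T \<in> linear_ops_on V. \<exists>K. \<forall>f\<in>V. N (T f) \<le> K * N f}"

definition bounded_functionals :: "('s \<Rightarrow> complex) set \<Rightarrow> (('s \<Rightarrow> complex) \<Rightarrow> real) \<Rightarrow>
    (('s \<Rightarrow> complex) \<Rightarrow> complex) set" where
  "bounded_functionals V N = {l.
     (\<forall>f\<in>V. \<forall>g\<in>V. l (\<lambda>s. f s + g s) = l f + l g) \<and>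
     (\<forall>c. \<forall>f\<in>V. l (\<lambda>s. c * f s) = c * l f) \<and>
     (\<exists>K. \<forall>f\<in>V. cmod (l f) \<le> K * N f)}"

definition op_zero :: "('s \<Rightarrow> complex) set \<Rightarrow> ('s \<Rightarrow> complex) \<Rightarrow> 's \<Rightarrow> complex" where
  "op_zero V = (\<lambda>f\<in>V. \<lambda>s. 0)"

definition op_id :: "('s \<Rightarrow> complex) set \<Rightarrow> ('s \<Rightarrow> complex) \<Rightarrow> 's \<Rightarrow> complex" where
  "op_id V = (\<lambda>f\<in>V. f)"

definition op_add :: "('s \<Rightarrow> complex) set \<Rightarrow> (('s \<Rightarrow> complex) \<Rightarrow> 's \<Rightarrow> complex) \<Rightarrow>
    (('s \<Rightarrow> complex) \<Rightarrow> 's \<Rightarrow> complex) \<Rightarrow> ('s \<Rightarrow> complex) \<Rightarrow> 's \<Rightarrow> complex" where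
  "op_add V A B = (\<lambda>f\<in>V. \<lambda>s. A f s + B f s)"

definition op_scale :: "('s \<Rightarrow> complex) set \<Rightarrow> complex \<Rightarrow>
    (('s \<Rightarrow> complex) \<Rightarrow> 's \<Rightarrow> complex) \<Rightarrow> ('s \<Rightarrow> complex) \<Rightarrow> 's \<Rightarrow> complex" where
  "op_scale V c A = (\<lambda>f\<in>V. \<lambda>s. c * A f s)"

definition op_poly :: "('s \<Rightarrow> complex) set \<Rightarrow> complex poly \<Rightarrow>
    (('s \<Rightarrow> complex) \<Rightarrow> 's \<Rightarrow> complex) \<Rightarrow> ('s \<Rightarrow> complex) \<Rightarrow> 's \<Rightarrow> complex" where
  "op_poly V q T = (\<lambda>f\<in>V. \<lambda>s. \<Sum>i\<le>degree q. coeff q i * (T ^^ i) f s)"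

definition op_alg :: "('s \<Rightarrow> complex) set \<Rightarrow> (('s \<Rightarrow> complex) \<Rightarrow> 's \<Rightarrow> complex) \<Rightarrow>
    (('s \<Rightarrow> complex) \<Rightarrow> 's \<Rightarrow> complex) set" where
  "op_alg V T = range (\<lambda>q. op_poly V q T)"

definition commutant :: "('s \<Rightarrow> complex) set \<Rightarrow> (('s \<Rightarrow> complex) \<Rightarrow> real) \<Rightarrow>
    (('s \<Rightarrow> complex) \<Rightarrow> 's \<Rightarrow> complex) \<Rightarrow> (('s \<Rightarrow> complex) \<Rightarrow> 's \<Rightarrow> complex) set" where
  "commutant V N T = {A \<in> bounded_ops V N. compose V A T = compose V T A}"

definition weak_operator_topology :: "('s \<Rightarrow> complex) set \<Rightarrow> (('s \<Rightarrow> complex) \<Rightarrow> real) \<Rightarrow>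
    (('s \<Rightarrow> complex) \<Rightarrow> 's \<Rightarrow> complex) topology" where
  "weak_operator_topology V N = topology_generated_by
     {{T \<in> bounded_ops V N. l (T f) \<in> U} | l f U.
        l \<in> bounded_functionals V N \<and> f \<in> V \<and> open U}"

definition minimal_commutant :: "('s \<Rightarrow> complex) set \<Rightarrow> (('s \<Rightarrow> complex) \<Rightarrow> real) \<Rightarrow>
    (('s \<Rightarrow> complex) \<Rightarrow> 's \<Rightarrow> complex) \<Rightarrow> bool" where
  "minimal_commutant V N T \<longleftrightarrow>
     weak_operator_topology V N closure_of op_alg V T = commutant V N T"

definition nontrivial_idempotent :: "('s \<Rightarrow> complex) set \<Rightarrow> (('s \<Rightarrow> complex) \<Rightarrow> real) \<Rightarrow>
    (('s \<Rightarrow> complex) \<Rightarrow> 's \<Rightarrow> complex) \<Rightarrow> bool" where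
  "nontrivial_idempotent V N J \<longleftrightarrow>
     J \<in> bounded_ops V N \<and> compose V J J = J \<and> J \<noteq> op_zero V \<and> J \<noteq> op_id V"

definition abelian_ops :: "('s \<Rightarrow> complex) set \<Rightarrow> (('s \<Rightarrow> complex) \<Rightarrow> 's \<Rightarrow> complex) set \<Rightarrow> bool" where
  "abelian_ops V \<A> \<longleftrightarrow> (\<forall>A\<in>\<A>. \<forall>B\<in>\<A>. compose V A B = compose V B A)"

text \<open>
  A function on \<open>G\<close> is represented by its extension by \<open>0\<close> outside \<open>G\<close>.
\<close>

definition continuous_functions :: "complex set \<Rightarrow> (complex \<Rightarrow> complex) set" where
  "continuous_functions G = {f. continuous_on G f \<and> (\<forall>z. z \<notin> G \<longrightarrow> f z = 0)}"

text \<open>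
  Subalgebras are not required to contain the constant function \<open>1\<close>.
\<close>

definition subalgebra_of_continuous :: "complex set \<Rightarrow> (complex \<Rightarrow> complex) set \<Rightarrow> bool" where
  "subalgebra_of_continuous G \<A> \<longleftrightarrow>
     \<A> \<subseteq> continuous_functions G \<and> (\<lambda>z. 0) \<in> \<A> \<and>
     (\<forall>f\<in>\<A>. \<forall>g\<in>\<A>. (\<lambda>z. f z + g z) \<in> \<A>) \<and>
     (\<forall>c. \<forall>f\<in>\<A>. (\<lambda>z. c * f z) \<in> \<A>) \<and>
     (\<forall>f\<in>\<A>. \<forall>g\<in>\<A>. (\<lambda>z. f z * g z) \<in> \<A>)"

definition algebra_iso_to_ops :: "('s \<Rightarrow> complex) set \<Rightarrow> (complex \<Rightarrow> complex) set \<Rightarrow>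
    (('s \<Rightarrow> complex) \<Rightarrow> 's \<Rightarrow> complex) set \<Rightarrow>
    ((complex \<Rightarrow> complex) \<Rightarrow> ('s \<Rightarrow> complex) \<Rightarrow> 's \<Rightarrow> complex) \<Rightarrow> bool" where
  "algebra_iso_to_ops V \<A> \<B> \<Phi> \<longleftrightarrow>
     bij_betw \<Phi> \<A> \<B> \<and>
     (\<forall>f\<in>\<A>. \<forall>g\<in>\<A>. \<Phi> (\<lambda>z. f z + g z) = op_add V (\<Phi> f) (\<Phi> g)) \<and>
     (\<forall>c. \<forall>f\<in>\<A>. \<Phi> (\<lambda>z. c * f z) = op_scale V c (\<Phi> f)) \<and>
     (\<forall>f\<in>\<A>. \<forall>g\<in>\<A>. \<Phi> (\<lambda>z. f z * g z) = compose V (\<Phi> f) (\<Phi> g))"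

definition functional_commutant_property :: "('s \<Rightarrow> complex) set \<Rightarrow> (('s \<Rightarrow> complex) \<Rightarrow> real) \<Rightarrow>
    (('s \<Rightarrow> complex) \<Rightarrow> 's \<Rightarrow> complex) \<Rightarrow> bool" where
  "functional_commutant_property V N T \<longleftrightarrow>
     (\<exists>G \<A> \<Phi>. connected G \<and> subalgebra_of_continuous G \<A> \<and>
        algebra_iso_to_ops V \<A> (commutant V N T) \<Phi>)"

definition hardy_mean :: "real \<Rightarrow> (complex \<Rightarrow> complex) \<Rightarrow> real \<Rightarrow> real" where
  "hardy_mean p f r = integral {0..2 * pi} (\<lambda>\<theta>. cmod (f (of_real r * cis \<theta>)) powr p)"

text \<open>
  A function on the disc is represented by its extension by \<open>0\<close> outside the disc.
\<close>

definition hardy_space :: "real \<Rightarrow> (complex \<Rightarrow> complex) set" where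
  "hardy_space p = {f. f holomorphic_on ball 0 1 \<and> (\<forall>z. z \<notin> ball 0 1 \<longrightarrow> f z = 0) \<and>
     bdd_above (hardy_mean p f ` {0<..<1})}"

definition hardy_norm :: "real \<Rightarrow> (complex \<Rightarrow> complex) \<Rightarrow> real" where
  "hardy_norm p f = (SUP r\<in>{0<..<1}. hardy_mean p f r) powr (1 / p)"

definition composition_op :: "real \<Rightarrow> (complex \<Rightarrow> complex) \<Rightarrow>
    (complex \<Rightarrow> complex) \<Rightarrow> complex \<Rightarrow> complex" where
  "composition_op p \<phi> = (\<lambda>f\<in>hardy_space p. \<lambda>z. if z \<in> ball 0 1 then f (\<phi> z) else 0)"

definition holomorphic_semiflow :: "(real \<Rightarrow> complex \<Rightarrow> complex) \<Rightarrow> bool" where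
  "holomorphic_semiflow \<psi> \<longleftrightarrow>
     (\<forall>t\<ge>0. \<psi> t holomorphic_on ball 0 1 \<and> \<psi> t \<in> ball 0 1 \<rightarrow> ball 0 1) \<and>
     (\<forall>z\<in>ball 0 1. \<psi> 0 z = z) \<and>
     (\<forall>t\<ge>0. \<forall>s\<ge>0. \<forall>z\<in>ball 0 1. \<psi> (t + s) z = \<psi> t (\<psi> s z)) \<and>
     (\<forall>s\<ge>0. \<forall>K. compact K \<and> K \<subseteq> ball 0 1 \<longrightarrow> uniform_limit K \<psi> (\<psi> s) (at s within {0..}))"

definition elliptic_semiflow :: "(real \<Rightarrow> complex \<Rightarrow> complex) \<Rightarrow> bool" where
  "elliptic_semiflow \<psi> \<longleftrightarrow>
     holomorphic_semiflow \<psi> \<and> (\<exists>t>0. \<exists>z\<in>ball 0 1. \<psi> t z = z)"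

definition denjoy_wolff_point :: "(real \<Rightarrow> complex \<Rightarrow> complex) \<Rightarrow> complex \<Rightarrow> bool" where
  "denjoy_wolff_point \<psi> \<tau> \<longleftrightarrow> \<tau> \<in> sphere 0 1 \<and>
     (\<forall>K. compact K \<and> K \<subseteq> ball 0 1 \<longrightarrow> uniform_limit K \<psi> (\<lambda>_. \<tau>) at_top)"

definition stolz_region :: "complex \<Rightarrow> real \<Rightarrow> complex set" where
  "stolz_region \<tau> M = {z \<in> ball 0 1. cmod (\<tau> - z) < M * (1 - cmod z)}"

definition has_nontangential_limit :: "(complex \<Rightarrow> complex) \<Rightarrow> complex \<Rightarrow> complex \<Rightarrow> bool" where
  "has_nontangential_limit f \<tau> L \<longleftrightarrow> (\<forall>M>1. (f \<longlongrightarrow> L) (at \<tau> within stolz_region \<tau> M))"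

definition has_spectral_value :: "(real \<Rightarrow> complex \<Rightarrow> complex) \<Rightarrow> complex \<Rightarrow> real \<Rightarrow> bool" where
  "has_spectral_value \<psi> \<tau> \<alpha> \<longleftrightarrow>
     (\<forall>t\<ge>0. has_nontangential_limit (deriv (\<psi> t)) \<tau> (of_real (exp (t * \<alpha>))))"

definition parabolic_semiflow :: "(real \<Rightarrow> complex \<Rightarrow> complex) \<Rightarrow> bool" where
  "parabolic_semiflow \<psi> \<longleftrightarrow> holomorphic_semiflow \<psi> \<and> \<not> elliptic_semiflow \<psi> \<and>
     (\<exists>\<tau>. denjoy_wolff_point \<psi> \<tau> \<and> has_spectral_value \<psi> \<tau> 0)"

definition koenigs_function :: "(real \<Rightarrow> complex \<Rightarrow> complex) \<Rightarrow> (complex \<Rightarrow> complex) \<Rightarrow> bool" where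
  "koenigs_function \<psi> h \<longleftrightarrow> h holomorphic_on ball 0 1 \<and> inj_on h (ball 0 1) \<and>
     (\<forall>t\<ge>0. \<forall>z\<in>ball 0 1. h z + of_real t \<in> h ` ball 0 1 \<and>
        \<psi> t z = inv_into (ball 0 1) h (h z + of_real t))"

definition half_plane :: "complex set \<Rightarrow> bool" where
  "half_plane H \<longleftrightarrow> (\<exists>a b. a \<noteq> 0 \<and> H = {w. a \<bullet> w > b})"

end

theory Submission imports Defs
begin

text \<open>
  For (ii), \<open>exp (2 \<pi> \<i> h)\<close> is bounded and invariant under \<open>\<psi> 1\<close>, so multiplication by it commutes with
  the composition operator, as does composition with \<open>\<psi> (1/2)\<close>; but these two operators anticommute,
  since \<open>h\<close> increases by \<open>1/2\<close> along \<open>\<psi> (1/2)\<close>.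

  For (i), let \<open>h\<close> map into the half-plane \<open>a \<bullet> w > b\<close> and put \<open>u = cnj a * h - b\<close>. The functions
  \<open>e s = exp (-s u)\<close>, \<open>s \<ge> 0\<close>, are eigenvectors of the composition operator. The corresponding eigenspaces are
  one-dimensional: an eigenfunction is determined on the orbit of \<open>0\<close> by its value at \<open>0\<close>, and the
  orbit is not a Blaschke sequence. So every \<open>A\<close> in the commutant acts on \<open>e s\<close> as a scalar \<open>\<alpha> A s\<close>, and
  \<open>A \<mapsto> \<alpha> A\<close> is a homomorphism into the continuous functions on \<open>[0, \<infinity>)\<close>. It is injective because
  the \<open>e s\<close> are total in \<open>H\<^sup>p\<close>. For this, let \<open>\<A>\<close> be the algebra of bounded functions generated by them,
  closed under bounded pointwise convergence; bounded functionals on \<open>H\<^sup>p\<close> are continuous under such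
  convergence. Now \<open>\<A>\<close> contains \<open>k = 1 / (1 + u)\<close>, by pushing poles the resolvents of \<open>k\<close> at all points
  outside the closure of \<open>k(\<D>)\<close>, by Runge's theorem all functions \<open>F \<circ> k\<close> with \<open>F\<close> holomorphic near that
  closure, and by Caratheodory kernel convergence (here regularity of the Koenigs domain enters) the
  identity, hence all bounded holomorphic functions. These are dense in \<open>H\<^sup>p\<close>: if \<open>G\<close> in \<open>H\<^sup>2\<close> satisfies
  \<open>|f| powr (p/2) \<le> Re G\<close>, then \<open>f\<close> times the square of \<open>1 / (1 + G/N)\<close> is bounded and tends to \<open>f\<close>.
\<close>

section \<open>Poisson integrals and subharmonicity\<close>

text \<open>The spaces are given by integral means, so boundary functions are avoided: estimates are
  made on circles inside the disc. For a general exponent q the power \<open>cmod f powr q\<close>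
  is handled through a logarithm of a zero-free majorant, which is why circles free of zeros of f
  keep appearing. For p = 1 there is no reflexivity to draw on; continuity of functionals under
  bounded pointwise convergence comes from the parallelogram law in H^2 instead. The detour through
  \<open>k\<close> is forced because the image of \<open>u\<close> is unbounded, whereas pole
  pushing and Runge's theorem want a bounded image whose closure has connected complement; that
  connectedness comes from the invariance of the Koenigs domain under right translations. Runge's
  theorem alone does not reach the identity: the inverse of \<open>k\<close> need not extend beyond
  \<open>k(\<D>)\<close>, so the identity is obtained only as a limit of functions
  \<open>F \<circ> k\<close>. This is also why bounded pointwise limits, and not uniform ones, are
  used.\<close>

lemma mean_value_circle:
  fixes f :: "complex \<Rightarrow> complex"
  assumes "continuous_on (cball 0 r) f" "f holomorphic_on ball 0 r" "0 < r" "cmod w < r"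
  shows "integral {0..2*pi} (\<lambda>t. f (r * cis t) * (r * cis t) / (r * cis t - w)) = 2 * pi * f w"
    and "(\<lambda>t. f (r * cis t) * (r * cis t) / (r * cis t - w)) integrable_on {0..2*pi}"
proof -
  have "((\<lambda>u. f u/(u-w)) has_contour_integral (2 * of_real pi * \<i> * f w)) (circlepath 0 r)"
    by (rule Cauchy_integral_circlepath) (use assms in auto)
  then have *: "((\<lambda>t. f (r * cis t) / (r * cis t - w) * r * \<i> * cis t) has_integral (2 * of_real pi * \<i> * f w)) {0..2*pi}"
    unfolding circlepath_def
    by (subst (asm) has_contour_integral_part_circlepath_iff) auto
  have "((\<lambda>t. (-\<i>) * (f (r * cis t) / (r * cis t - w) * r * \<i> * cis t)) has_integral (-\<i>) * (2 * of_real pi * \<i> * f w)) {0..2*pi}"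
    by (rule has_integral_mult_right[OF *])
  then have "((\<lambda>t. f (r * cis t) * (r * cis t) / (r * cis t - w)) has_integral 2 * pi * f w) {0..2*pi}"
    by (rule has_integral_eq_rhs[OF has_integral_eq, rotated]) (auto simp: field_simps)
  then show "integral {0..2*pi} (\<lambda>t. f (r * cis t) * (r * cis t) / (r * cis t - w)) = 2 * pi * f w"
    "(\<lambda>t. f (r * cis t) * (r * cis t) / (r * cis t - w)) integrable_on {0..2*pi}"
    by (auto simp: integral_unique)
qed

lemma mean_value_center:
  fixes f :: "complex \<Rightarrow> complex"
  assumes "continuous_on (cball 0 r) f" "f holomorphic_on ball 0 r" "0 < r"
  shows "((\<lambda>t. f (r * cis t)) has_integral 2 * pi * f 0) {0..2*pi}"
proof -
  have "f (r * cis t) * (r * cis t) / (r * cis t - 0) = f (r * cis t)" for t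
    using assms(3) by auto
  then show ?thesis
    using mean_value_circle[OF assms, of 0] assms(3) by (simp add: has_integral_integral)
qed

text \<open>The factor \<open>1 / (2 * pi)\<close> is left out, so the total mass is
  \<open>2 * pi\<close>. The radius stays variable because functions are often controlled only on
  circles inside the unit disc.\<close>

definition poisson_kernel :: "real \<Rightarrow> complex \<Rightarrow> real \<Rightarrow> real" where
  "poisson_kernel R w t = (R\<^sup>2 - (cmod w)\<^sup>2) / (cmod (R * cis t - w))\<^sup>2"

lemma norm_real_cis [simp]: "cmod (complex_of_real R * cis t) = \<bar>R\<bar>"
  by (simp add: norm_mult)

lemma real_cis_minus_nonzero: "cmod w < R \<Longrightarrow> R * cis t - w \<noteq> 0"
  using norm_real_cis[of R t] by auto

text \<open>As the real part of a function holomorphic in \<open>w\<close>, the kernel is harmonic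
  in \<open>w\<close>; \<open>poisson_kernel_mean\<close> averages this function.\<close>

lemma poisson_kernel_eq:
  assumes "cmod w < R"
  shows "poisson_kernel R w t = Re ((R * cis t + w) / (R * cis t - w))"
proof -
  have "(R * cis t + w) / (R * cis t - w) = (R * cis t + w) * cnj (R * cis t - w) / (cmod (R * cis t - w))\<^sup>2"
    using complex_div_cnj by blast
  moreover have "Re ((R * cis t + w) * cnj (R * cis t - w)) = R\<^sup>2 - (cmod w)\<^sup>2"
  proof -
    have "Re ((R * cis t + w) * cnj (R * cis t - w)) = (R * cos t)\<^sup>2 + (R * sin t)\<^sup>2 - ((Re w)\<^sup>2 + (Im w)\<^sup>2)"
      by (simp add: algebra_simps power2_eq_square)
    also have "(R * cos t)\<^sup>2 + (R * sin t)\<^sup>2 = R\<^sup>2"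
      by (simp add: power_mult_distrib flip: distrib_left)
    finally show ?thesis by (simp add: cmod_power2)
  qed
  ultimately show ?thesis by (simp add: poisson_kernel_def)
qed

lemma poisson_kernel_nonneg: "cmod w < R \<Longrightarrow> 0 \<le> poisson_kernel R w t"
  by (auto simp: poisson_kernel_def intro!: divide_nonneg_nonneg power_mono)

lemma poisson_kernel_le:
  assumes "cmod w < R"
  shows "poisson_kernel R w t \<le> (R + cmod w) / (R - cmod w)"
proof -
  have "R - cmod w \<le> cmod (R * cis t - w)"
    using norm_triangle_ineq2[of "R * cis t" w] by simp
  then have "(R - cmod w)\<^sup>2 \<le> (cmod (R * cis t - w))\<^sup>2"
    using assms by (intro power_mono) auto
  then have "poisson_kernel R w t \<le> (R\<^sup>2 - (cmod w)\<^sup>2) / (R - cmod w)\<^sup>2"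
    unfolding poisson_kernel_def using assms
    by (intro divide_left_mono) (auto intro!: power_mono mult_pos_pos zero_less_power simp: real_cis_minus_nonzero)
  also have "\<dots> = (R + cmod w) / (R - cmod w)"
    using assms by (simp add: power2_eq_square square_diff_square_factored)
  finally show ?thesis .
qed

lemma continuous_on_poisson_kernel [continuous_intros]:
  assumes "continuous_on S f" "continuous_on S g" "\<And>x. x \<in> S \<Longrightarrow> cmod (f x) < R"
  shows "continuous_on S (\<lambda>x. poisson_kernel R (f x) (g x))"
  unfolding poisson_kernel_def
  using real_cis_minus_nonzero assms(3)
  by (intro continuous_intros assms(1,2) continuous_on_compose2[OF continuous_on_cis]) auto

text \<open>Cauchy's formula for f times
  \<open>(R\<^sup>2 - (cmod w)\<^sup>2) / (R\<^sup>2 - cnj w * z)\<close>. This factor is 1 at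
  \<open>z = w\<close>, has no pole in the closed disc, and turns the Cauchy kernel into the Poisson
  kernel on the circle.\<close>

lemma poisson_formula:
  fixes f :: "complex \<Rightarrow> complex"
  assumes "continuous_on (cball 0 R) f" "f holomorphic_on ball 0 R" "cmod w < R"
  shows "((\<lambda>t. f (R * cis t) * poisson_kernel R w t) has_integral 2 * pi * f w) {0..2*pi}"
proof -
  have R: "R > 0" using assms(3) norm_ge_zero[of w] by linarith
  have nz: "R\<^sup>2 - cnj w * z \<noteq> 0" if "z \<in> cball 0 R" for z
  proof
    assume "R\<^sup>2 - cnj w * z = 0"
    then have "R\<^sup>2 = cmod w * cmod z"
      by (metis abs_power2 eq_iff_diff_eq_0 norm_mult norm_of_real complex_mod_cnj)
    moreover have "cmod w * cmod z \<le> cmod w * R"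
      using that by (intro mult_left_mono) auto
    moreover have "cmod w * R < R * R" using assms(3) R by simp
    ultimately show False by (simp add: power2_eq_square)
  qed
  define F where "F = (\<lambda>z. f z * (R\<^sup>2 - (cmod w)\<^sup>2) / (R\<^sup>2 - cnj w * z))"
  have F: "continuous_on (cball 0 R) F" "F holomorphic_on ball 0 R"
    unfolding F_def using assms nz by (auto intro!: continuous_intros holomorphic_intros)
  have 1: "((\<lambda>t. F (R * cis t) * (R * cis t) / (R * cis t - w)) has_integral 2 * pi * F w) {0..2*pi}"
    using mean_value_circle[OF F R assms(3)] by (simp add: has_integral_integral)
  have "cnj w * w = (cmod w)\<^sup>2" by (metis complex_norm_square mult.commute of_real_power)
  then have 2: "F w = f w"
    using nz[of w] assms(3) by (simp add: F_def field_simps)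
  have 3: "F (R * cis t) * (R * cis t) / (R * cis t - w) = f (R * cis t) * poisson_kernel R w t" for t
  proof -
    let ?z = "R * cis t"
    have zz: "?z * cnj ?z = R\<^sup>2"
      using complex_norm_square[of ?z] by (simp only: norm_real_cis power2_abs of_real_power)
    have "R\<^sup>2 - cnj w * ?z = ?z * cnj (?z - w)"
      using zz by (simp add: algebra_simps)
    then have "F ?z * ?z / (?z - w) = f ?z * (R\<^sup>2 - (cmod w)\<^sup>2) * ?z / (?z * (cnj (?z - w) * (?z - w)))"
      by (simp add: F_def)
    also have "\<dots> = f ?z * (R\<^sup>2 - (cmod w)\<^sup>2) / (cnj (?z - w) * (?z - w))"
      using R by (simp del: complex_cnj_diff)
    also have "cnj (?z - w) * (?z - w) = (cmod (?z - w))\<^sup>2"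
      by (metis complex_norm_square mult.commute of_real_power)
    finally show ?thesis by (simp add: poisson_kernel_def)
  qed
  show ?thesis using 1 unfolding 2 3 .
qed

lemma integral_poisson_kernel:
  assumes "cmod w < R"
  shows "(poisson_kernel R w has_integral 2 * pi) {0..2*pi}"
proof -
  have "((\<lambda>t. 1 * complex_of_real (poisson_kernel R w t)) has_integral 2 * pi * (1::complex)) {0..2*pi}"
    by (rule poisson_formula) (use assms in auto)
  then have "((\<lambda>t. Re (1 * complex_of_real (poisson_kernel R w t))) has_integral Re (2 * pi * (1::complex))) {0..2*pi}"
    by (rule has_integral_Re)
  then show ?thesis by simp
qed

lemma poisson_kernel_mean:
  assumes "continuous_on (cball 0 r) \<phi>" "\<phi> holomorphic_on ball 0 r" "0 < r"
    "\<And>z. z \<in> cball 0 r \<Longrightarrow> cmod (\<phi> z) < R"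
  shows "((\<lambda>s. poisson_kernel R (\<phi> (r * cis s)) t) has_integral 2 * pi * poisson_kernel R (\<phi> 0) t) {0..2*pi}"
proof -
  let ?F = "\<lambda>z. (R * cis t + \<phi> z) / (R * cis t - \<phi> z)"
  have "((\<lambda>s. ?F (r * cis s)) has_integral 2 * pi * ?F 0) {0..2*pi}"
    using assms real_cis_minus_nonzero
    by (intro mean_value_center) (force intro!: continuous_intros holomorphic_intros)+
  then have "((\<lambda>s. Re (?F (r * cis s))) has_integral Re (2 * pi * ?F 0)) {0..2*pi}"
    by (rule has_integral_Re)
  moreover have "Re (complex_of_real c * z) = c * Re z" for c z
    by simp
  moreover have "Re (?F (r * cis s)) = poisson_kernel R (\<phi> (r * cis s)) t" for s
    using assms by (subst poisson_kernel_eq) auto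
  moreover have "Re (?F 0) = poisson_kernel R (\<phi> 0) t"
    using assms by (subst poisson_kernel_eq) auto
  ultimately show ?thesis by (simp only:)
qed

text \<open>The Poisson kernel is harmonic in its second argument, so averaging a Poisson integral along
  \<open>\<phi>\<close> evaluates it at \<open>\<phi> 0\<close>; this is Littlewood's subordination principle.\<close>
lemma poisson_integral_mean:
  fixes g :: "real \<Rightarrow> real"
  assumes \<phi>: "continuous_on (cball 0 r) \<phi>" "\<phi> holomorphic_on ball 0 r" "0 < r"
    "\<And>z. z \<in> cball 0 r \<Longrightarrow> cmod (\<phi> z) < R"
    and g: "continuous_on {0..2*pi} g"
  shows "integral {0..2*pi} (\<lambda>s. integral {0..2*pi} (\<lambda>t. g t * poisson_kernel R (\<phi> (r * cis s)) t))
       = 2 * pi * integral {0..2*pi} (\<lambda>t. g t * poisson_kernel R (\<phi> 0) t)"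
proof -
  have "continuous_on (cbox (0, 0) (2 * pi, 2 * pi)) 
     (\<lambda>(s, t). g t * poisson_kernel R (\<phi> (r * cis s)) t)"
    unfolding split_def
    by (intro continuous_intros continuous_on_compose2[OF g] continuous_on_compose2[OF \<phi>(1)]
        continuous_on_compose2[OF continuous_on_cis]) (use \<phi> in \<open>auto simp: cbox_Pair_eq\<close>)
  then have "integral {0..2*pi} (\<lambda>s. integral {0..2*pi} (\<lambda>t. g t * poisson_kernel R (\<phi> (r * cis s)) t))
     = integral {0..2*pi} (\<lambda>t. integral {0..2*pi} (\<lambda>s. g t * poisson_kernel R (\<phi> (r * cis s)) t))"
    using integral_swap_continuous[of 0 0 "2*pi" "2*pi" "\<lambda>s t. g t * poisson_kernel R (\<phi> (r * cis s)) t"]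
    by simp
  also have "\<dots> = integral {0..2*pi} (\<lambda>t. g t * (2 * pi * poisson_kernel R (\<phi> 0) t))"
    by (intro integral_cong integral_unique has_integral_mult_right poisson_kernel_mean assms)
  also have "\<dots> = 2 * pi * integral {0..2*pi} (\<lambda>t. g t * poisson_kernel R (\<phi> 0) t)"
    by (subst integral_mult_right[symmetric]) (auto simp: algebra_simps)
  finally show ?thesis .
qed

section \<open>Removal of zeros and subharmonicity of powers of the modulus\<close>

lemma holomorphic_factor_zero:
  fixes f :: "complex \<Rightarrow> complex"
  assumes f: "f holomorphic_on S" and S: "open S" "connected S" "a \<in> S" and nz: "\<exists>w\<in>S. f w \<noteq> 0"
  obtains n g where "g holomorphic_on S" "g a \<noteq> 0" "\<And>z. z \<in> S \<Longrightarrow> f z = (z - a) ^ n * g z"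
proof -
  define n where "n = nat (zorder f a)"
  define g0 where "g0 = zor_poly f a"
  obtain r where r: "r > 0" "cball a r \<subseteq> S" "g0 holomorphic_on cball a r"
    "\<And>w. w \<in> cball a r \<Longrightarrow> f w = g0 w * (w - a) ^ n \<and> g0 w \<noteq> 0"
    using zorder_exist_zero[OF f S nz, folded n_def g0_def] by blast
  define g where "g = (\<lambda>z. if z = a then g0 a else f z / (z - a) ^ n)"
  have "g holomorphic_on (S - {a})"
    by (rule holomorphic_transform[where f = "\<lambda>z. f z / (z - a) ^ n"])
       (auto intro!: holomorphic_intros holomorphic_on_subset[OF f] simp: g_def)
  moreover have "g holomorphic_on ball a r"
    by (rule holomorphic_transform[of g0])
       (use r in \<open>auto intro!: holomorphic_on_subset[OF r(3)] simp: g_def\<close>)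
  ultimately have "g holomorphic_on ((S - {a}) \<union> ball a r)"
    using S by (intro holomorphic_on_Un) auto
  moreover have "(S - {a}) \<union> ball a r = S" using r(1,2) S(3) ball_subset_cball[of a r] by auto
  ultimately have "g holomorphic_on S" by simp
  moreover have "g a \<noteq> 0" using r(1) r(4)[of a] by (simp add: g_def)
  moreover have "f z = (z - a) ^ n * g z" if "z \<in> S" for z
    using r(1) r(4)[of a] by (simp add: g_def)
  ultimately show ?thesis by (rule that)
qed

text \<open>One polynomial identity yields both facts about Blaschke factors: the inequality inside
  the disc and the equality of moduli on the circle.\<close>

lemma blaschke_factor_identity:
  "(cmod (of_real (R\<^sup>2) - cnj a * z))\<^sup>2 - R\<^sup>2 * (cmod (z - a))\<^sup>2
     = (R\<^sup>2 - (cmod a)\<^sup>2) * (R\<^sup>2 - (cmod z)\<^sup>2)"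
  unfolding cmod_power2 by (simp add: power2_eq_square algebra_simps)

lemma blaschke_factor_le:
  assumes "cmod a < R" "cmod z \<le> R"
  shows "cmod (z - a) \<le> cmod ((of_real (R\<^sup>2) - cnj a * z) / R)"
proof -
  have "R > 0" using assms(1) norm_ge_zero[of a] by linarith
  have "0 \<le> (R\<^sup>2 - (cmod a)\<^sup>2) * (R\<^sup>2 - (cmod z)\<^sup>2)"
    using assms by (intro mult_nonneg_nonneg) (auto intro!: power_mono)
  then have "(R * cmod (z - a))\<^sup>2 \<le> (cmod (of_real (R\<^sup>2) - cnj a * z))\<^sup>2"
    unfolding blaschke_factor_identity[of R a z, symmetric] by (simp add: power_mult_distrib)
  then have "R * cmod (z - a) \<le> cmod (of_real (R\<^sup>2) - cnj a * z)"
    by (rule power2_le_imp_le) auto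
  then show ?thesis using \<open>R > 0\<close> by (simp add: norm_divide field_simps)
qed

lemma blaschke_factor_eq:
  assumes "cmod z = R" "R > 0"
  shows "cmod ((of_real (R\<^sup>2) - cnj a * z) / R) = cmod (z - a)"
proof -
  have "(R * cmod (z - a))\<^sup>2 = (cmod (of_real (R\<^sup>2) - cnj a * z))\<^sup>2"
    using blaschke_factor_identity[of R a z] assms by (simp add: power_mult_distrib)
  then have "R * cmod (z - a) = cmod (of_real (R\<^sup>2) - cnj a * z)"
    by (rule power2_eq_imp_eq) (use assms in auto)
  then show ?thesis using \<open>R > 0\<close> by (simp add: norm_divide field_simps)
qed

lemma blaschke_denominator_nonzero:
  assumes "cmod a < R" "cmod z \<le> R"
  shows "of_real (R\<^sup>2) - cnj a * z \<noteq> 0"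
proof
  assume "of_real (R\<^sup>2) - cnj a * z = 0"
  then have 0: "cmod ((of_real (R\<^sup>2) - cnj a * z) / R) = 0" by simp
  have "z = a" using blaschke_factor_le[OF assms] unfolding 0 by simp
  then have "of_real ((cmod a)\<^sup>2) = cnj a * z"
    using complex_norm_square[of a] by (simp add: mult.commute)
  also have "\<dots> = of_real (R\<^sup>2)"
    using \<open>of_real (R\<^sup>2) - cnj a * z = 0\<close> by simp
  finally have "(cmod a)\<^sup>2 = R\<^sup>2"
    by (simp only: of_real_eq_iff)
  moreover have "(cmod a)\<^sup>2 < R\<^sup>2"
    using assms by (intro power_strict_mono) auto
  ultimately show False by simp
qed

text \<open>Dividing out the finite Blaschke product of the zeros.\<close>
lemma zero_free_majorant:
  fixes f :: "complex \<Rightarrow> complex"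
  assumes f: "f holomorphic_on S" and S: "open S" "connected S" "cball 0 R \<subseteq> S" and R: "0 < R"
    and nz: "\<And>z. z \<in> sphere 0 R \<Longrightarrow> f z \<noteq> 0"
  shows "\<exists>F. F holomorphic_on S \<and> (\<forall>z\<in>cball 0 R. F z \<noteq> 0 \<and> cmod (f z) \<le> cmod (F z)) \<and>
           (\<forall>z\<in>sphere 0 R. cmod (F z) = cmod (f z))"
proof -
  have fin: "finite {z\<in>cball 0 R. f z = 0}"
    if f: "f holomorphic_on S" and nz: "\<And>z. z \<in> sphere 0 R \<Longrightarrow> f z \<noteq> 0" for f :: "complex \<Rightarrow> complex"
  proof (cases "f constant_on S")
    case True
    have "of_real R \<in> sphere (0::complex) R" using R by simp
    then have "of_real R \<in> S" "f (of_real R) \<noteq> 0" using nz[of "of_real R"] S(3) by auto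
    then have "f z \<noteq> 0" if "z \<in> S" for z
      using True that by (auto simp: constant_on_def)
    then have "{z\<in>cball 0 R. f z = 0} = {}" using S(3) by auto
    then show ?thesis by (simp only: finite.emptyI)
  next
    case False
    then show ?thesis by (intro holomorphic_compact_finite_zeros[OF f S(1,2) _ S(3)]) auto
  qed
  show ?thesis
    using f nz
  proof (induction "card {z\<in>cball 0 R. f z = 0}" arbitrary: f rule: less_induct)
    case less
    show ?case
    proof (cases "{z\<in>cball 0 R. f z = 0} = {}")
      case True
      then show ?thesis using less.prems by (intro exI[of _ f]) auto
    next
      case False
      then obtain a where a: "cmod a \<le> R" "f a = 0" by auto
      then have aR: "cmod a < R" using less.prems(2)[of a] by force
      have Rz: "of_real R \<in> S" "f (of_real R) \<noteq> 0" using S(3) less.prems(2)[of "of_real R"] R by auto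
      have aS: "a \<in> S" using S(3) a by auto
      have "\<exists>w\<in>S. f w \<noteq> 0" using Rz by blast
      then obtain n g where g: "g holomorphic_on S" "g a \<noteq> 0" "\<And>z. z \<in> S \<Longrightarrow> f z = (z - a) ^ n * g z"
        using holomorphic_factor_zero[OF less.prems(1) S(1,2) aS] by blast
      \<comment> \<open>The factor \<open>z - a\<close> is replaced, with its full multiplicity, by
        its reflection in the circle. This preserves the modulus on the circle, does not lower it
        inside and removes the zero at \<open>a\<close>, so the number of zeros drops.\<close>
      define k where "k = (\<lambda>z. ((of_real (R\<^sup>2) - cnj a * z) / R) ^ n * g z)"
      have k: "k holomorphic_on S" unfolding k_def using R by (intro holomorphic_intros g) auto
      have keq: "cmod (k z) = cmod (f z)" if "z \<in> sphere 0 R" for z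
        using blaschke_factor_eq[of z R a] that R g(3)[of z] S(3) by (auto simp: k_def norm_mult norm_power)
      have kle: "cmod (f z) \<le> cmod (k z)" if "z \<in> cball 0 R" for z
      proof -
        have "cmod (f z) = cmod (z - a) ^ n * cmod (g z)" using g(3)[of z] that S(3) by (auto simp: norm_mult norm_power)
        also have "\<dots> \<le> cmod ((of_real (R\<^sup>2) - cnj a * z) / R) ^ n * cmod (g z)"
          using blaschke_factor_le[OF aR, of z] that by (intro mult_right_mono power_mono) auto
        finally show ?thesis by (simp add: k_def norm_mult norm_power)
      qed
      have knz: "k z \<noteq> 0" if "z \<in> sphere 0 R" for z
        using keq[OF that] less.prems(2)[OF that] by auto
      have "{z\<in>cball 0 R. k z = 0} \<subset> {z\<in>cball 0 R. f z = 0}"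
      proof
        show "{z\<in>cball 0 R. k z = 0} \<subseteq> {z\<in>cball 0 R. f z = 0}" using kle by force
        have "k a \<noteq> 0" using g(2) blaschke_denominator_nonzero[OF aR, of a] aR R by (simp add: k_def)
        then show "{z\<in>cball 0 R. k z = 0} \<noteq> {z\<in>cball 0 R. f z = 0}" using a by auto
      qed
      then have "card {z\<in>cball 0 R. k z = 0} < card {z\<in>cball 0 R. f z = 0}"
        using fin[OF less.prems(1,2)] by (simp add: psubset_card_mono)
      from less.hyps[OF this k knz] obtain F where
        "F holomorphic_on S" "\<forall>z\<in>cball 0 R. F z \<noteq> 0 \<and> cmod (k z) \<le> cmod (F z)"
        "\<forall>z\<in>sphere 0 R. cmod (F z) = cmod (k z)" by blast
      then show ?thesis using kle keq by (intro exI[of _ F]) (fastforce intro: order_trans)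
    qed
  qed
qed

text \<open>A zero-free function on a disc has a holomorphic logarithm, so every real power of the
  majorant is again the modulus of a holomorphic function.\<close>

lemma zero_free_power_majorant:
  fixes f :: "complex \<Rightarrow> complex"
  assumes f: "f holomorphic_on S" and S: "open S" "connected S" "cball 0 R \<subseteq> S" and R: "0 < R"
    and nz: "\<And>z. z \<in> sphere 0 R \<Longrightarrow> f z \<noteq> 0" and q: "0 < q"
  shows "\<exists>G. G holomorphic_on cball 0 R \<and> (\<forall>z\<in>cball 0 R. cmod (f z) powr q \<le> cmod (G z)) \<and>
           (\<forall>z\<in>sphere 0 R. cmod (G z) = cmod (f z) powr q)"
proof -
  obtain F where F: "F holomorphic_on S" "\<And>z. z \<in> cball 0 R \<Longrightarrow> F z \<noteq> 0"
     "\<And>z. z \<in> cball 0 R \<Longrightarrow> cmod (f z) \<le> cmod (F z)"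
     "\<And>z. z \<in> sphere 0 R \<Longrightarrow> cmod (F z) = cmod (f z)"
    using zero_free_majorant[OF f S R nz] by blast
  have "F holomorphic_on cball 0 R" using F(1) S(3) by (rule holomorphic_on_subset)
  then obtain L where L: "L holomorphic_on cball 0 R" "\<And>z. z \<in> cball 0 R \<Longrightarrow> F z = exp (L z)"
    by (rule simply_connected_imp_holomorphic_log)
       (auto simp: F(2) convex_imp_simply_connected convex_imp_locally_path_connected)
  define G where "G = (\<lambda>z. exp (of_real q * L z))"
  have G: "cmod (G z) = cmod (F z) powr q" if "z \<in> cball 0 R" for z
  proof -
    have "cmod (F z) = exp (Re (L z))" using L(2)[OF that] by simp
    then show ?thesis by (simp add: G_def powr_def)
  qed
  show ?thesis
  proof (intro exI[of _ G] conjI ballI)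
    show "G holomorphic_on cball 0 R" unfolding G_def by (intro holomorphic_intros L)
    show "cmod (f z) powr q \<le> cmod (G z)" if "z \<in> cball 0 R" for z
      using F(3)[OF that] q by (simp add: G[OF that] powr_mono2)
    show "cmod (G z) = cmod (f z) powr q" if "z \<in> sphere 0 R" for z
      using F(4)[OF that] that by (simp add: G)
  qed
qed

lemma continuous_on_circle:
  assumes "continuous_on S f" "\<And>t. t \<in> A \<Longrightarrow> of_real r * cis t \<in> S"
  shows "continuous_on A (\<lambda>t. f (of_real r * cis t))"
  by (intro continuous_on_compose2[OF assms(1)] continuous_intros
        continuous_on_compose2[OF continuous_on_cis]) (use assms(2) in auto)

text \<open>The holomorphic majorant of \<open>cmod f powr q\<close> has the same modulus on the
  circle and dominates inside, so Poisson's formula for the majorant gives the sub-mean inequality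
  for f.\<close>

lemma subharmonic_norm_powr:
  fixes f :: "complex \<Rightarrow> complex"
  assumes f: "f holomorphic_on S" and S: "open S" "connected S" "cball 0 R \<subseteq> S" and w: "cmod w < R"
    and nz: "\<And>z. z \<in> sphere 0 R \<Longrightarrow> f z \<noteq> 0" and q: "0 < q"
  shows "2 * pi * cmod (f w) powr q \<le> integral {0..2*pi} (\<lambda>t. cmod (f (R * cis t)) powr q * poisson_kernel R w t)"
proof -
  have R: "R > 0" using w norm_ge_zero[of w] by linarith
  obtain G where G: "G holomorphic_on cball 0 R" "\<And>z. z \<in> cball 0 R \<Longrightarrow> cmod (f z) powr q \<le> cmod (G z)"
           "\<And>z. z \<in> sphere 0 R \<Longrightarrow> cmod (G z) = cmod (f z) powr q"
    using zero_free_power_majorant[OF f S R nz q] by blast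
  have cG: "continuous_on (cball 0 R) G" using G(1) by (rule holomorphic_on_imp_continuous_on)
  have P: "((\<lambda>t. G (R * cis t) * poisson_kernel R w t) has_integral 2 * pi * G w) {0..2*pi}"
    using cG holomorphic_on_subset[OF G(1)] w by (intro poisson_formula) auto
  have "2 * pi * cmod (f w) powr q \<le> 2 * pi * cmod (G w)" using G(2)[of w] w by simp
  also have "\<dots> = cmod (integral {0..2*pi} (\<lambda>t. G (R * cis t) * poisson_kernel R w t))"
    using P by (simp add: integral_unique norm_mult)
  also have "\<dots> \<le> integral {0..2*pi} (\<lambda>t. cmod (f (R * cis t)) powr q * poisson_kernel R w t)"
  proof (rule integral_norm_bound_integral)
    show "(\<lambda>t. G (R * cis t) * poisson_kernel R w t) integrable_on {0..2 * pi}"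
      using P by blast
    have eq: "cmod (f (R * cis t)) powr q = cmod (G (R * cis t))" for t
      using G(3)[of "R * cis t"] R by simp
    show "(\<lambda>t. cmod (f (R * cis t)) powr q * poisson_kernel R w t) integrable_on {0..2 * pi}"
      unfolding eq using w R
      by (intro integrable_continuous_interval continuous_intros continuous_on_circle[OF cG]) auto
    show "cmod (G (R * cis t) * poisson_kernel R w t) \<le> cmod (f (R * cis t)) powr q * poisson_kernel R w t"
      if "t \<in> {0..2*pi}" for t
      using poisson_kernel_nonneg[OF w] by (simp add: eq norm_mult)
  qed
  finally show ?thesis .
qed

text \<open>A smaller closed disc contains finitely many zeros, which excludes only finitely many
  radii. This supplies circles arbitrarily close to the unit circle on which
  \<open>subharmonic_norm_powr\<close> applies.\<close>

lemma zero_free_circle_exists: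
  fixes f :: "complex \<Rightarrow> complex"
  assumes f: "f holomorphic_on ball 0 1" and nz: "\<exists>w\<in>ball 0 1. f w \<noteq> 0" and r: "r < 1"
  obtains R where "r < R" "0 < R" "R < 1" "\<And>z. z \<in> sphere 0 R \<Longrightarrow> f z \<noteq> 0"
proof (cases "f constant_on ball 0 1")
  case True
  then obtain c where c: "\<And>z. z \<in> ball 0 1 \<Longrightarrow> f z = c" by (auto simp: constant_on_def)
  then have "c \<noteq> 0" using nz by auto
  let ?R = "(max r 0 + 1) / 2"
  show ?thesis using that[of ?R] c \<open>c \<noteq> 0\<close> r by auto
next
  case False
  define s where "s = (max r 0 + 1) / 2"
  have s: "r < s" "0 < s" "s < 1" "max r 0 < s" using r by (auto simp: s_def)
  have "finite {z \<in> cball 0 s. f z = 0}"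
    using s by (intro holomorphic_compact_finite_zeros[OF f _ _ _ _ False]) auto
  then have "finite (cmod ` {z \<in> cball 0 s. f z = 0})" by (rule finite_imageI)
  moreover have "infinite {max r 0<..<s}" using s(4) by (rule infinite_Ioo)
  ultimately have "\<not> {max r 0<..<s} \<subseteq> cmod ` {z \<in> cball 0 s. f z = 0}"
    using finite_subset by blast
  then obtain R where "R \<in> {max r 0<..<s}" "R \<notin> cmod ` {z \<in> cball 0 s. f z = 0}"
    by blast
  then show ?thesis using that[of R] s by force
qed

section \<open>Hardy spaces\<close>

abbreviation unit_disc :: "complex set" where
  "unit_disc \<equiv> ball 0 1"

lemma continuous_on_disc_circle:
  assumes "f holomorphic_on unit_disc" "\<bar>r\<bar> < 1"
  shows "continuous_on A (\<lambda>t. f (of_real r * cis t))"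
  by (rule continuous_on_circle[OF holomorphic_on_imp_continuous_on[OF assms(1)]]) (use assms(2) in auto)

lemma hardy_mean_integrable:
  assumes "f holomorphic_on unit_disc" "\<bar>r\<bar> < 1" "p > 0"
  shows "(\<lambda>t. cmod (f (of_real r * cis t)) powr p) integrable_on {0..2*pi}"
  by (intro integrable_continuous_interval continuous_on_powr' continuous_intros
        continuous_on_disc_circle assms) (use assms in auto)

lemma hardy_mean_nonneg: "0 \<le> hardy_mean p f r"
  unfolding hardy_mean_def
  by (cases "(\<lambda>\<theta>. cmod (f (of_real r * cis \<theta>)) powr p) integrable_on {0..2*pi}")
     (auto intro: integral_nonneg simp: not_integrable_integral)

lemma hardy_mean_mono:
  assumes "f holomorphic_on unit_disc" "g holomorphic_on unit_disc" "\<bar>r\<bar> < 1" "p > 0" "0 \<le> c"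
    and le: "\<And>z. cmod z = \<bar>r\<bar> \<Longrightarrow> cmod (f z) powr p \<le> c * cmod (g z) powr p"
  shows "hardy_mean p f r \<le> c * hardy_mean p g r"
proof -
  have "hardy_mean p f r \<le> integral {0..2*pi} (\<lambda>t. c * cmod (g (of_real r * cis t)) powr p)"
    unfolding hardy_mean_def
    by (intro integral_le hardy_mean_integrable assms integrable_on_mult_right)
       (use assms in auto)
  then show ?thesis by (simp add: hardy_mean_def)
qed

lemma hardy_mean_bounded:
  assumes "f holomorphic_on unit_disc" "\<bar>r\<bar> < 1" "p > 0"
    and le: "\<And>z. z \<in> unit_disc \<Longrightarrow> cmod (f z) \<le> C"
  shows "hardy_mean p f r \<le> 2 * pi * C powr p"
proof -
  have "hardy_mean p f r \<le> integral {0..2*pi} (\<lambda>t. C powr p)"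
    unfolding hardy_mean_def
    by (intro integral_le hardy_mean_integrable assms)
       (use assms in \<open>auto intro!: powr_mono2\<close>)
  then show ?thesis by simp
qed

text \<open>Comparison with twice the maximum replaces Minkowski's inequality. The worse constant is
  harmless, since only boundedness and smallness of means are ever used.\<close>

lemma norm_add_powr_le:
  fixes x y :: complex
  assumes "p > 0"
  shows "cmod (x + y) powr p \<le> 2 powr p * (cmod x powr p + cmod y powr p)"
proof -
  have "cmod (x + y) \<le> 2 * max (cmod x) (cmod y)"
    using norm_triangle_ineq[of x y] by linarith
  then have "cmod (x + y) powr p \<le> (2 * max (cmod x) (cmod y)) powr p"
    using assms by (intro powr_mono2) auto
  also have "\<dots> = 2 powr p * max (cmod x) (cmod y) powr p"
    by (simp add: powr_mult)
  also have "\<dots> \<le> 2 powr p * (cmod x powr p + cmod y powr p)"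
    by (intro mult_left_mono) (auto simp: max_def)
  finally show ?thesis .
qed

lemma hardy_mean_add_le:
  assumes "f holomorphic_on unit_disc" "g holomorphic_on unit_disc" "\<bar>r\<bar> < 1" "p > 0"
  shows "hardy_mean p (\<lambda>z. f z + g z) r \<le> 2 powr p * (hardy_mean p f r + hardy_mean p g r)"
proof -
  have "hardy_mean p (\<lambda>z. f z + g z) r \<le> integral {0..2*pi} (\<lambda>t. 2 powr p *
     (cmod (f (of_real r * cis t)) powr p + cmod (g (of_real r * cis t)) powr p))"
    unfolding hardy_mean_def
    by (intro integral_le hardy_mean_integrable[of "\<lambda>z. f z + g z"] assms norm_add_powr_le
        integrable_on_mult_right integrable_add hardy_mean_integrable holomorphic_intros)
  also have "\<dots> = 2 powr p * (hardy_mean p f r + hardy_mean p g r)"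
    unfolding hardy_mean_def integral_mult_right
    by (subst integral_add) (auto intro!: hardy_mean_integrable assms)
  finally show ?thesis .
qed

text \<open>Littlewood subordination: Poisson integrals dominate \<open>cmod f powr p\<close> at the
  points of the curve, their average along the curve is the value at \<open>\<phi> 0\<close>, and
  Harnack's bound for the kernel there finishes. The sub-mean inequality is a hypothesis because it
  has two sources: zero-free circles for general p, every circle for p = 2.\<close>

lemma hardy_mean_compose_le:
  assumes f: "f holomorphic_on unit_disc" and \<phi>: "\<phi> holomorphic_on unit_disc" and r: "0 < r" "r < 1" and p: "p > 0"
    and R: "R < 1" "\<And>z. z \<in> cball 0 r \<Longrightarrow> cmod (\<phi> z) < R"
    and sub: "\<And>w. cmod w < R \<Longrightarrow> 2 * pi * cmod (f w) powr p
       \<le> integral {0..2*pi} (\<lambda>t. cmod (f (R * cis t)) powr p * poisson_kernel R w t)"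
  shows "hardy_mean p (\<lambda>z. f (\<phi> z)) r \<le> (R + cmod (\<phi> 0)) / (R - cmod (\<phi> 0)) * hardy_mean p f R"
proof -
  have \<phi>0: "cmod (\<phi> 0) < R" using R(2)[of 0] r by simp
  then have R0: "0 < R" using norm_ge_zero[of "\<phi> 0"] by linarith
  define C where "C = (R + cmod (\<phi> 0)) / (R - cmod (\<phi> 0))"
  define g where "g = (\<lambda>t. cmod (f (R * cis t)) powr p)"
  have cg: "continuous_on {0..2*pi} g" unfolding g_def
    by (intro continuous_on_powr' continuous_intros continuous_on_disc_circle f)
       (use R p R0 in auto)
  have c\<phi>: "continuous_on (cball 0 r) \<phi>" "\<phi> holomorphic_on ball 0 r"
    using r by (auto intro!: holomorphic_on_imp_continuous_on holomorphic_on_subset[OF \<phi>])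
  have gP: "(\<lambda>t. g t * poisson_kernel R w t) integrable_on {0..2*pi}" if "cmod w < R" for w
    using that by (intro integrable_continuous_interval continuous_intros cg) auto
  have "2 * pi * hardy_mean p (\<lambda>z. f (\<phi> z)) r
      = integral {0..2*pi} (\<lambda>s. 2 * pi * cmod (f (\<phi> (r * cis s))) powr p)"
    by (simp add: hardy_mean_def)
  also have "\<dots> \<le> integral {0..2*pi} (\<lambda>s. integral {0..2*pi} (\<lambda>t. g t * poisson_kernel R (\<phi> (r * cis s)) t))"
  proof (intro integral_le integrable_continuous_interval)
    have im: "of_real r * cis s \<in> cball 0 r" for s using r by simp
    show "continuous_on {0..2*pi} (\<lambda>s. 2 * pi * cmod (f (\<phi> (r * cis s))) powr p)"
      using R r p less_trans[OF R(2)[OF im] R(1)]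
      by (intro continuous_on_powr' continuous_intros continuous_on_circle[OF c\<phi>(1)]
          continuous_on_compose2[OF holomorphic_on_imp_continuous_on[OF f]]) auto
    show "continuous_on {0..2*pi} (\<lambda>s. integral {0..2*pi} (\<lambda>t. g t * poisson_kernel R (\<phi> (r * cis s)) t))"
    proof -
      have "continuous_on ({0..2*pi} \<times> cbox 0 (2*pi)) (\<lambda>(s, t). g t * poisson_kernel R (\<phi> (r * cis s)) t)"
        unfolding split_def
        by (intro continuous_intros continuous_on_compose2[OF cg] continuous_on_compose2[OF c\<phi>(1)]
            continuous_on_compose2[OF continuous_on_cis]) (use R r in auto)
      then show ?thesis using integral_continuous_on_param[of "{0..2*pi}" 0 "2*pi"] by simp
    qed
    show "2 * pi * cmod (f (\<phi> (r * cis s))) powr p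
       \<le> integral {0..2*pi} (\<lambda>t. g t * poisson_kernel R (\<phi> (r * cis s)) t)" for s
      using sub[OF R(2)[OF im]] by (simp add: g_def)
  qed
  also have "\<dots> = 2 * pi * integral {0..2*pi} (\<lambda>t. g t * poisson_kernel R (\<phi> 0) t)"
    by (rule poisson_integral_mean) (use c\<phi> r R cg in auto)
  also have "integral {0..2*pi} (\<lambda>t. g t * poisson_kernel R (\<phi> 0) t) \<le> integral {0..2*pi} (\<lambda>t. C * g t)"
  proof (intro integral_le gP \<phi>0 integrable_continuous_interval continuous_intros cg)
    show "g t * poisson_kernel R (\<phi> 0) t \<le> C * g t" for t
      using mult_left_mono[OF poisson_kernel_le[OF \<phi>0, of t], of "g t"]
      by (simp add: C_def g_def mult.commute)
  qed
  also have "integral {0..2*pi} (\<lambda>t. C * g t) = C * hardy_mean p f R"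
    by (simp add: hardy_mean_def g_def)
  finally have "2 * pi * hardy_mean p (\<lambda>z. f (\<phi> z)) r \<le> 2 * pi * (C * hardy_mean p f R)"
    by simp
  then show ?thesis unfolding C_def[symmetric] by (rule mult_left_le_imp_le) simp
qed

lemma hardy_mean_compose_bound:
  assumes f: "f holomorphic_on unit_disc" and \<phi>: "\<phi> holomorphic_on unit_disc" "\<phi> \<in> unit_disc \<rightarrow> unit_disc"
    and r: "0 < r" "r < 1" and p: "p > 0"
    and M: "\<And>r. r \<in> {0<..<1} \<Longrightarrow> hardy_mean p f r \<le> M"
  shows "hardy_mean p (\<lambda>z. f (\<phi> z)) r \<le> 4 / (1 - cmod (\<phi> 0)) * M"
proof (cases "\<exists>w\<in>unit_disc. f w \<noteq> 0")
  case False
  have \<phi>0: "cmod (\<phi> 0) < 1" using funcset_mem[OF \<phi>(2), of 0] by simp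
  have "hardy_mean p (\<lambda>z. f (\<phi> z)) r = integral {0..2*pi} (\<lambda>t. 0)"
    unfolding hardy_mean_def
  proof (intro integral_cong)
    fix t have "\<phi> (r * cis t) \<in> unit_disc" using r by (intro funcset_mem[OF \<phi>(2)]) auto
    then show "cmod (f (\<phi> (r * cis t))) powr p = 0" using False by auto
  qed
  also have "\<dots> \<le> 4 / (1 - cmod (\<phi> 0)) * M"
    using M[of "1/2"] hardy_mean_nonneg[of p f "1/2"] \<phi>0 by auto
  finally show ?thesis .
next
  case True
  have \<phi>0: "cmod (\<phi> 0) < 1" using funcset_mem[OF \<phi>(2), of 0] by simp
  have "compact (\<phi> ` cball 0 r)"
    using r by (intro compact_continuous_image holomorphic_on_imp_continuous_on
       holomorphic_on_subset[OF \<phi>(1)]) auto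
  moreover have "\<phi> ` cball 0 r \<noteq> {}" using r by auto
  moreover have "continuous_on (\<phi> ` cball 0 r) cmod" by (intro continuous_intros)
  ultimately obtain z0 where z0: "z0 \<in> cball 0 r" "\<And>z. z \<in> cball 0 r \<Longrightarrow> cmod (\<phi> z) \<le> cmod (\<phi> z0)"
    using continuous_attains_sup[of "\<phi> ` cball 0 r" cmod] by auto
  have "\<phi> z0 \<in> unit_disc" using z0 r by (intro funcset_mem[OF \<phi>(2)]) auto
  \<comment> \<open>Besides enclosing the image of the closed disc, the radius is kept above
    \<open>(1 + cmod (\<phi> 0)) / 2\<close>. Then \<open>R - cmod (\<phi> 0)\<close> is at least
    half of \<open>1 - cmod (\<phi> 0)\<close>, which produces the constant 4.\<close>
  then have "max (cmod (\<phi> z0)) ((1 + cmod (\<phi> 0)) / 2) < 1" using \<phi>0 by auto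
  then obtain R where R: "max (cmod (\<phi> z0)) ((1 + cmod (\<phi> 0)) / 2) < R" "0 < R" "R < 1"
     "\<And>z. z \<in> sphere 0 R \<Longrightarrow> f z \<noteq> 0"
    using zero_free_circle_exists[OF f True] by metis
  have "hardy_mean p (\<lambda>z. f (\<phi> z)) r \<le> (R + cmod (\<phi> 0)) / (R - cmod (\<phi> 0)) * hardy_mean p f R"
  proof (rule hardy_mean_compose_le[OF f \<phi>(1) r p R(3)])
    show "cmod (\<phi> z) < R" if "z \<in> cball 0 r" for z using z0(2)[OF that] R(1) by linarith
    show "2 * pi * cmod (f w) powr p \<le> integral {0..2*pi} (\<lambda>t. cmod (f (R * cis t)) powr p * poisson_kernel R w t)"
      if "cmod w < R" for w
      by (rule subharmonic_norm_powr[OF f]) (use R p that in auto)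
  qed
  also have "\<dots> \<le> 4 / (1 - cmod (\<phi> 0)) * M"
  proof (rule mult_mono)
    have "(R + cmod (\<phi> 0)) / (R - cmod (\<phi> 0)) \<le> 2 / ((1 - cmod (\<phi> 0)) / 2)"
      using R \<phi>0 by (intro frac_le) auto
    then show "(R + cmod (\<phi> 0)) / (R - cmod (\<phi> 0)) \<le> 4 / (1 - cmod (\<phi> 0))" by simp
  qed (use R \<phi>0 M hardy_mean_nonneg in auto)
  finally show ?thesis .
qed

text \<open>Means are controlled only for radii above \<open>r0\<close>, because the bound is later
  applied to a quotient by a Blaschke product, which is bounded below only near the circle.\<close>

lemma hardy_point_bound:
  assumes f: "f holomorphic_on unit_disc" and w: "cmod w < 1" and p: "p > 0" and r0: "r0 < 1"
    and M: "\<And>r. r0 < r \<Longrightarrow> 0 < r \<Longrightarrow> r < 1 \<Longrightarrow> hardy_mean p f r \<le> M"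
  shows "cmod (f w) powr p \<le> 4 / (1 - cmod w) * M"
proof (cases "f w = 0")
  case True
  obtain r where "max r0 0 < r" "r < 1" using r0 dense[of "max r0 0" 1] by auto
  then have "0 \<le> M" using M[of r] hardy_mean_nonneg[of p f r] by auto
  then show ?thesis using True w by simp
next
  case False
  then have True: "\<exists>w\<in>unit_disc. f w \<noteq> 0" using w by auto
  have "max r0 ((1 + cmod w) / 2) < 1" using w r0 by auto
  then obtain R where R: "max r0 ((1 + cmod w) / 2) < R" "0 < R" "R < 1"
     "\<And>z. z \<in> sphere 0 R \<Longrightarrow> f z \<noteq> 0"
    using zero_free_circle_exists[OF f True] by metis
  have "(1 + cmod w) / 2 < R" using R(1) by simp
  moreover have "cmod w < (1 + cmod w) / 2" using w by simp
  ultimately have wR: "cmod w < R" by (rule less_trans[rotated])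
  have "2 * pi * cmod (f w) powr p \<le> integral {0..2*pi} (\<lambda>t. cmod (f (R * cis t)) powr p * poisson_kernel R w t)"
    by (rule subharmonic_norm_powr[OF f]) (use R p wR in auto)
  also have "\<dots> \<le> integral {0..2*pi} (\<lambda>t. cmod (f (R * cis t)) powr p * (4 / (1 - cmod w)))"
  proof (intro integral_le mult_left_mono)
    show "(\<lambda>t. cmod (f (R * cis t)) powr p * (4 / (1 - cmod w))) integrable_on {0..2*pi}"
      using R by (intro integrable_on_mult_left hardy_mean_integrable f p) auto
    show "(\<lambda>t. cmod (f (R * cis t)) powr p * poisson_kernel R w t) integrable_on {0..2*pi}"
      by (intro integrable_continuous_interval continuous_on_powr' continuous_intros continuous_on_disc_circle f)
         (use R p wR in auto)
    have "(R + cmod w) / (R - cmod w) \<le> 2 / ((1 - cmod w) / 2)"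
      using R w by (intro frac_le) auto
    then show "poisson_kernel R w t \<le> 4 / (1 - cmod w)" for t
      using poisson_kernel_le[OF wR, of t] by simp
  qed auto
  also have "\<dots> = hardy_mean p f R * (4 / (1 - cmod w))"
    unfolding hardy_mean_def by (rule integral_mult_left)
  also have "\<dots> \<le> M * (4 / (1 - cmod w))"
    using M[of R] R w by (intro mult_right_mono) auto
  finally have le: "2 * pi * cmod (f w) powr p \<le> 4 / (1 - cmod w) * M" by (simp add: mult.commute)
  have "1 * cmod (f w) powr p \<le> 2 * pi * cmod (f w) powr p"
    using pi_ge_two by (intro mult_right_mono) auto
  then show ?thesis using le by linarith
qed

section \<open>Square means: monotonicity in the radius and the parallelogram law\<close>

lemma hardy_mean_two: "hardy_mean 2 f r = integral {0..2*pi} (\<lambda>t. (cmod (f (of_real r * cis t)))\<^sup>2)"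
  unfolding hardy_mean_def by (intro integral_cong) simp

text \<open>Subordination with the identity map: it fixes 0, so the Harnack factor is 1. As
  \<open>f\<^sup>2\<close> is holomorphic, Poisson's formula gives the sub-mean inequality on every
  circle, with or without zeros.\<close>

lemma hardy_mean_two_mono:
  assumes f: "f holomorphic_on unit_disc" and r: "0 < r" "r \<le> R" "R < 1"
  shows "hardy_mean 2 f r \<le> hardy_mean 2 f R"
proof (cases "r = R")
  case False
  then have rR: "r < R" using r by simp
  have "hardy_mean 2 (\<lambda>z. f (z)) r \<le> (R + cmod 0) / (R - cmod 0) * hardy_mean 2 f R"
  proof (rule hardy_mean_compose_le[OF f])
    fix w :: complex assume w: "cmod w < R"
    have P: "((\<lambda>t. (f (R * cis t))\<^sup>2 * poisson_kernel R w t) has_integral 2 * pi * (f w)\<^sup>2) {0..2*pi}"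
      using r w by (intro poisson_formula holomorphic_on_imp_continuous_on holomorphic_intros
           holomorphic_on_subset[OF f]) auto
    have "2 * pi * cmod (f w) powr 2 = cmod (integral {0..2*pi} (\<lambda>t. (f (R * cis t))\<^sup>2 * poisson_kernel R w t))"
      using P by (simp add: integral_unique norm_mult norm_power)
    also have "\<dots> \<le> integral {0..2*pi} (\<lambda>t. cmod (f (R * cis t)) powr 2 * poisson_kernel R w t)"
    proof (rule integral_norm_bound_integral)
      show "(\<lambda>t. (f (R * cis t))\<^sup>2 * poisson_kernel R w t) integrable_on {0..2 * pi}"
        using P by blast
      show "(\<lambda>t. cmod (f (R * cis t)) powr 2 * poisson_kernel R w t) integrable_on {0..2*pi}"
        by (intro integrable_continuous_interval continuous_on_powr' continuous_intros continuous_on_disc_circle f)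
           (use r w in auto)
      show "cmod ((f (R * cis t))\<^sup>2 * poisson_kernel R w t) \<le> cmod (f (R * cis t)) powr 2 * poisson_kernel R w t" for t
        using poisson_kernel_nonneg[OF w] by (simp add: norm_mult norm_power)
    qed
    finally show "2 * pi * cmod (f w) powr 2 \<le> integral {0..2*pi} (\<lambda>t. cmod (f (R * cis t)) powr 2 * poisson_kernel R w t)" .
  qed (use r rR in auto)
  then show ?thesis using r by simp
qed auto

lemma hardy_mean_parallelogram:
  assumes f: "f holomorphic_on unit_disc" and g: "g holomorphic_on unit_disc" and r: "0 < r" "r < 1"
  shows "hardy_mean 2 (\<lambda>z. f z + g z) r + hardy_mean 2 (\<lambda>z. f z - g z) r
    = 2 * hardy_mean 2 f r + 2 * hardy_mean 2 g r"
proof -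
  have int: "(\<lambda>t. (cmod (h (of_real r * cis t)))\<^sup>2) integrable_on {0..2*pi}" if "h holomorphic_on unit_disc" for h
    using hardy_mean_integrable[OF that, of r 2] r by simp
  have "hardy_mean 2 (\<lambda>z. f z + g z) r + hardy_mean 2 (\<lambda>z. f z - g z) r =
     integral {0..2*pi} (\<lambda>t. (cmod (f (of_real r * cis t) + g (of_real r * cis t)))\<^sup>2 +
                             (cmod (f (of_real r * cis t) - g (of_real r * cis t)))\<^sup>2)"
    unfolding hardy_mean_two
    by (intro integral_add[symmetric] int[of "\<lambda>z. f z + g z"] int[of "\<lambda>z. f z - g z"] holomorphic_intros f g)
  also have "\<dots> = integral {0..2*pi} (\<lambda>t. 2 * (cmod (f (of_real r * cis t)))\<^sup>2 + 2 * (cmod (g (of_real r * cis t)))\<^sup>2)"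
    by (intro integral_cong) (simp add: power2_norm_eq_inner inner_add inner_diff inner_commute algebra_simps)
  also have "\<dots> = 2 * hardy_mean 2 f r + 2 * hardy_mean 2 g r"
    unfolding hardy_mean_two
    by (subst integral_add) (auto intro!: integrable_on_mult_right int f g)
  finally show ?thesis .
qed

section \<open>Hardy norms, point evaluations, composition and multiplication operators\<close>

lemma hardy_spaceI:
  assumes "f holomorphic_on unit_disc" "\<And>z. z \<notin> unit_disc \<Longrightarrow> f z = 0"
    "\<And>r. 0 < r \<Longrightarrow> r < 1 \<Longrightarrow> hardy_mean p f r \<le> M"
  shows "f \<in> hardy_space p"
  using assms by (auto simp: hardy_space_def intro!: bdd_aboveI2[where M = M])

lemma hardy_space_holomorphic: "f \<in> hardy_space p \<Longrightarrow> f holomorphic_on unit_disc"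
  and hardy_space_outside: "f \<in> hardy_space p \<Longrightarrow> z \<notin> unit_disc \<Longrightarrow> f z = 0"
  by (auto simp: hardy_space_def)

lemma hardy_norm_nonneg: "0 \<le> hardy_norm p f"
  by (simp add: hardy_norm_def)

lemma hardy_norm_le:
  assumes "p > 0" "\<And>r. 0 < r \<Longrightarrow> r < 1 \<Longrightarrow> hardy_mean p f r \<le> M"
  shows "hardy_norm p f \<le> M powr (1 / p)"
proof -
  have ne: "{0<..<1::real} \<noteq> {}" by simp
  have "0 \<le> hardy_mean p f (1/2)" by (rule hardy_mean_nonneg)
  also have "\<dots> \<le> (SUP r\<in>{0<..<1}. hardy_mean p f r)"
    using assms by (intro cSUP_upper bdd_aboveI2[where M = M]) auto
  finally have "0 \<le> (SUP r\<in>{0<..<1}. hardy_mean p f r)" .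
  moreover have "(SUP r\<in>{0<..<1}. hardy_mean p f r) \<le> M"
    using assms by (intro cSUP_least ne) auto
  ultimately show ?thesis
    unfolding hardy_norm_def using assms(1) by (intro powr_mono2) auto
qed

lemma hardy_mean_le_norm:
  assumes "f \<in> hardy_space p" "0 < r" "r < 1" "p > 0"
  shows "hardy_mean p f r \<le> hardy_norm p f powr p"
proof -
  have le: "hardy_mean p f r \<le> (SUP r\<in>{0<..<1}. hardy_mean p f r)"
    using assms by (intro cSUP_upper) (auto simp: hardy_space_def)
  moreover have "0 \<le> (SUP r\<in>{0<..<1}. hardy_mean p f r)"
    using le hardy_mean_nonneg[of p f r] by linarith
  ultimately show ?thesis using assms(4) by (simp add: hardy_norm_def powr_powr)
qed

lemma hardy_norm_le_mult:
  assumes "p > 0" "0 \<le> C" "\<And>r. 0 < r \<Longrightarrow> r < 1 \<Longrightarrow> hardy_mean p f r \<le> C * hardy_norm p g powr p"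
  shows "hardy_norm p f \<le> C powr (1 / p) * hardy_norm p g"
proof -
  have "hardy_norm p f \<le> (C * hardy_norm p g powr p) powr (1 / p)"
    by (rule hardy_norm_le[OF assms(1,3)])
  also have "\<dots> = C powr (1 / p) * hardy_norm p g"
    using assms(1,2) by (simp add: powr_mult powr_powr hardy_norm_nonneg)
  finally show ?thesis .
qed

lemma hardy_space_add:
  assumes "f \<in> hardy_space p" "g \<in> hardy_space p" "p > 0"
  shows "(\<lambda>z. f z + g z) \<in> hardy_space p"
    and "hardy_norm p (\<lambda>z. f z + g z) powr p \<le> 2 powr p * (hardy_norm p f powr p + hardy_norm p g powr p)"
proof -
  let ?M = "2 powr p * (hardy_norm p f powr p + hardy_norm p g powr p)"
  have le: "hardy_mean p (\<lambda>z. f z + g z) r \<le> ?M" if "0 < r" "r < 1" for r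
  proof -
    have "hardy_mean p (\<lambda>z. f z + g z) r \<le> 2 powr p * (hardy_mean p f r + hardy_mean p g r)"
      using that assms by (intro hardy_mean_add_le) (auto simp: hardy_space_def)
    also have "\<dots> \<le> ?M"
      using that assms by (intro mult_left_mono add_mono hardy_mean_le_norm) auto
    finally show ?thesis .
  qed
  show "(\<lambda>z. f z + g z) \<in> hardy_space p"
    by (rule hardy_spaceI[OF _ _ le])
       (use assms in \<open>auto intro!: holomorphic_intros simp: hardy_space_def\<close>)
  have "hardy_norm p (\<lambda>z. f z + g z) powr p \<le> (?M powr (1 / p)) powr p"
    using assms by (intro powr_mono2 hardy_norm_le le hardy_norm_nonneg) auto
  also have "\<dots> = ?M" using assms by (simp add: powr_powr)
  finally show "hardy_norm p (\<lambda>z. f z + g z) powr p \<le> ?M" .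
qed

lemma hardy_space_mult_bounded:
  assumes f: "f \<in> hardy_space p" and g: "g holomorphic_on unit_disc" "\<And>z. z \<in> unit_disc \<Longrightarrow> cmod (g z) \<le> C"
    and p: "p > 0"
  shows "(\<lambda>z. g z * f z) \<in> hardy_space p"
    and "hardy_norm p (\<lambda>z. g z * f z) \<le> C * hardy_norm p f"
proof -
  have C: "0 \<le> C" using order_trans[OF norm_ge_zero g(2)[of 0]] by simp
  have le: "hardy_mean p (\<lambda>z. g z * f z) r \<le> C powr p * hardy_norm p f powr p" if r: "0 < r" "r < 1" for r
  proof -
    have "hardy_mean p (\<lambda>z. g z * f z) r \<le> C powr p * hardy_mean p f r"
    proof (rule hardy_mean_mono)
      show "cmod (g z * f z) powr p \<le> C powr p * cmod (f z) powr p" if "cmod z = \<bar>r\<bar>" for z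
        using g(2)[of z] p that r C by (auto simp: norm_mult powr_mult intro!: mult_right_mono powr_mono2)
    qed (use f g p r in \<open>auto intro!: holomorphic_intros simp: hardy_space_def\<close>)
    also have "\<dots> \<le> C powr p * hardy_norm p f powr p"
      by (intro mult_left_mono hardy_mean_le_norm f r p) auto
    finally show ?thesis .
  qed
  show "(\<lambda>z. g z * f z) \<in> hardy_space p"
    by (rule hardy_spaceI[OF _ _ le])
       (use f g in \<open>auto intro!: holomorphic_intros simp: hardy_space_def\<close>)
  have "hardy_norm p (\<lambda>z. g z * f z) \<le> (C powr p) powr (1 / p) * hardy_norm p f"
    by (rule hardy_norm_le_mult[OF p _ le]) auto
  then show "hardy_norm p (\<lambda>z. g z * f z) \<le> C * hardy_norm p f"
    using p C by (simp add: powr_powr)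
qed

lemma hardy_space_scale:
  assumes f: "f \<in> hardy_space p" and p: "p > 0"
  shows "(\<lambda>z. c * f z) \<in> hardy_space p"
    and "hardy_norm p (\<lambda>z. c * f z) \<le> cmod c * hardy_norm p f"
  using hardy_space_mult_bounded[OF f, of "\<lambda>_. c" "cmod c"] p by auto

lemma hardy_point_le_norm:
  assumes f: "f \<in> hardy_space p" and p: "p > 0" and w: "cmod w < 1"
  shows "cmod (f w) \<le> (4 / (1 - cmod w)) powr (1 / p) * hardy_norm p f"
proof -
  have "cmod (f w) powr p \<le> 4 / (1 - cmod w) * hardy_norm p f powr p"
    by (rule hardy_point_bound[where ?r0.0 = 0, OF hardy_space_holomorphic[OF f] w p])
       (auto intro!: hardy_mean_le_norm f p)
  then have "(cmod (f w) powr p) powr (1 / p) \<le> (4 / (1 - cmod w) * hardy_norm p f powr p) powr (1 / p)"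
    using p by (intro powr_mono2) auto
  also have "\<dots> = (4 / (1 - cmod w)) powr (1 / p) * (hardy_norm p f powr p) powr (1 / p)"
    by (rule powr_mult)
  also have "(hardy_norm p f powr p) powr (1 / p) = hardy_norm p f"
    using p by (simp add: powr_powr hardy_norm_nonneg)
  finally show ?thesis using p by (simp add: powr_powr)
qed

text \<open>Points outside the disc are included: under extension by 0 the evaluation there is the
  zero functional, which saves case distinctions when functions are compared pointwise.\<close>

lemma point_evaluation_bounded:
  assumes p: "p > 0"
  shows "(\<lambda>f. f w) \<in> bounded_functionals (hardy_space p) (hardy_norm p)"
proof (cases "cmod w < 1")
  case True
  then show ?thesis using hardy_point_le_norm[OF _ p] by (auto simp: bounded_functionals_def)
next
  case False
  then have "f w = 0" if "f \<in> hardy_space p" for f using hardy_space_outside[OF that, of w] by simp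
  then show ?thesis by (auto simp: bounded_functionals_def intro!: exI[of _ 0])
qed

lemma hardy_space_compose:
  assumes f: "f \<in> hardy_space p" and \<phi>: "\<phi> holomorphic_on unit_disc" "\<phi> \<in> unit_disc \<rightarrow> unit_disc" and p: "p > 0"
  defines "g \<equiv> \<lambda>z. if z \<in> unit_disc then f (\<phi> z) else 0"
  shows "g \<in> hardy_space p"
    and "hardy_norm p g \<le> (4 / (1 - cmod (\<phi> 0))) powr (1 / p) * hardy_norm p f"
proof -
  have \<phi>0: "cmod (\<phi> 0) < 1" using funcset_mem[OF \<phi>(2), of 0] by simp
  have hol: "(\<lambda>z. f (\<phi> z)) holomorphic_on unit_disc"
    using holomorphic_on_compose_gen[OF \<phi>(1) hardy_space_holomorphic[OF f]] \<phi>(2) by (auto simp: o_def)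
  have eq: "hardy_mean p g r = hardy_mean p (\<lambda>z. f (\<phi> z)) r" if "0 < r" "r < 1" for r
    unfolding hardy_mean_def using that by (intro integral_cong) (auto simp: g_def)
  have le: "hardy_mean p g r \<le> 4 / (1 - cmod (\<phi> 0)) * hardy_norm p f powr p" if r: "0 < r" "r < 1" for r
    unfolding eq[OF r]
    by (rule hardy_mean_compose_bound[OF hardy_space_holomorphic[OF f] \<phi> r p])
       (use hardy_mean_le_norm[OF f _ _ p] in auto)
  have "g holomorphic_on unit_disc"
    by (rule holomorphic_transform[OF hol]) (simp add: g_def)
  then show "g \<in> hardy_space p"
    by (rule hardy_spaceI[OF _ _ le]) (simp_all add: g_def)
  show "hardy_norm p g \<le> (4 / (1 - cmod (\<phi> 0))) powr (1 / p) * hardy_norm p f"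
    using \<phi>0 by (intro hardy_norm_le_mult p le) auto
qed

lemma composition_op_bounded:
  assumes \<phi>: "\<phi> holomorphic_on unit_disc" "\<phi> \<in> unit_disc \<rightarrow> unit_disc" and p: "p > 0"
  shows "composition_op p \<phi> \<in> bounded_ops (hardy_space p) (hardy_norm p)"
proof -
  have "composition_op p \<phi> \<in> linear_ops_on (hardy_space p)"
    unfolding linear_ops_on_def composition_op_def
    using hardy_space_compose(1)[OF _ \<phi> p] hardy_space_add(1)[OF _ _ p] hardy_space_scale(1)[OF _ p]
    by (auto simp: fun_eq_iff)
  moreover have "\<forall>f\<in>hardy_space p. hardy_norm p (composition_op p \<phi> f)
      \<le> (4 / (1 - cmod (\<phi> 0))) powr (1 / p) * hardy_norm p f"
    using hardy_space_compose(2)[OF _ \<phi> p] by (simp add: composition_op_def)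
  ultimately show ?thesis unfolding bounded_ops_def by blast
qed

text \<open>\<open>g\<close> may take any values outside the disc, where \<open>f\<close> already
  vanishes; so an exponential of the Koenigs function can be used as it stands.\<close>

definition multiplication_op :: "real \<Rightarrow> (complex \<Rightarrow> complex) \<Rightarrow> (complex \<Rightarrow> complex) \<Rightarrow> complex \<Rightarrow> complex" where
  "multiplication_op p g = (\<lambda>f\<in>hardy_space p. \<lambda>z. g z * f z)"

lemma multiplication_op_bounded:
  assumes g: "g holomorphic_on unit_disc" "\<And>z. z \<in> unit_disc \<Longrightarrow> cmod (g z) \<le> C" and p: "p > 0"
  shows "multiplication_op p g \<in> bounded_ops (hardy_space p) (hardy_norm p)"
proof -
  have "multiplication_op p g \<in> linear_ops_on (hardy_space p)"
    unfolding linear_ops_on_def multiplication_op_def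
    using hardy_space_mult_bounded(1)[OF _ g p] hardy_space_add(1)[OF _ _ p] hardy_space_scale(1)[OF _ p]
    by (auto simp: fun_eq_iff algebra_simps)
  moreover have "\<forall>f\<in>hardy_space p. hardy_norm p (multiplication_op p g f) \<le> C * hardy_norm p f"
    using hardy_space_mult_bounded(2)[OF _ g p] by (simp add: multiplication_op_def)
  ultimately show ?thesis unfolding bounded_ops_def by blast
qed

section \<open>Bounded analytic functions and the Blaschke condition\<close>

definition bounded_analytic :: "(complex \<Rightarrow> complex) set" where
  "bounded_analytic = {f. f holomorphic_on unit_disc \<and> (\<forall>z. z \<notin> unit_disc \<longrightarrow> f z = 0) \<and>
     (\<exists>C. \<forall>z\<in>unit_disc. cmod (f z) \<le> C)}"

lemma bounded_analytic_hardy: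
  assumes "f \<in> bounded_analytic" "p > 0"
  shows "f \<in> hardy_space p"
proof -
  obtain C where f: "f holomorphic_on unit_disc" "\<And>z. z \<notin> unit_disc \<Longrightarrow> f z = 0"
    "\<And>z. z \<in> unit_disc \<Longrightarrow> cmod (f z) \<le> C"
    using assms(1) unfolding bounded_analytic_def by blast
  show ?thesis
    by (rule hardy_spaceI[OF f(1,2) hardy_mean_bounded[OF f(1) _ assms(2) f(3)]]) auto
qed

text \<open>Each point of \<open>Z\<close> contributes one factor, whatever the multiplicity of the
  zero. The factors removed so far do not vanish at the new point \<open>a\<close>, so the quotient
  still does.\<close>

lemma blaschke_divide:
  fixes f :: "complex \<Rightarrow> complex"
  assumes "finite Z" "Z \<subseteq> unit_disc" "f holomorphic_on unit_disc" "\<And>a. a \<in> Z \<Longrightarrow> f a = 0"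
  shows "\<exists>g. g holomorphic_on unit_disc \<and> (\<forall>z\<in>unit_disc. f z = (\<Prod>a\<in>Z. (z - a) / (1 - cnj a * z)) * g z)"
  using assms
proof (induction Z rule: finite_induct)
  case empty
  then show ?case by (intro exI[of _ f]) simp
next
  case (insert a Z)
  then obtain g where g: "g holomorphic_on unit_disc"
    "\<And>z. z \<in> unit_disc \<Longrightarrow> f z = (\<Prod>a\<in>Z. (z - a) / (1 - cnj a * z)) * g z"
    using insert.IH[OF _ insert.prems(2)] insert.prems by blast
  have nz: "1 - cnj b * z \<noteq> 0" if "b \<in> insert a Z" "z \<in> unit_disc" for b z
    using blaschke_denominator_nonzero[of b 1 z] that insert.prems by auto
  have aD: "a \<in> unit_disc" using insert.prems by auto
  have "(\<Prod>b\<in>Z. (a - b) / (1 - cnj b * a)) \<noteq> 0"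
    using insert.hyps nz aD by (auto simp: prod_zero_iff)
  then have ga: "g a = 0" using g(2)[OF aD] insert.prems by auto
  define g1 where "g1 = (\<lambda>z. if z = a then deriv g a else (g z - g a) / (z - a))"
  have g1: "g1 holomorphic_on unit_disc" unfolding g1_def by (rule pole_lemma_open[OF g(1)]) simp
  have gg: "g z = (z - a) * g1 z" for z by (auto simp: g1_def ga)
  show ?case
  proof (intro exI[of _ "\<lambda>z. (1 - cnj a * z) * g1 z"] conjI ballI)
    show "(\<lambda>z. (1 - cnj a * z) * g1 z) holomorphic_on unit_disc" by (intro holomorphic_intros g1)
    fix z :: complex assume z: "z \<in> unit_disc"
    then show "f z = (\<Prod>a\<in>insert a Z. (z - a) / (1 - cnj a * z)) * ((1 - cnj a * z) * g1 z)"
      using g(2)[OF z] gg[of z] nz[of a z] insert.hyps by simp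
  qed
qed

text \<open>The product is continuous on the closed disc and unimodular on the circle, so uniform
  continuity keeps its modulus above 1/2 in a thin annulus.\<close>

lemma finite_blaschke_near_circle:
  assumes "finite Z" "Z \<subseteq> unit_disc"
  obtains r0 where "r0 < 1" "\<And>z. r0 < cmod z \<Longrightarrow> cmod z < 1 \<Longrightarrow> 1/2 \<le> cmod (\<Prod>a\<in>Z. (z - a) / (1 - cnj a * z))"
proof -
  define B where "B = (\<lambda>z. \<Prod>a\<in>Z. (z - a) / (1 - cnj a * z))"
  have nz: "1 - cnj b * z \<noteq> 0" if "b \<in> Z" "cmod z \<le> 1" for b z
    using blaschke_denominator_nonzero[of b 1 z] that assms by auto
  have "continuous_on (cball 0 1) B" unfolding B_def
    using nz by (intro continuous_intros) auto
  then have "uniformly_continuous_on (cball 0 1) B"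
    by (intro compact_uniformly_continuous) auto
  then have "\<exists>d>0. \<forall>x\<in>cball 0 1. \<forall>y\<in>cball 0 1. dist y x < d \<longrightarrow> dist (B y) (B x) < 1/2"
    unfolding uniformly_continuous_on_def by (elim allE[of _ "1/2"]) simp
  then obtain d where d: "d > 0" "\<And>x y. x \<in> cball 0 1 \<Longrightarrow> y \<in> cball 0 1 \<Longrightarrow> dist y x < d \<Longrightarrow> dist (B y) (B x) < 1/2"
    by blast
  have B1: "cmod (B z) = 1" if "cmod z = 1" for z
    unfolding B_def prod_norm[symmetric]
  proof (rule prod.neutral, rule ballI)
    fix a assume "a \<in> Z"
    then have "1 - cnj a * z \<noteq> 0" "z \<noteq> a" using nz[of a z] that assms(2) by auto
    then show "cmod ((z - a) / (1 - cnj a * z)) = 1"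
      using blaschke_factor_eq[of z 1 a] that by (simp add: norm_divide)
  qed
  show ?thesis
  proof (rule that[of "max 0 (1 - d)"])
    show "max 0 (1 - d) < 1" using d by auto
    fix z assume z: "max 0 (1 - d) < cmod z" "cmod z < 1"
    \<comment> \<open>\<open>sgn z\<close> is the radial projection of \<open>z\<close> to the unit
      circle, at distance \<open>1 - cmod z\<close>.\<close>
    have "sgn z * of_real (cmod z) = z" using z by (auto simp: sgn_eq)
    then have "sgn z - z = sgn z * of_real (1 - cmod z)"
      by (simp add: right_diff_distrib)
    then have "dist (sgn z) z = cmod (sgn z) * \<bar>1 - cmod z\<bar>"
      unfolding dist_norm by (simp only: norm_mult norm_of_real)
    then have "dist (sgn z) z = 1 - cmod z" using z by (auto simp: norm_sgn)
    then have "dist (B (sgn z)) (B z) < 1/2"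
      using z by (intro d) (auto simp: norm_sgn)
    moreover have "cmod (B (sgn z)) = 1" using z by (intro B1) (auto simp: norm_sgn)
    ultimately have "1/2 \<le> cmod (B z)"
      unfolding dist_norm using norm_triangle_ineq2[of "B (sgn z)" "B z"] by linarith
    then show "1/2 \<le> cmod (\<Prod>a\<in>Z. (z - a) / (1 - cnj a * z))"
      by (simp only: B_def)
  qed
qed

text \<open>A weak form of Jensen's inequality. Division by the Blaschke product costs at most the
  factor \<open>2 powr p\<close> in the means near the circle, and the quotient is then estimated at
  0. The constant does not depend on \<open>Z\<close>, so the zero set may grow.\<close>

lemma blaschke_product_bound:
  fixes f :: "complex \<Rightarrow> complex"
  assumes f: "f holomorphic_on unit_disc" and p: "p > 0" and r1: "r1 < 1"
    and M: "\<And>r. r1 < r \<Longrightarrow> 0 < r \<Longrightarrow> r < 1 \<Longrightarrow> hardy_mean p f r \<le> M"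
    and Z: "finite Z" "Z \<subseteq> unit_disc" "\<And>a. a \<in> Z \<Longrightarrow> f a = 0"
  shows "cmod (f 0) powr p \<le> (\<Prod>a\<in>Z. cmod a) powr p * (4 * 2 powr p * M)"
proof -
  obtain g where g: "g holomorphic_on unit_disc"
    "\<And>z. z \<in> unit_disc \<Longrightarrow> f z = (\<Prod>a\<in>Z. (z - a) / (1 - cnj a * z)) * g z"
    using blaschke_divide[OF Z(1,2) f Z(3)] by blast
  obtain r0 where r0: "r0 < 1" "\<And>z. r0 < cmod z \<Longrightarrow> cmod z < 1 \<Longrightarrow> 1/2 \<le> cmod (\<Prod>a\<in>Z. (z - a) / (1 - cnj a * z))"
    using finite_blaschke_near_circle[OF Z(1,2)] by blast
  have "cmod (g 0) powr p \<le> 4 / (1 - cmod 0) * (2 powr p * M)"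
  proof (rule hardy_point_bound[OF g(1)])
    show "max r0 r1 < 1" using r0 r1 by simp
    fix r :: real assume r: "max r0 r1 < r" "0 < r" "r < 1"
    have "hardy_mean p g r \<le> 2 powr p * hardy_mean p f r"
    proof (rule hardy_mean_mono)
      fix z assume z: "cmod z = \<bar>r\<bar>"
      have "1/2 * cmod (g z) \<le> cmod (f z)"
        using mult_right_mono[OF r0(2)[of z], of "cmod (g z)"] g(2)[of z] z r by (auto simp: norm_mult)
      then have "cmod (g z) powr p \<le> (2 * cmod (f z)) powr p" using p by (intro powr_mono2) auto
      then show "cmod (g z) powr p \<le> 2 powr p * cmod (f z) powr p" by (simp add: powr_mult)
    qed (use r f g p in auto)
    also have "\<dots> \<le> 2 powr p * M" using M[of r] r by (intro mult_left_mono) auto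
    finally show "hardy_mean p g r \<le> 2 powr p * M" .
  qed (use p in auto)
  moreover have "cmod (f 0) powr p = (\<Prod>a\<in>Z. cmod a) powr p * cmod (g 0) powr p"
    using g(2)[of 0] by (simp add: norm_mult powr_mult prod_nonneg flip: prod_norm)
  ultimately show ?thesis by (simp add: mult_left_mono)
qed

text \<open>The products of the \<open>cmod (a n)\<close> stay away from 0, and
  \<open>1 - x \<le> - ln x\<close> turns this into a bound for the partial sums. If f vanishes at 0
  the product bound says nothing, so a power of z is divided out first.\<close>

lemma blaschke_summable:
  fixes f :: "complex \<Rightarrow> complex"
  assumes f: "f \<in> hardy_space p" and p: "p > 0" and nz: "\<exists>w\<in>unit_disc. f w \<noteq> 0"
    and a: "inj a" "\<And>n. a n \<in> unit_disc" "\<And>n. a n \<noteq> 0" "\<And>n. f (a n) = 0"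
  shows "summable (\<lambda>n. 1 - cmod (a n))"
proof -
  note hf = hardy_space_holomorphic[OF f]
  obtain m g where g: "g holomorphic_on unit_disc" "g 0 \<noteq> 0" "\<And>z. z \<in> unit_disc \<Longrightarrow> f z = (z - 0) ^ m * g z"
    by (rule holomorphic_factor_zero[OF hf _ _ _ nz, of 0]) auto
  \<comment> \<open>On circles of radius above 1/2, division by \<open>z ^ m\<close> enlarges the
    modulus at most by the factor \<open>2 ^ m\<close>.\<close>
  define M where "M = (2 ^ m) powr p * hardy_norm p f powr p"
  have M: "hardy_mean p g r \<le> M" if "1/2 < r" "0 < r" "r < 1" for r
  proof -
    have "hardy_mean p g r \<le> (2 ^ m) powr p * hardy_mean p f r"
    proof (rule hardy_mean_mono)
      fix z assume z: "cmod z = \<bar>r\<bar>"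
      have "1 * cmod (g z) \<le> (2 * r) ^ m * cmod (g z)"
        using that by (intro mult_right_mono one_le_power) auto
      also have "\<dots> = 2 ^ m * cmod (f z)"
        using g(3)[of z] z that by (simp add: norm_mult norm_power power_mult_distrib)
      finally have "cmod (g z) powr p \<le> (2 ^ m * cmod (f z)) powr p"
        using p by (intro powr_mono2) auto
      then show "cmod (g z) powr p \<le> (2 ^ m) powr p * cmod (f z) powr p" by (simp add: powr_mult)
    qed (use that hf g p in auto)
    also have "\<dots> \<le> M" unfolding M_def using that f p by (intro mult_left_mono hardy_mean_le_norm) auto
    finally show ?thesis .
  qed
  define K where "K = 4 * 2 powr p * M"
  have ga: "g (a n) = 0" for n using a(2-4)[of n] g(3)[of "a n"] by auto
  have bd: "cmod (g 0) powr p \<le> (\<Prod>k<n. cmod (a k)) powr p * K" for n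
  proof -
    have "cmod (g 0) powr p \<le> (\<Prod>b\<in>a ` {..<n}. cmod b) powr p * K"
      unfolding K_def
    proof (rule blaschke_product_bound[OF g(1) p])
      show "(1/2::real) < 1" by simp
    qed (use a(2) ga M in auto)
    also have "(\<Prod>b\<in>a ` {..<n}. cmod b) = (\<Prod>k<n. cmod (a k))"
      using a(1) by (subst prod.reindex) (auto simp: inj_on_def inj_def)
    finally show ?thesis .
  qed
  have g0: "0 < cmod (g 0) powr p" using g(2) by simp
  also have "\<dots> \<le> K" using bd[of 0] by simp
  finally have K: "K > 0" .
  show ?thesis
  proof (rule summableI_nonneg_bounded)
    show "0 \<le> 1 - cmod (a n)" for n using a(2)[of n] by simp
    fix n
    have pos: "0 < (\<Prod>k<n. cmod (a k))" using a(3) by (intro prod_pos) auto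
    have "(\<Sum>k<n. 1 - cmod (a k)) \<le> (\<Sum>k<n. - ln (cmod (a k)))"
    proof (rule sum_mono)
      fix k show "1 - cmod (a k) \<le> - ln (cmod (a k))"
        using ln_le_minus_one[of "cmod (a k)"] a(3)[of k] by simp
    qed
    also have "\<dots> = - ln (\<Prod>k<n. cmod (a k))"
      using a(3) by (simp add: ln_prod sum_negf)
    also have "\<dots> = - ln ((\<Prod>k<n. cmod (a k)) powr p) / p"
      using pos p by (simp add: ln_powr)
    also have "\<dots> \<le> - ln (cmod (g 0) powr p / K) / p"
    proof -
      have "cmod (g 0) powr p / K \<le> (\<Prod>k<n. cmod (a k)) powr p"
        using bd[of n] K by (simp add: field_simps)
      moreover have "0 < cmod (g 0) powr p / K" using g0 K by (rule divide_pos_pos)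
      ultimately have "ln (cmod (g 0) powr p / K) \<le> ln ((\<Prod>k<n. cmod (a k)) powr p)"
        using ln_le_cancel_iff less_le_trans by blast
      then show ?thesis using p by (intro divide_right_mono) auto
    qed
    finally show "(\<Sum>k<n. 1 - cmod (a k)) \<le> - ln (cmod (g 0) powr p / K) / p" .
  qed
qed

section \<open>Bounded pointwise convergence\<close>

lemma hardy_mean_tendsto:
  fixes F :: "nat \<Rightarrow> complex \<Rightarrow> complex"
  assumes hol: "\<And>n. F n holomorphic_on unit_disc" and r: "0 < r" "r < 1" and p: "p > 0"
    and C: "\<And>n z. cmod z = r \<Longrightarrow> cmod (F n z) \<le> C"
    and lim: "\<And>z. cmod z = r \<Longrightarrow> (\<lambda>n. F n z) \<longlonglongrightarrow> f z"
  shows "(\<lambda>n. hardy_mean p (F n) r) \<longlonglongrightarrow> hardy_mean p f r"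
  unfolding hardy_mean_def
proof (rule dominated_convergence(2))
  have z: "cmod (of_real r * cis t) = r" for t using r by simp
  show "(\<lambda>\<theta>. cmod (F n (of_real r * cis \<theta>)) powr p) integrable_on {0..2*pi}" for n
    using hol r p by (intro hardy_mean_integrable) auto
  show "(\<lambda>_. C powr p) integrable_on {0..2*pi}"
    by (intro integrable_continuous_interval continuous_on_const)
  show "norm (cmod (F n (of_real r * cis \<theta>)) powr p) \<le> C powr p" for n \<theta>
    using C[OF z, of n \<theta>] p by (auto intro!: powr_mono2)
  show "(\<lambda>n. cmod (F n (of_real r * cis \<theta>)) powr p) \<longlonglongrightarrow> cmod (f (of_real r * cis \<theta>)) powr p" for \<theta>
    using tendsto_powr'[OF tendsto_norm[OF lim[OF z, of \<theta>]] tendsto_const] p by simp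
qed

text \<open>The square of the H^2 norm, kept without the root so that the parallelogram law can be
  stated directly.\<close>

definition hardy_sup :: "(complex \<Rightarrow> complex) \<Rightarrow> real" where
  "hardy_sup f = (SUP r\<in>{0<..<1}. hardy_mean 2 f r)"

lemma hardy_mean_le_sup:
  assumes "f \<in> hardy_space 2" "0 < r" "r < 1"
  shows "hardy_mean 2 f r \<le> hardy_sup f"
  unfolding hardy_sup_def using assms by (intro cSUP_upper) (auto simp: hardy_space_def)

lemma hardy_sup_least:
  assumes "\<And>r. 0 < r \<Longrightarrow> r < 1 \<Longrightarrow> hardy_mean 2 f r \<le> M"
  shows "hardy_sup f \<le> M"
  unfolding hardy_sup_def using assms by (intro cSUP_least) auto

lemma hardy_sup_nonneg:
  assumes "f \<in> hardy_space 2"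
  shows "0 \<le> hardy_sup f"
  using hardy_mean_le_sup[OF assms, of "1/2"] hardy_mean_nonneg[of 2 f "1/2"] by linarith

lemma hardy_space_diff:
  assumes "f \<in> hardy_space p" "g \<in> hardy_space p" "p > 0"
  shows "(\<lambda>z. f z - g z) \<in> hardy_space p"
  using hardy_space_add(1)[OF assms(1) hardy_space_scale(1)[OF assms(2), of "-1"]] assms(3) by simp

text \<open>The suprema for the sum and the difference may be approached at different radii.
  Monotonicity of square means allows both to be moved to the larger radius, where the identity
  holds.\<close>

lemma hardy_sup_parallelogram:
  assumes f: "f \<in> hardy_space 2" and g: "g \<in> hardy_space 2"
  shows "hardy_sup (\<lambda>z. f z - g z) \<le> 2 * hardy_sup f + 2 * hardy_sup g - hardy_sup (\<lambda>z. f z + g z)"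
proof (rule hardy_sup_least)
  note hol = hardy_space_holomorphic[OF f] hardy_space_holomorphic[OF g]
  fix r1 :: real assume r1: "0 < r1" "r1 < 1"
  have "hardy_sup (\<lambda>z. f z + g z) \<le> 2 * hardy_sup f + 2 * hardy_sup g - hardy_mean 2 (\<lambda>z. f z - g z) r1"
  proof (rule hardy_sup_least)
    fix r2 :: real assume r2: "0 < r2" "r2 < 1"
    let ?R = "max r1 r2"
    have R: "0 < ?R" "?R < 1" using r1 r2 by (auto simp: less_max_iff_disj)
    have "hardy_mean 2 (\<lambda>z. f z - g z) r1 + hardy_mean 2 (\<lambda>z. f z + g z) r2
        \<le> hardy_mean 2 (\<lambda>z. f z - g z) ?R + hardy_mean 2 (\<lambda>z. f z + g z) ?R"
      using r1 r2 by (intro add_mono hardy_mean_two_mono holomorphic_intros hol) auto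
    also have "\<dots> = 2 * hardy_mean 2 f ?R + 2 * hardy_mean 2 g ?R"
      using hardy_mean_parallelogram[OF hol R] by simp
    also have "\<dots> \<le> 2 * hardy_sup f + 2 * hardy_sup g"
      using r1 r2 by (intro add_mono mult_left_mono hardy_mean_le_sup f g) auto
    finally show "hardy_mean 2 (\<lambda>z. f z + g z) r2 \<le> 2 * hardy_sup f + 2 * hardy_sup g - hardy_mean 2 (\<lambda>z. f z - g z) r1"
      by linarith
  qed
  then show "hardy_mean 2 (\<lambda>z. f z - g z) r1 \<le> 2 * hardy_sup f + 2 * hardy_sup g - hardy_sup (\<lambda>z. f z + g z)"
    by linarith
qed

lemma hardy_sup_midpoint:
  assumes f: "f \<in> hardy_space 2"
  shows "4 * hardy_sup (\<lambda>z. (1/2) * f z) \<le> hardy_sup f"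
proof -
  have "hardy_sup (\<lambda>z. (1/2) * f z) \<le> hardy_sup f / 4"
  proof (rule hardy_sup_least)
    fix r :: real assume r: "0 < r" "r < 1"
    have "hardy_mean 2 (\<lambda>z. (1/2) * f z) r = integral {0..2*pi} (\<lambda>t. (1/4) * (cmod (f (of_real r * cis t)))\<^sup>2)"
      unfolding hardy_mean_two by (intro integral_cong) (simp add: norm_mult norm_divide power_divide)
    also have "\<dots> = hardy_mean 2 f r / 4" unfolding hardy_mean_two by simp
    also have "\<dots> \<le> hardy_sup f / 4" using hardy_mean_le_sup[OF f r] by simp
    finally show "hardy_mean 2 (\<lambda>z. (1/2) * f z) r \<le> hardy_sup f / 4" .
  qed
  then show ?thesis by simp
qed

lemma hardy_sup_bounded:
  assumes "f holomorphic_on unit_disc" "\<And>z. z \<in> unit_disc \<Longrightarrow> cmod (f z) \<le> C"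
  shows "hardy_sup f \<le> 2 * pi * C powr 2"
  by (rule hardy_sup_least, rule hardy_mean_bounded) (use assms in auto)

text \<open>Elements of almost minimal \<open>H\<^sup>2\<close> norm in a decreasing sequence of convex sets form a Cauchy
  sequence by the parallelogram law.\<close>
lemma almost_minimal_sequence:
  fixes K :: "nat \<Rightarrow> (complex \<Rightarrow> complex) set"
  assumes ne: "\<And>n. K n \<noteq> {}" and dec: "\<And>m n. n \<le> m \<Longrightarrow> K m \<subseteq> K n"
    and bdd: "\<And>n. K n \<subseteq> bounded_analytic" "\<And>n g z. g \<in> K n \<Longrightarrow> z \<in> unit_disc \<Longrightarrow> cmod (g z) \<le> C"
    and mid: "\<And>n f g. f \<in> K n \<Longrightarrow> g \<in> K n \<Longrightarrow> (\<lambda>z. (1/2) * (f z + g z)) \<in> K n"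
    and small: "\<And>z e. z \<in> unit_disc \<Longrightarrow> 0 < e \<Longrightarrow> \<exists>n. \<forall>g\<in>K n. cmod (g z) \<le> e"
  obtains g \<epsilon> where "\<And>n. g n \<in> K n" "\<epsilon> \<longlonglongrightarrow> 0" "\<And>n r. 0 < r \<Longrightarrow> r < 1 \<Longrightarrow> hardy_mean 2 (g n) r \<le> \<epsilon> n"
proof -
  have H2: "g \<in> hardy_space 2" and hol: "g holomorphic_on unit_disc" if "g \<in> K n" for g n
    using that bdd(1)[of n] bounded_analytic_hardy[of g 2] by (auto simp: bounded_analytic_def)
  define c where "c = (\<lambda>n. INF g\<in>K n. hardy_sup g)"
  have bb: "bdd_below (hardy_sup ` K n)" for n
    using H2 hardy_sup_nonneg by (intro bdd_belowI2[where m = 0]) blast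
  have c_le: "c n \<le> hardy_sup g" if "g \<in> K n" for n g
    unfolding c_def by (rule cINF_lower[OF bb that])
  have c_mono: "c n \<le> c m" if "n \<le> m" for n m
    unfolding c_def by (rule cINF_superset_mono[OF ne bb dec[OF that]]) simp
  have "\<exists>g\<in>K n. hardy_sup g < c n + 1 / (real n + 1)" for n
    using cINF_less_iff[OF ne bb, of n "c n + 1 / (real n + 1)"] by (simp add: c_def)
  then obtain g where g: "\<And>n. g n \<in> K n" "\<And>n. hardy_sup (g n) < c n + 1 / (real n + 1)"
    by metis
  have c_bdd: "c n \<le> 2 * pi * C powr 2" for n
  proof -
    have "hardy_sup (g n) \<le> 2 * pi * C powr 2"
      by (rule hardy_sup_bounded[OF hol[OF g(1)] bdd(2)[OF g(1)]])
    then show ?thesis using c_le[OF g(1), of n] by linarith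
  qed
  obtain c0 where c0: "c \<longlonglongrightarrow> c0" "\<And>n. c n \<le> c0"
    using incseq_convergent[of c "2 * pi * C powr 2"] c_mono c_bdd by (auto simp: incseq_def)
  \<comment> \<open>The parallelogram law gives
    \<open>2 * (c n + 1 / (n + 1)) + 2 * (c m + 1 / (m + 1)) - 4 * c n\<close>; replacing
    \<open>c m\<close> by its limit \<open>c0\<close> and \<open>1 / (m + 1)\<close> by
    \<open>1 / (n + 1)\<close> removes the dependence on m.\<close>
  define \<epsilon> where "\<epsilon> = (\<lambda>n. 2 * (c0 - c n) + 4 / (real n + 1))"
  have diff: "hardy_sup (\<lambda>z. g n z - g m z) \<le> \<epsilon> n" if "n \<le> m" for n m
  proof -
    have gm: "g m \<in> K n" using g(1)[of m] dec[OF that] by auto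
    have "4 * c n \<le> 4 * hardy_sup (\<lambda>z. (1/2) * (g n z + g m z))"
      using c_le[OF mid[OF g(1) gm]] by simp
    also have "\<dots> \<le> hardy_sup (\<lambda>z. g n z + g m z)"
      by (intro hardy_sup_midpoint hardy_space_add(1) H2[OF g(1)]) simp
    finally have "hardy_sup (\<lambda>z. g n z - g m z) \<le> 2 * hardy_sup (g n) + 2 * hardy_sup (g m) - 4 * c n"
      using hardy_sup_parallelogram[OF H2[OF g(1)] H2[OF g(1)], of n m] by linarith
    moreover have "1 / (real m + 1) \<le> 1 / (real n + 1)"
      using that by (intro divide_left_mono) auto
    ultimately show ?thesis
      using g(2)[of n] g(2)[of m] c0(2)[of m] unfolding \<epsilon>_def by argo
  qed
  \<comment> \<open>Since the sets shrink pointwise to 0, letting m grow in \<open>g n - g m\<close>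
    turns the Cauchy estimate into an estimate of \<open>g n\<close> itself.\<close>
  have gz: "(\<lambda>m. g m z) \<longlonglongrightarrow> 0" if z: "z \<in> unit_disc" for z
  proof (rule LIMSEQ_I)
    fix e :: real assume e: "0 < e"
    then obtain n where n: "\<forall>g\<in>K n. cmod (g z) \<le> e/2" using small[OF z, of "e/2"] by auto
    show "\<exists>no. \<forall>m\<ge>no. norm (g m z - 0) < e"
    proof (intro exI[of _ n] allI impI)
      fix m assume "n \<le> m"
      then have "g m \<in> K n" using dec g(1) by blast
      then have "cmod (g m z) \<le> e/2" using n by blast
      then show "norm (g m z - 0) < e" using e by simp
    qed
  qed
  show ?thesis
  proof (rule that)
    show "g n \<in> K n" for n by (rule g(1))
    have "(\<lambda>n. 4 / (real n + 1)) \<longlonglongrightarrow> 0" by real_asymp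
    then have "\<epsilon> \<longlonglongrightarrow> 2 * (c0 - c0) + 0" unfolding \<epsilon>_def by (intro tendsto_intros c0)
    then show "\<epsilon> \<longlonglongrightarrow> 0" by simp
    fix n and r :: real assume r: "0 < r" "r < 1"
    have "(\<lambda>m. hardy_mean 2 (\<lambda>z. g n z - g m z) r) \<longlonglongrightarrow> hardy_mean 2 (g n) r"
    proof (rule hardy_mean_tendsto[where C = "2 * C"])
      show "cmod (g n z - g m z) \<le> 2 * C" if "cmod z = r" for m z
      proof -
        have z: "z \<in> unit_disc" using that r by simp
        show ?thesis
          using norm_triangle_ineq4[of "g n z" "g m z"] bdd(2)[OF g(1)[of n] z] bdd(2)[OF g(1)[of m] z] by linarith
      qed
      show "(\<lambda>m. g n z - g m z) \<longlonglongrightarrow> g n z" if "cmod z = r" for z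
      proof -
        have z: "z \<in> unit_disc" using that r by simp
        show ?thesis using tendsto_diff[OF tendsto_const gz[OF z], of "g n z"] by simp
      qed
    qed (use r in \<open>auto intro!: holomorphic_intros hol[OF g(1)]\<close>)
    then show "hardy_mean 2 (g n) r \<le> \<epsilon> n"
    proof (rule LIMSEQ_le_const2)
      show "\<exists>N. \<forall>m\<ge>N. hardy_mean 2 (\<lambda>z. g n z - g m z) r \<le> \<epsilon> n"
      proof (intro exI[of _ n] allI impI)
        fix m assume "n \<le> m"
        then show "hardy_mean 2 (\<lambda>z. g n z - g m z) r \<le> \<epsilon> n"
          using diff[of n m] hardy_mean_le_sup[OF hardy_space_diff[OF H2[OF g(1)] H2[OF g(1)], of n m] r] by simp
      qed
    qed
  qed
qed

text \<open>On the interval from 0 to C the power \<open>x powr p\<close> is at most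
  \<open>\<eta> + K * x\<^sup>2\<close>, so for uniformly bounded functions smallness in H^2 passes
  to every exponent.\<close>

lemma bounded_null_hardy_norm:
  fixes g :: "nat \<Rightarrow> complex \<Rightarrow> complex"
  assumes g: "\<And>n. g n holomorphic_on unit_disc" "\<And>n z. z \<in> unit_disc \<Longrightarrow> cmod (g n z) \<le> C"
    and \<epsilon>: "\<epsilon> \<longlonglongrightarrow> 0" "\<And>n r. 0 < r \<Longrightarrow> r < 1 \<Longrightarrow> hardy_mean 2 (g n) r \<le> \<epsilon> n" and p: "p > 0"
  shows "(\<lambda>n. hardy_norm p (g n)) \<longlonglongrightarrow> 0"
proof (rule LIMSEQ_I)
  fix d :: real assume d: "0 < d"
  \<comment> \<open>Chosen so that \<open>2 * pi * \<eta>\<close> is half of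
    \<open>(d / 2) powr p\<close>; the term with \<epsilon> gets the other half.\<close>
  define \<eta> where "\<eta> = (d / 2) powr p / (4 * pi)"
  have \<eta>: "\<eta> > 0" using d by (simp add: \<eta>_def)
  have C: "0 \<le> C" using order_trans[OF norm_ge_zero g(2)[of 0]] by simp
  define K where "K = C powr p / (\<eta> powr (1 / p))\<^sup>2"
  have K: "K \<ge> 0" by (simp add: K_def)
  have pw: "x powr p \<le> \<eta> + K * x\<^sup>2" if x: "0 \<le> x" "x \<le> C" for x
  proof (cases "x \<le> \<eta> powr (1 / p)")
    case True
    then have "x powr p \<le> (\<eta> powr (1 / p)) powr p" using x p by (intro powr_mono2) auto
    also have "\<dots> = \<eta>" using \<eta> p by (simp add: powr_powr)
    finally show ?thesis using mult_nonneg_nonneg[OF K zero_le_power2[of x]] by linarith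
  next
    case False
    have "x powr p \<le> C powr p * 1" using x p by (simp add: powr_mono2)
    also have "\<dots> \<le> C powr p * (x\<^sup>2 / (\<eta> powr (1 / p))\<^sup>2)"
      using False \<eta> by (intro mult_left_mono) (auto simp: field_simps intro!: power_mono)
    also have "\<dots> = K * x\<^sup>2" by (simp add: K_def)
    finally show ?thesis using \<eta> by simp
  qed
  have mean: "hardy_mean p (g n) r \<le> 2 * pi * \<eta> + K * \<epsilon> n" if r: "0 < r" "r < 1" for n r
  proof -
    have i2: "(\<lambda>t. (cmod (g n (of_real r * cis t)))\<^sup>2) integrable_on {0..2*pi}"
      using hardy_mean_integrable[OF g(1), of r 2] r by simp
    have "hardy_mean p (g n) r \<le> integral {0..2*pi} (\<lambda>t. \<eta> + K * (cmod (g n (of_real r * cis t)))\<^sup>2)"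
      unfolding hardy_mean_def
    proof (intro integral_le integrable_add integrable_on_mult_right i2)
      show "(\<lambda>t. cmod (g n (of_real r * cis t)) powr p) integrable_on {0..2*pi}"
        using r p by (intro hardy_mean_integrable g) auto
      show "cmod (g n (of_real r * cis t)) powr p \<le> \<eta> + K * (cmod (g n (of_real r * cis t)))\<^sup>2" for t
        using r by (intro pw g) auto
    qed auto
    also have "\<dots> = 2 * pi * \<eta> + K * hardy_mean 2 (g n) r"
      unfolding hardy_mean_two
      by (subst integral_add) (auto intro!: integrable_on_mult_right i2)
    also have "\<dots> \<le> 2 * pi * \<eta> + K * \<epsilon> n" using mult_left_mono[OF \<epsilon>(2)[OF r] K] by simp
    finally show ?thesis .
  qed
  have "(\<lambda>n. K * \<epsilon> n) \<longlonglongrightarrow> 0" using tendsto_mult_left[OF \<epsilon>(1), of K] by simp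
  moreover have "0 < (d/2) powr p / 2" using d by simp
  ultimately obtain N where N: "\<And>n. n \<ge> N \<Longrightarrow> norm (K * \<epsilon> n - 0) < (d/2) powr p / 2"
    using LIMSEQ_D by blast
  show "\<exists>no. \<forall>n\<ge>no. norm (hardy_norm p (g n) - 0) < d"
  proof (intro exI[of _ N] allI impI)
    fix n assume "n \<ge> N"
    then have "K * \<epsilon> n < (d/2) powr p / 2" using N[of n] by (simp add: abs_less_iff)
    moreover have "2 * pi * \<eta> = (d/2) powr p / 2" by (simp add: \<eta>_def)
    ultimately have le: "2 * pi * \<eta> + K * \<epsilon> n \<le> (d/2) powr p" by linarith
    have "hardy_norm p (g n) \<le> ((d/2) powr p) powr (1 / p)"
      by (rule hardy_norm_le[OF p]) (rule order_trans[OF mean le])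
    then show "norm (hardy_norm p (g n) - 0) < d"
      using d p hardy_norm_nonneg[of p "g n"] by (simp add: powr_powr)
  qed
qed

section \<open>Bounded functionals under bounded pointwise convergence\<close>

lemma bounded_analyticI:
  assumes "f holomorphic_on unit_disc" "\<And>z. z \<notin> unit_disc \<Longrightarrow> f z = 0"
    "\<And>z. z \<in> unit_disc \<Longrightarrow> cmod (f z) \<le> C"
  shows "f \<in> bounded_analytic"
  using assms unfolding bounded_analytic_def by blast

lemma bounded_functionalD:
  assumes "l \<in> bounded_functionals V N"
  shows "f \<in> V \<Longrightarrow> g \<in> V \<Longrightarrow> l (\<lambda>s. f s + g s) = l f + l g"
    and "f \<in> V \<Longrightarrow> l (\<lambda>s. c * f s) = c * l f"
  using assms by (auto simp: bounded_functionals_def)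

lemma bounded_functional_bound:
  assumes "l \<in> bounded_functionals V (hardy_norm p)"
  obtains K where "K > 0" "\<And>f. f \<in> V \<Longrightarrow> cmod (l f) \<le> K * hardy_norm p f"
proof -
  obtain K where K: "\<And>f. f \<in> V \<Longrightarrow> cmod (l f) \<le> K * hardy_norm p f"
    using assms unfolding bounded_functionals_def by blast
  show ?thesis
  proof (rule that[of "\<bar>K\<bar> + 1"])
    fix f assume "f \<in> V"
    have "K * hardy_norm p f \<le> (\<bar>K\<bar> + 1) * hardy_norm p f"
      by (intro mult_right_mono hardy_norm_nonneg) auto
    then show "cmod (l f) \<le> (\<bar>K\<bar> + 1) * hardy_norm p f" using K[OF \<open>f \<in> V\<close>] by linarith
  qed auto
qed

text \<open>A substitute for weak compactness that also covers \<open>p = 1\<close>. Otherwise a subsequence has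
  \<open>l (F n) \<rightarrow> L \<noteq> 0\<close>; the sets \<open>K n\<close> below play the role of the convex hulls of its tails.\<close>
lemma bounded_functional_tendsto_0:
  fixes F :: "nat \<Rightarrow> complex \<Rightarrow> complex"
  assumes l: "l \<in> bounded_functionals (hardy_space p) (hardy_norm p)" and p: "p > 0"
    and F: "\<And>n. F n \<in> bounded_analytic" "\<And>n z. z \<in> unit_disc \<Longrightarrow> cmod (F n z) \<le> C"
      "\<And>z. z \<in> unit_disc \<Longrightarrow> (\<lambda>n. F n z) \<longlonglongrightarrow> 0"
  shows "(\<lambda>n. l (F n)) \<longlonglongrightarrow> 0"
proof (rule ccontr)
  assume "\<not> (\<lambda>n. l (F n)) \<longlonglongrightarrow> 0"
  then obtain e where e: "e > 0" "\<And>N. \<exists>n\<ge>N. e \<le> cmod (l (F n))"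
    unfolding LIMSEQ_iff by (auto simp: not_less)
  obtain B where B: "B > 0" "\<And>f. f \<in> hardy_space p \<Longrightarrow> cmod (l f) \<le> B * hardy_norm p f"
    using bounded_functional_bound[OF l] by blast
  note linear = bounded_functionalD[OF l]
  have V: "f \<in> hardy_space p" if "f \<in> bounded_analytic" for f
    using bounded_analytic_hardy[OF that p] .
  have hol: "f holomorphic_on unit_disc" if "f \<in> bounded_analytic" for f
    using that by (simp add: bounded_analytic_def)
  have "infinite {n. e \<le> cmod (l (F n))}"
    using e(2) unfolding infinite_nat_iff_unbounded_le by auto
  then obtain r0 :: "nat \<Rightarrow> nat" where r0: "strict_mono r0" "\<And>n. e \<le> cmod (l (F (r0 n)))"
    using infinite_enumerate by blast
  have "l (F n) \<in> cball 0 (B * (2 * pi * C powr p) powr (1 / p))" for n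
  proof -
    have "hardy_norm p (F n) \<le> (2 * pi * C powr p) powr (1 / p)"
      by (intro hardy_norm_le p hardy_mean_bounded hol F) auto
    then have "B * hardy_norm p (F n) \<le> B * (2 * pi * C powr p) powr (1 / p)"
      using B by simp
    then show ?thesis using B(2)[OF V[OF F(1)], of n] by simp
  qed
  then have "\<exists>L\<in>cball 0 (B * (2 * pi * C powr p) powr (1 / p)). \<exists>r1. strict_mono (r1 :: nat \<Rightarrow> nat) \<and>
      ((\<lambda>n. l (F (r0 n))) \<circ> r1) \<longlonglongrightarrow> L"
    using compact_cball[of "0::complex" "B * (2 * pi * C powr p) powr (1 / p)"] unfolding compact_def
    by (elim allE[of _ "\<lambda>n. l (F (r0 n))"]) blast
  then obtain L and r1 :: "nat \<Rightarrow> nat" where r1: "strict_mono r1" "(\<lambda>n. l (F (r0 (r1 n)))) \<longlonglongrightarrow> L"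
    unfolding o_def by blast
  have "e \<le> cmod L"
    using r0(2) by (intro LIMSEQ_le_const[OF tendsto_norm[OF r1(2)]]) auto
  then have L: "cmod L / 2 > 0" using e(1) by linarith
  obtain n0 where n0: "\<And>n. n \<ge> n0 \<Longrightarrow> cmod (l (F (r0 (r1 n))) - L) < cmod L / 2"
    using LIMSEQ_D[OF r1(2) L] by auto
  define G where "G = (\<lambda>n. F (r0 (r1 (n + n0))))"
  have G: "\<And>n. G n \<in> bounded_analytic" "\<And>n z. z \<in> unit_disc \<Longrightarrow> cmod (G n z) \<le> C"
     "\<And>n. cmod (l (G n) - L) \<le> cmod L / 2"
    using F n0 by (auto simp: G_def less_imp_le)
  have G0: "(\<lambda>n. G n z) \<longlonglongrightarrow> 0" if "z \<in> unit_disc" for z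
  proof -
    have "strict_mono (\<lambda>n. r0 (r1 (n + n0)))"
      using r0(1) r1(1) by (simp add: strict_mono_def)
    then show ?thesis using LIMSEQ_subseq_LIMSEQ[OF F(3)[OF that]] by (simp add: o_def G_def)
  qed
  \<comment> \<open>Both conditions are inequalities preserved by midpoints, so no convex
    combinations have to be written down. The first keeps \<open>cmod (l g)\<close> at least
    \<open>cmod L / 2\<close>; the second passes pointwise bounds of the tail on to every
    member.\<close>
  define K where "K = (\<lambda>n. {g \<in> bounded_analytic. cmod (l g - L) \<le> cmod L / 2 \<and>
     (\<forall>z\<in>unit_disc. \<forall>e. (\<forall>m\<ge>n. cmod (G m z) \<le> e) \<longrightarrow> cmod (g z) \<le> e)})"
  obtain g \<epsilon> where g: "\<And>n. g n \<in> K n" "\<epsilon> \<longlonglongrightarrow> 0" "\<And>n r. 0 < r \<Longrightarrow> r < 1 \<Longrightarrow> hardy_mean 2 (g n) r \<le> \<epsilon> n"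
  proof (rule almost_minimal_sequence[of K C])
    have "G n \<in> K n" for n using G(1,3)[of n] by (simp add: K_def)
    then show "K n \<noteq> {}" for n by blast
    show "K m \<subseteq> K n" if "n \<le> m" for m n using that by (force simp: K_def)
    show "K n \<subseteq> bounded_analytic" for n by (auto simp: K_def)
    show "cmod (g z) \<le> C" if "g \<in> K n" "z \<in> unit_disc" for n g z
      using that G(2) by (auto simp: K_def)
    show "\<exists>n. \<forall>g\<in>K n. cmod (g z) \<le> e" if z: "z \<in> unit_disc" and e: "0 < e" for z e
    proof -
      obtain n where "\<forall>m\<ge>n. cmod (G m z) \<le> e" using LIMSEQ_D[OF G0[OF z] e] by (auto intro: less_imp_le)
      then show ?thesis using z by (intro exI[of _ n]) (auto simp: K_def)
    qed
    show "(\<lambda>z. (1/2) * (f z + g z)) \<in> K n" if fg: "f \<in> K n" "g \<in> K n" for n f g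
    proof -
      have b: "f \<in> bounded_analytic" "g \<in> bounded_analytic" using fg by (auto simp: K_def)
      obtain C1 C2 where C12: "\<And>z. z \<in> unit_disc \<Longrightarrow> cmod (f z) \<le> C1" "\<And>z. z \<in> unit_disc \<Longrightarrow> cmod (g z) \<le> C2"
        using b unfolding bounded_analytic_def by blast
      have half: "cmod ((1/2) * (x + y)) \<le> e" if "cmod x \<le> e" "cmod y \<le> e" for x y :: complex and e
        using norm_triangle_ineq[of x y] that by (simp add: norm_mult norm_divide)
      have "cmod ((1/2) * (f z + g z)) \<le> max C1 C2" if "z \<in> unit_disc" for z
        using C12[OF that] by (intro half) auto
      then have 1: "(\<lambda>z. (1/2) * (f z + g z)) \<in> bounded_analytic"
        using b by (intro bounded_analyticI[of _ "max C1 C2"])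
          (auto simp: bounded_analytic_def simp del: mult_le_cancel_left norm_mult intro!: holomorphic_intros)
      have "l (\<lambda>z. (1/2) * (f z + g z)) = (1/2) * (l f + l g)"
        using linear(2)[OF hardy_space_add(1)[OF V[OF b(1)] V[OF b(2)] p], of "1/2"] linear(1)[OF V[OF b(1)] V[OF b(2)]] by simp
      then have "l (\<lambda>z. (1/2) * (f z + g z)) - L = (1/2) * ((l f - L) + (l g - L))"
        by (simp add: algebra_simps)
      moreover have "cmod ((1/2) * ((l f - L) + (l g - L))) \<le> cmod L / 2"
        by (rule half) (use fg in \<open>simp_all add: K_def\<close>)
      ultimately have 2: "cmod (l (\<lambda>z. (1/2) * (f z + g z)) - L) \<le> cmod L / 2" by (simp only:)
      show ?thesis
        unfolding K_def mem_Collect_eq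
      proof (intro conjI 1 2 ballI allI impI)
        fix z e assume z: "z \<in> unit_disc" "\<forall>m\<ge>n. cmod (G m z) \<le> e"
        show "cmod ((1/2) * (f z + g z)) \<le> e"
          by (rule half) (use fg z in \<open>unfold K_def, blast+\<close>)
      qed
    qed
  qed (rule that)
  have gK: "g n \<in> bounded_analytic" "cmod (l (g n) - L) \<le> cmod L / 2"
     "z \<in> unit_disc \<Longrightarrow> cmod (g n z) \<le> C" for n z
    using g(1)[of n] G(2) by (auto simp: K_def)
  have "(\<lambda>n. hardy_norm p (g n)) \<longlonglongrightarrow> 0"
    by (rule bounded_null_hardy_norm[OF hol[OF gK(1)] gK(3) g(2,3) p]) auto
  then have "(\<lambda>n. B * hardy_norm p (g n)) \<longlonglongrightarrow> 0"
    using tendsto_mult_left[of _ 0 sequentially B] by simp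
  then obtain n where "B * hardy_norm p (g n) < cmod L / 2"
    using order_tendstoD(2)[OF _ L] eventually_happens by (metis trivial_limit_sequentially)
  then have "cmod (l (g n)) < cmod L / 2" using B(2)[OF V[OF gK(1)], of n] by linarith
  moreover have "cmod L - cmod (l (g n)) \<le> cmod (l (g n) - L)"
    by (metis norm_minus_commute norm_triangle_ineq2)
  ultimately show False using gK(2)[of n] by linarith
qed

lemma bounded_analytic_diff:
  assumes "f \<in> bounded_analytic" "g \<in> bounded_analytic"
  shows "(\<lambda>z. f z - g z) \<in> bounded_analytic"
proof -
  obtain C1 C2 where C: "\<And>z. z \<in> unit_disc \<Longrightarrow> cmod (f z) \<le> C1" "\<And>z. z \<in> unit_disc \<Longrightarrow> cmod (g z) \<le> C2"
    using assms unfolding bounded_analytic_def by blast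
  have "cmod (f z - g z) \<le> C1 + C2" if "z \<in> unit_disc" for z
    using C[OF that] norm_triangle_ineq4[of "f z" "g z"] by linarith
  then show ?thesis
    using assms by (intro bounded_analyticI[of _ "C1 + C2"]) (auto simp: bounded_analytic_def intro!: holomorphic_intros)
qed

lemma bounded_functional_tendsto:
  fixes F :: "nat \<Rightarrow> complex \<Rightarrow> complex"
  assumes l: "l \<in> bounded_functionals (hardy_space p) (hardy_norm p)" and p: "p > 0"
    and F: "\<And>n. F n \<in> bounded_analytic" "\<And>n z. z \<in> unit_disc \<Longrightarrow> cmod (F n z) \<le> C"
    and f: "f \<in> bounded_analytic" "\<And>z. z \<in> unit_disc \<Longrightarrow> (\<lambda>n. F n z) \<longlonglongrightarrow> f z"
  shows "(\<lambda>n. l (F n)) \<longlonglongrightarrow> l f"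
proof -
  have V: "f \<in> hardy_space p" if "f \<in> bounded_analytic" for f
    using bounded_analytic_hardy[OF that p] .
  have fC: "cmod (f z) \<le> C" if "z \<in> unit_disc" for z
    using F(2)[OF that] by (intro LIMSEQ_le_const2[OF tendsto_norm[OF f(2)[OF that]]]) auto
  have "(\<lambda>n. l (\<lambda>z. F n z - f z)) \<longlonglongrightarrow> 0"
  proof (rule bounded_functional_tendsto_0[OF l p])
    show "(\<lambda>z. F n z - f z) \<in> bounded_analytic" for n by (rule bounded_analytic_diff[OF F(1) f(1)])
    show "cmod (F n z - f z) \<le> 2 * C" if "z \<in> unit_disc" for n z
      using F(2)[OF that, of n] fC[OF that] norm_triangle_ineq4[of "F n z" "f z"] by linarith
    show "(\<lambda>n. F n z - f z) \<longlonglongrightarrow> 0" if "z \<in> unit_disc" for z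
      using f(2)[OF that] by (simp add: LIM_zero)
  qed
  moreover have "l (\<lambda>z. F n z - f z) = l (F n) - l f" for n
    using bounded_functionalD(1)[OF l V[OF F(1)] hardy_space_scale(1)[OF V[OF f(1)] p, of "-1"], of n]
      bounded_functionalD(2)[OF l V[OF f(1)], of "-1"] by simp
  ultimately show ?thesis by (simp add: LIM_zero_iff)
qed

section \<open>Harmonic majorants and density of bounded functions\<close>

text \<open>A continuous pointwise bound is bounded on compact sets, which is what Montel's theorem
  asks for. The form suits bounds such as those from point evaluations, which blow up at the
  circle.\<close>

lemma montel_pointwise_bound:
  fixes F :: "nat \<Rightarrow> complex \<Rightarrow> complex"
  assumes S: "open S" and F: "\<And>n. F n holomorphic_on S"
    and b: "continuous_on S b" "\<And>n z. z \<in> S \<Longrightarrow> cmod (F n z) \<le> b z"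
  obtains g r where "g holomorphic_on S" "strict_mono (r :: nat \<Rightarrow> nat)"
    "\<And>x. x \<in> S \<Longrightarrow> (\<lambda>n. F (r n) x) \<longlonglongrightarrow> g x"
    "\<And>K. compact K \<Longrightarrow> K \<subseteq> S \<Longrightarrow> uniform_limit K (\<lambda>n. F (r n)) g sequentially"
proof -
  let ?H = "{h. h holomorphic_on S \<and> (\<forall>z\<in>S. cmod (h z) \<le> b z)}"
  have bnd: "\<exists>B. \<forall>h\<in>?H. \<forall>z\<in>K. cmod (h z) \<le> B" if K: "compact K" "K \<subseteq> S" for K
  proof -
    have "compact (b ` K)" using K b(1) by (intro compact_continuous_image continuous_on_subset[OF b(1)])
    then obtain B where B: "\<forall>y\<in>b ` K. norm y \<le> B" using compact_imp_bounded bounded_iff by metis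
    show ?thesis
    proof (intro exI[of _ B] ballI)
      fix h z assume "h \<in> ?H" "z \<in> K"
      then have "cmod (h z) \<le> b z" "b z \<le> B" using K B by (auto dest!: bspec simp: abs_le_iff)
      then show "cmod (h z) \<le> B" by linarith
    qed
  qed
  have "range F \<subseteq> ?H" using F b(2) by auto
  from Montel[OF S _ bnd this] obtain g r where "g holomorphic_on S" "strict_mono (r :: nat \<Rightarrow> nat)"
    "\<And>x. x \<in> S \<Longrightarrow> (\<lambda>n. F (r n) x) \<longlonglongrightarrow> g x"
    "\<And>K. compact K \<Longrightarrow> K \<subseteq> S \<Longrightarrow> uniform_limit K (F \<circ> r) g sequentially"
    by blast
  then show ?thesis using that by (simp add: o_def)
qed

section \<open>Herglotz integrals and harmonic majorants\<close>

definition herglotz :: "(real \<Rightarrow> real) \<Rightarrow> complex \<Rightarrow> complex" where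
  "herglotz g z = integral {0..2*pi} (\<lambda>t. of_real (g t) * ((cis t + z) / (cis t - z))) / (2 * pi)"

lemma cis_minus_nonzero: "cmod z < 1 \<Longrightarrow> cis t - z \<noteq> 0"
  using real_cis_minus_nonzero[of z 1 t] by simp

lemma herglotz_integrable:
  assumes "continuous_on {0..2*pi} g" "cmod z < 1"
  shows "(\<lambda>t. of_real (g t) * ((cis t + z) / (cis t - z))) integrable_on {0..2*pi}"
  using cis_minus_nonzero[OF assms(2)]
  by (intro integrable_continuous_interval continuous_intros assms(1) continuous_on_compose2[OF continuous_on_cis]) auto

lemma herglotz_holomorphic:
  assumes g: "continuous_on {0..2*pi} g"
  shows "herglotz g holomorphic_on unit_disc"
proof -
  have "(\<lambda>z. integral (cbox 0 (2*pi)) (\<lambda>t. of_real (g t) * ((cis t + z) / (cis t - z)))) holomorphic_on unit_disc"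
  proof (rule leibniz_rule_holomorphic)
    fix z t assume z: "z \<in> unit_disc"
    have nz: "cis t - z \<noteq> 0" using cis_minus_nonzero[of z t] z by simp
    show "((\<lambda>z. of_real (g t) * ((cis t + z) / (cis t - z))) has_field_derivative
           of_real (g t) * (2 * cis t / (cis t - z)\<^sup>2)) (at z within unit_disc)"
      using nz by (auto intro!: derivative_eq_intros simp: field_simps power2_eq_square)
  next
    show "(\<lambda>t. of_real (g t) * ((cis t + z) / (cis t - z))) integrable_on cbox 0 (2*pi)" if "z \<in> unit_disc" for z
      using herglotz_integrable[OF g, of z] that by simp
    show "continuous_on (unit_disc \<times> cbox 0 (2 * pi)) (\<lambda>(z, t). of_real (g t) * (2 * cis t / (cis t - z)\<^sup>2))"
      unfolding split_def using cis_minus_nonzero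
      by (intro continuous_intros continuous_on_compose2[OF g] continuous_on_compose2[OF continuous_on_cis]) auto
  qed simp
  then have "(\<lambda>z. integral (cbox 0 (2*pi)) (\<lambda>t. of_real (g t) * ((cis t + z) / (cis t - z))) / (2 * pi)) holomorphic_on unit_disc"
    by (intro holomorphic_intros) auto
  then show ?thesis by (simp add: herglotz_def[abs_def])
qed

lemma Re_herglotz:
  assumes "continuous_on {0..2*pi} g" "cmod z < 1"
  shows "2 * pi * Re (herglotz g z) = integral {0..2*pi} (\<lambda>t. g t * poisson_kernel 1 z t)"
proof -
  have "((\<lambda>t. Re (of_real (g t) * ((cis t + z) / (cis t - z)))) has_integral
     Re (integral {0..2*pi} (\<lambda>t. of_real (g t) * ((cis t + z) / (cis t - z))))) {0..2*pi}"
    by (intro has_integral_Re integrable_integral herglotz_integrable assms)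
  moreover have "Re (of_real (g t) * ((cis t + z) / (cis t - z))) = g t * poisson_kernel 1 z t" for t
    using poisson_kernel_eq[OF assms(2), of t] by (simp only: Re_complex_of_real Im_complex_of_real times_complex.sel) simp
  ultimately show ?thesis by (simp add: herglotz_def integral_unique)
qed

lemma Im_herglotz_0:
  assumes "continuous_on {0..2*pi} g"
  shows "Im (herglotz g 0) = 0"
proof -
  have "((\<lambda>t. Im (of_real (g t) * ((cis t + 0) / (cis t - 0)))) has_integral
     Im (integral {0..2*pi} (\<lambda>t. of_real (g t) * ((cis t + 0) / (cis t - 0))))) {0..2*pi}"
    by (intro has_integral_Im integrable_integral herglotz_integrable assms) simp
  then show ?thesis by (simp add: herglotz_def integral_unique)
qed

text \<open>Jensen's inequality for the probability density
  \<open>poisson_kernel 1 z t / (2 * pi)\<close>: the variance of g about its mean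
  \<open>Re (herglotz g z)\<close> is nonnegative.\<close>

lemma Re_herglotz_square_le:
  assumes g: "continuous_on {0..2*pi} g" and z: "cmod z < 1"
  shows "2 * pi * (Re (herglotz g z))\<^sup>2 \<le> integral {0..2*pi} (\<lambda>t. (g t)\<^sup>2 * poisson_kernel 1 z t)"
proof -
  let ?c = "Re (herglotz g z)" and ?P = "poisson_kernel 1 z"
  have P: "(?P has_integral 2 * pi) {0..2*pi}" by (rule integral_poisson_kernel[OF z])
  have i1: "(\<lambda>t. g t * ?P t) integrable_on {0..2*pi}" and i2: "(\<lambda>t. (g t)\<^sup>2 * ?P t) integrable_on {0..2*pi}"
    using z by (intro integrable_continuous_interval continuous_intros g; simp)+
  have "0 \<le> integral {0..2*pi} (\<lambda>t. (g t - ?c)\<^sup>2 * ?P t)"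
    by (intro integral_nonneg mult_nonneg_nonneg poisson_kernel_nonneg z integrable_continuous_interval continuous_intros g)
       (use z in auto)
  also have "(\<lambda>t. (g t - ?c)\<^sup>2 * ?P t) = (\<lambda>t. (g t)\<^sup>2 * ?P t - 2 * ?c * (g t * ?P t) + ?c\<^sup>2 * ?P t)"
    by (simp add: power2_eq_square algebra_simps fun_eq_iff)
  also have "integral {0..2*pi} \<dots> = integral {0..2*pi} (\<lambda>t. (g t)\<^sup>2 * ?P t) - 2 * ?c * (2 * pi * ?c) + ?c\<^sup>2 * (2 * pi)"
  proof (rule integral_unique, intro has_integral_add has_integral_diff has_integral_mult_right P)
    show "((\<lambda>t. (g t)\<^sup>2 * ?P t) has_integral integral {0..2*pi} (\<lambda>t. (g t)\<^sup>2 * ?P t)) {0..2*pi}"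
      using i2 by (rule integrable_integral)
    show "((\<lambda>t. g t * ?P t) has_integral 2 * pi * ?c) {0..2*pi}"
      unfolding Re_herglotz[OF g z] using i1 by (rule integrable_integral)
  qed
  finally show ?thesis by (simp add: power2_eq_square algebra_simps)
qed

text \<open>The Hilbert transform is an \<open>L\<^sup>2\<close> isometry up to the mean: \<open>Re (G\<^sup>2)\<close> has mean \<open>G(0)\<^sup>2 \<ge> 0\<close>.\<close>
lemma herglotz_hardy_mean:
  assumes g: "continuous_on {0..2*pi} g" and r: "0 < r" "r < 1"
  shows "hardy_mean 2 (herglotz g) r \<le> 2 * integral {0..2*pi} (\<lambda>t. (g t)\<^sup>2)"
proof -
  let ?G = "herglotz g"
  have hol: "?G holomorphic_on unit_disc" by (rule herglotz_holomorphic[OF g])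
  have cG: "continuous_on {0..2*pi} (\<lambda>t. ?G (of_real r * cis t))"
    by (rule continuous_on_disc_circle[OF hol]) (use r in auto)
  have "((\<lambda>t. (?G (r * cis t))\<^sup>2) has_integral 2 * pi * (?G 0)\<^sup>2) {0..2*pi}"
    using r by (intro mean_value_center holomorphic_on_imp_continuous_on holomorphic_intros
        holomorphic_on_subset[OF hol]) auto
  then have "((\<lambda>t. Re ((?G (r * cis t))\<^sup>2)) has_integral Re (2 * pi * (?G 0)\<^sup>2)) {0..2*pi}"
    by (rule has_integral_Re)
  moreover have "Re (2 * pi * (?G 0)\<^sup>2) = 2 * pi * (Re (?G 0))\<^sup>2"
    using Im_herglotz_0[OF g] by (simp add: power2_eq_square)
  ultimately have sq: "((\<lambda>t. Re ((?G (r * cis t))\<^sup>2)) has_integral 2 * pi * (Re (?G 0))\<^sup>2) {0..2*pi}" by simp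
  have "integral {0..2*pi} (\<lambda>t. 2 * pi * (Re (?G (r * cis t)))\<^sup>2)
     \<le> integral {0..2*pi} (\<lambda>s. integral {0..2*pi} (\<lambda>t. (g t)\<^sup>2 * poisson_kernel 1 (r * cis s) t))"
  proof (intro integral_le integrable_continuous_interval)
    show "continuous_on {0..2*pi} (\<lambda>t. 2 * pi * (Re (?G (r * cis t)))\<^sup>2)"
      by (intro continuous_intros cG)
    have "continuous_on ({0..2*pi} \<times> cbox 0 (2*pi)) (\<lambda>(s, t). (g t)\<^sup>2 * poisson_kernel 1 (r * cis s) t)"
      unfolding split_def
      by (intro continuous_intros continuous_on_compose2[OF g]
          continuous_on_compose2[OF continuous_on_cis]) (use r in auto)
    then show "continuous_on {0..2*pi} (\<lambda>s. integral {0..2*pi} (\<lambda>t. (g t)\<^sup>2 * poisson_kernel 1 (r * cis s) t))"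
      using integral_continuous_on_param[of "{0..2*pi}" 0 "2*pi"] by simp
    show "2 * pi * (Re (?G (r * cis s)))\<^sup>2 \<le> integral {0..2*pi} (\<lambda>t. (g t)\<^sup>2 * poisson_kernel 1 (r * cis s) t)" for s
      using r by (intro Re_herglotz_square_le g) auto
  qed
  also have "\<dots> = 2 * pi * integral {0..2*pi} (\<lambda>t. (g t)\<^sup>2 * poisson_kernel 1 0 t)"
    by (rule poisson_integral_mean[of r "\<lambda>z. z" 1 "\<lambda>t. (g t)\<^sup>2"]) (use r in \<open>auto intro!: continuous_intros g\<close>)
  finally have "2 * pi * integral {0..2*pi} (\<lambda>t. (Re (?G (r * cis t)))\<^sup>2) \<le> 2 * pi * integral {0..2*pi} (\<lambda>t. (g t)\<^sup>2)"
    by (simp add: poisson_kernel_def)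
  then have re: "integral {0..2*pi} (\<lambda>t. (Re (?G (r * cis t)))\<^sup>2) \<le> integral {0..2*pi} (\<lambda>t. (g t)\<^sup>2)"
    by simp
  \<comment> \<open>By \<open>(cmod w)\<^sup>2 = 2 * (Re w)\<^sup>2 - Re (w\<^sup>2)\<close> the
    whole square mean reduces to that of the real part and the mean of
    \<open>Re (?G\<^sup>2)\<close>, which is known from the value at 0.\<close>
  have "hardy_mean 2 ?G r = integral {0..2*pi} (\<lambda>t. 2 * (Re (?G (r * cis t)))\<^sup>2 - Re ((?G (r * cis t))\<^sup>2))"
  proof -
    have "(cmod w)\<^sup>2 = 2 * (Re w)\<^sup>2 - Re (w\<^sup>2)" for w
      unfolding cmod_power2 by (simp add: power2_eq_square)
    then show ?thesis unfolding hardy_mean_two by (simp only:)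
  qed
  also have "\<dots> = 2 * integral {0..2*pi} (\<lambda>t. (Re (?G (r * cis t)))\<^sup>2) - 2 * pi * (Re (?G 0))\<^sup>2"
  proof (rule integral_unique, intro has_integral_diff has_integral_mult_right sq integrable_integral)
    show "(\<lambda>t. (Re (?G (r * cis t)))\<^sup>2) integrable_on {0..2*pi}"
      by (intro integrable_continuous_interval continuous_intros cG)
  qed
  also have "\<dots> \<le> 2 * integral {0..2*pi} (\<lambda>t. (g t)\<^sup>2) - 0"
    by (intro diff_mono mult_left_mono re) auto
  finally show ?thesis by simp
qed

lemma zero_free_radii:
  fixes f :: "complex \<Rightarrow> complex"
  assumes f: "f holomorphic_on unit_disc" and nz: "\<exists>w\<in>unit_disc. f w \<noteq> 0"
  obtains R :: "nat \<Rightarrow> real" where "\<And>n. 0 < R n" "\<And>n. R n < 1"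
    "\<And>n z. z \<in> sphere 0 (R n) \<Longrightarrow> f z \<noteq> 0" "R \<longlonglongrightarrow> 1"
proof -
  have "\<exists>R. 1 - 1 / (real n + 2) < R \<and> 0 < R \<and> R < 1 \<and> (\<forall>z\<in>sphere 0 R. f z \<noteq> 0)" for n
  proof (rule zero_free_circle_exists[OF f nz, of "1 - 1 / (real n + 2)"])
    show "1 - 1 / (real n + 2) < 1" by simp
  qed blast
  then obtain R where R: "\<And>n. 1 - 1 / (real n + 2) < R n" "\<And>n. 0 < R n" "\<And>n. R n < 1"
    "\<And>n. \<forall>z\<in>sphere 0 (R n). f z \<noteq> 0" by metis
  have "(\<lambda>n. 1 - 1 / (real n + 2)) \<longlonglongrightarrow> 1" by real_asymp
  then have "R \<longlonglongrightarrow> 1"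
  proof (rule tendsto_sandwich[rotated 2, OF _ tendsto_const])
    show "\<forall>\<^sub>F n in sequentially. 1 - 1 / (real n + 2) \<le> R n" using R(1) by (simp add: less_imp_le)
    show "\<forall>\<^sub>F n in sequentially. R n \<le> 1" using R(3) by (simp add: less_imp_le)
  qed
  then show ?thesis using that[of R] R by blast
qed

lemma poisson_kernel_scale:
  assumes "R > 0"
  shows "poisson_kernel R (of_real R * z) t = poisson_kernel 1 z t"
proof -
  have "cmod (of_real R * cis t - of_real R * z) = R * cmod (cis t - z)"
    using assms by (simp add: norm_mult flip: right_diff_distrib)
  moreover have "R\<^sup>2 - (cmod (of_real R * z))\<^sup>2 = R\<^sup>2 * (1 - (cmod z)\<^sup>2)"
    by (simp add: norm_mult power_mult_distrib algebra_simps)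
  ultimately show ?thesis using assms by (simp add: poisson_kernel_def power_mult_distrib)
qed

text \<open>The exponent p/2 is chosen because the square of \<open>cmod f powr (p / 2)\<close> has
  bounded means, which puts the majorant in H^2. In place of a boundary function, Herglotz integrals
  over zero-free circles tending to the unit circle are used, rescaled to the unit disc, and a
  normal families limit is taken.\<close>

lemma hardy_majorant:
  assumes f: "f \<in> hardy_space p" and p: "p > 0"
  obtains G where "G \<in> hardy_space 2" "\<And>z. z \<in> unit_disc \<Longrightarrow> cmod (f z) powr (p / 2) \<le> Re (G z)"
proof (cases "\<exists>w\<in>unit_disc. f w \<noteq> 0")
  case False
  have "(\<lambda>z. 0) \<in> hardy_space 2"
    by (rule hardy_spaceI[where M = 0]) (auto simp: hardy_mean_def)
  then show ?thesis using that[of "\<lambda>z. 0"] False by auto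
next
  case True
  note hol = hardy_space_holomorphic[OF f]
  obtain R where R: "\<And>n. 0 < R n" "\<And>n. R n < 1" "\<And>n z. z \<in> sphere 0 (R n) \<Longrightarrow> f z \<noteq> 0" "R \<longlonglongrightarrow> 1"
    using zero_free_radii[OF hol True] by blast
  define g where "g = (\<lambda>n t. cmod (f (R n * cis t)) powr (p / 2))"
  have g: "continuous_on {0..2*pi} (g n)" for n
    unfolding g_def
  proof (intro continuous_on_powr' continuous_intros continuous_on_disc_circle hol)
    show "\<bar>R n\<bar> < 1" using R(1,2)[of n] by simp
  qed (use p in auto)
  define M where "M = 2 * hardy_norm p f powr p"
  have mean: "hardy_mean 2 (herglotz (g n)) r \<le> M" if r: "0 < r" "r < 1" for n r
  proof -
    have "integral {0..2*pi} (\<lambda>t. (g n t)\<^sup>2) = hardy_mean p f (R n)"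
      unfolding hardy_mean_def g_def
      by (intro integral_cong) (simp add: power2_eq_square flip: powr_add)
    then show ?thesis
      using herglotz_hardy_mean[OF g r, of n] hardy_mean_le_norm[OF f R(1) R(2) p, of n]
      by (simp add: M_def)
  qed
  \<comment> \<open>The point bound for H^2, uniform in n, makes the Herglotz integrals a normal
    family.\<close>
  have bound: "cmod (herglotz (g n) z) \<le> sqrt (4 / (1 - cmod z) * M)" if "z \<in> unit_disc" for n z
  proof -
    have "cmod (herglotz (g n) z) powr 2 \<le> 4 / (1 - cmod z) * M"
      by (rule hardy_point_bound[where ?r0.0 = 0, OF herglotz_holomorphic[OF g]]) (use that mean in auto)
    then show ?thesis by (intro real_le_rsqrt) simp
  qed
  obtain G s where G: "G holomorphic_on unit_disc" "strict_mono (s :: nat \<Rightarrow> nat)"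
    "\<And>x. x \<in> unit_disc \<Longrightarrow> (\<lambda>n. herglotz (g (s n)) x) \<longlonglongrightarrow> G x"
  proof (rule montel_pointwise_bound[of unit_disc "\<lambda>n. herglotz (g n)" "\<lambda>z. sqrt (4 / (1 - cmod z) * M)"])
    show "continuous_on unit_disc (\<lambda>z. sqrt (4 / (1 - cmod z) * M))"
      by (intro continuous_intros) auto
  qed (use herglotz_holomorphic[OF g] bound in auto)
  define G' where "G' = (\<lambda>z. if z \<in> unit_disc then G z else 0)"
  show ?thesis
  proof (rule that)
    show "G' \<in> hardy_space 2"
    proof (rule hardy_spaceI)
      show "G' holomorphic_on unit_disc"
        by (rule holomorphic_transform[OF G(1)]) (simp add: G'_def)
      fix r :: real assume r: "0 < r" "r < 1"
      have "(\<lambda>n. hardy_mean 2 (herglotz (g (s n))) r) \<longlonglongrightarrow> hardy_mean 2 G' r"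
      proof (rule hardy_mean_tendsto[where C = "sqrt (4 / (1 - r) * M)"])
        show "cmod (herglotz (g (s n)) z) \<le> sqrt (4 / (1 - r) * M)" if "cmod z = r" for n z
          using bound[of z "s n"] that r by simp
        show "(\<lambda>n. herglotz (g (s n)) z) \<longlonglongrightarrow> G' z" if "cmod z = r" for z
          using G(3)[of z] that r by (simp add: G'_def)
      qed (use r herglotz_holomorphic[OF g] in auto)
      then show "hardy_mean 2 G' r \<le> M"
        by (rule LIMSEQ_le_const2) (use mean[OF r] in auto)
    qed (simp add: G'_def)
    fix z :: complex assume z: "z \<in> unit_disc"
    have Rz: "R n * z \<in> unit_disc" for n
    proof -
      have "R n * cmod z < 1 * 1" using R(1,2)[of n] z by (intro mult_strict_mono) auto
      then show ?thesis using R(1)[of n] by (simp add: norm_mult)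
    qed
    have le: "cmod (f (R n * z)) powr (p / 2) \<le> Re (herglotz (g n) z)" for n
    proof -
      have "2 * pi * cmod (f (R n * z)) powr (p / 2) \<le> integral {0..2*pi}
          (\<lambda>t. cmod (f (R n * cis t)) powr (p / 2) * poisson_kernel (R n) (R n * z) t)"
      proof (rule subharmonic_norm_powr[OF hol])
        show "cball 0 (R n) \<subseteq> unit_disc" using R(2)[of n] by auto
        show "cmod (R n * z) < R n" using R(1)[of n] z by (simp add: norm_mult)
      qed (use R(3) p in auto)
      also have "\<dots> = 2 * pi * Re (herglotz (g n) z)"
        using z R(1) by (subst Re_herglotz[OF g]) (auto simp: g_def poisson_kernel_scale)
      finally show ?thesis by simp
    qed
    have "isCont f z"
      using hol z by (meson continuous_on_eq_continuous_at holomorphic_on_imp_continuous_on open_ball)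
    moreover have "(\<lambda>n. complex_of_real (R n) * z) \<longlonglongrightarrow> of_real 1 * z"
      by (intro tendsto_intros R(4))
    ultimately have "(\<lambda>n. f (R n * z)) \<longlonglongrightarrow> f z"
      by (intro isCont_tendsto_compose[of z f]) auto
    then have "(\<lambda>n. cmod (f (R n * z)) powr (p / 2)) \<longlonglongrightarrow> cmod (f z) powr (p / 2)"
      using p by (intro tendsto_powr' tendsto_intros) auto
    then have "(\<lambda>n. cmod (f (R (s n) * z)) powr (p / 2)) \<longlonglongrightarrow> cmod (f z) powr (p / 2)"
      using LIMSEQ_subseq_LIMSEQ[OF _ G(2)] by (force simp: o_def)
    moreover have "(\<lambda>n. Re (herglotz (g (s n)) z)) \<longlonglongrightarrow> Re (G' z)"
      using G(3)[OF z] z by (auto simp: G'_def intro!: tendsto_intros)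
    ultimately show "cmod (f z) powr (p / 2) \<le> Re (G' z)"
      by (rule LIMSEQ_le) (use le in auto)
  qed
qed

text \<open>A dilate has H^2 norm at most that of G, while its sum with G has norm close to twice
  that of G when the dilation is close to the identity. By the parallelogram law the difference is
  then small.\<close>

lemma hardy_dilation_approx:
  assumes G: "G \<in> hardy_space 2" and e: "0 < e"
  obtains \<rho> where "0 < \<rho>" "\<rho> < 1"
    "\<And>r. 0 < r \<Longrightarrow> r < 1 \<Longrightarrow> hardy_mean 2 (\<lambda>z. G z - G (of_real \<rho> * z)) r \<le> e"
proof -
  note hol = hardy_space_holomorphic[OF G]
  \<comment> \<open>Four times the margin \<open>e / 8\<close> is \<open>e / 2\<close>, so
    \<open>4 * hardy_mean 2 G r\<close> still exceeds \<open>4 * hardy_sup G - e\<close> strictly,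
    with room for replacing one copy of G by a dilate.\<close>
  have "\<exists>r\<in>{0<..<1}. hardy_sup G - e / 8 < hardy_mean 2 G r"
    using less_cSUP_iff[of "{0<..<1::real}" "hardy_mean 2 G" "hardy_sup G - e / 8"] G e
    by (simp add: hardy_sup_def hardy_space_def)
  then obtain r where r: "0 < r" "r < 1" "hardy_sup G - e / 8 < hardy_mean 2 G r" by auto
  define \<rho> where "\<rho> = (\<lambda>n::nat. 1 - 1 / (real n + 2))"
  have \<rho>: "0 < \<rho> n" "\<rho> n < 1" for n by (auto simp: \<rho>_def field_simps)
  have \<rho>1: "\<rho> \<longlonglongrightarrow> 1" unfolding \<rho>_def by real_asymp
  define D where "D = (\<lambda>n z. if z \<in> unit_disc then G (of_real (\<rho> n) * z) else 0)"
  have D_in: "of_real (\<rho> n) * z \<in> unit_disc" if "z \<in> unit_disc" for n z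
  proof -
    have "\<rho> n * cmod z < 1 * 1" using \<rho>[of n] that by (intro mult_strict_mono) auto
    then show ?thesis using \<rho>[of n] by (simp add: norm_mult)
  qed
  have holD: "(\<lambda>z. G (of_real (\<rho> n) * z)) holomorphic_on unit_disc" for n
  proof -
    have "(G \<circ> (\<lambda>z. of_real (\<rho> n) * z)) holomorphic_on unit_disc"
      by (rule holomorphic_on_compose_gen[OF _ hol image_subsetI]) (rule D_in | intro holomorphic_intros)+
    then show ?thesis by (simp add: o_def)
  qed
  have meanD: "hardy_mean 2 (D n) r \<le> hardy_sup G" if r: "0 < r" "r < 1" for n r
  proof -
    have "hardy_mean 2 (D n) r = hardy_mean 2 G (\<rho> n * r)"
      unfolding hardy_mean_def using r by (intro integral_cong) (auto simp: D_def mult.assoc)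
    moreover have "\<rho> n * r < 1 * 1" using \<rho>[of n] r by (intro mult_strict_mono) auto
    ultimately show ?thesis using \<rho>[of n] r by (simp add: hardy_mean_le_sup[OF G])
  qed
  have D: "D n \<in> hardy_space 2" for n
  proof (rule hardy_spaceI[OF _ _ meanD])
    show "D n holomorphic_on unit_disc"
      by (rule holomorphic_transform[OF holD]) (simp add: D_def)
  qed (simp_all add: D_def)
  have supD: "hardy_sup (D n) \<le> hardy_sup G" for n
    by (rule hardy_sup_least[OF meanD])
  have "compact (G ` cball 0 r)"
    using r by (intro compact_continuous_image holomorphic_on_imp_continuous_on holomorphic_on_subset[OF hol]) auto
  then obtain C where C: "\<And>z. z \<in> cball 0 r \<Longrightarrow> cmod (G z) \<le> C"
    using compact_imp_bounded[of "G ` cball 0 r"] unfolding bounded_iff by blast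
  have "(\<lambda>n. hardy_mean 2 (\<lambda>z. G z + D n z) r) \<longlonglongrightarrow> hardy_mean 2 (\<lambda>z. G z + G z) r"
  proof (rule hardy_mean_tendsto[where C = "C + C"])
    fix n and z :: complex assume z: "cmod z = r"
    have "\<rho> n * cmod z \<le> 1 * r" using \<rho>[of n] z r by (intro mult_mono) auto
    then have "cmod (G (of_real (\<rho> n) * z)) \<le> C" using \<rho>[of n] by (intro C) (simp add: norm_mult)
    then show "cmod (G z + D n z) \<le> C + C"
      using C[of z] z r norm_triangle_ineq[of "G z" "D n z"] by (simp add: D_def)
  next
    fix z :: complex assume z: "cmod z = r"
    have "isCont G z"
      using hol z r by (meson continuous_on_eq_continuous_at holomorphic_on_imp_continuous_on open_ball mem_ball_0)
    moreover have "(\<lambda>n. complex_of_real (\<rho> n) * z) \<longlonglongrightarrow> of_real 1 * z"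
      by (intro tendsto_intros \<rho>1)
    ultimately have "(\<lambda>n. G (of_real (\<rho> n) * z)) \<longlonglongrightarrow> G z"
      by (intro isCont_tendsto_compose[of z G]) auto
    from tendsto_add[OF tendsto_const[of "G z"] this]
    show "(\<lambda>n. G z + D n z) \<longlonglongrightarrow> G z + G z"
      using z r by (simp add: D_def)
  qed (use r hol hardy_space_holomorphic[OF D] in \<open>auto intro!: holomorphic_intros\<close>)
  moreover have "hardy_mean 2 (\<lambda>z. G z + G z) r = 4 * hardy_mean 2 G r"
    unfolding hardy_mean_two by (simp add: power_mult_distrib norm_mult flip: mult_2 integral_mult_right)
  ultimately have "(\<lambda>n. hardy_mean 2 (\<lambda>z. G z + D n z) r) \<longlonglongrightarrow> 4 * hardy_mean 2 G r" by simp
  moreover have "4 * hardy_sup G - e < 4 * hardy_mean 2 G r" using r(3) e by argo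
  ultimately have "\<forall>\<^sub>F n in sequentially. 4 * hardy_sup G - e < hardy_mean 2 (\<lambda>z. G z + D n z) r"
    by (rule order_tendstoD(1))
  then obtain n where n: "4 * hardy_sup G - e < hardy_mean 2 (\<lambda>z. G z + D n z) r"
    using eventually_happens trivial_limit_sequentially by blast
  also have "\<dots> \<le> hardy_sup (\<lambda>z. G z + D n z)"
    by (intro hardy_mean_le_sup hardy_space_add(1) G D r) simp
  finally have le: "hardy_sup (\<lambda>z. G z - D n z) \<le> e"
    using hardy_sup_parallelogram[OF G D, of n] supD[of n] by linarith
  show ?thesis
  proof (rule that[OF \<rho>])
    fix r :: real assume r: "0 < r" "r < 1"
    have "hardy_mean 2 (\<lambda>z. G z - G (of_real (\<rho> n) * z)) r = hardy_mean 2 (\<lambda>z. G z - D n z) r"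
      unfolding hardy_mean_def using r by (intro integral_cong) (auto simp: D_def)
    also have "\<dots> \<le> e"
      using hardy_mean_le_sup[OF hardy_space_diff[OF G D] r, of n] le by simp
    finally show "hardy_mean 2 (\<lambda>z. G z - G (of_real (\<rho> n) * z)) r \<le> e" .
  qed
qed

text \<open>The error is controlled by |G|^2 |1 - x| with |1 - x| at most 1 and at most |G| / N, but
  the means of |G|^3 need not be bounded. So a dilation of G splits |G|^2 into a bounded part,
  paired with the small factor |G| / N, and a remainder E of small square mean, paired with the
  factor 1.\<close>

lemma hardy_bounded_approx:
  assumes f: "f \<in> hardy_space p" and p: "p \<ge> 1" and d: "0 < d"
  obtains F where "F \<in> bounded_analytic"
    "\<And>r. 0 < r \<Longrightarrow> r < 1 \<Longrightarrow> hardy_mean p (\<lambda>z. f z - F z) r \<le> d"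
proof -
  have p0: "p > 0" using p by simp
  note holf = hardy_space_holomorphic[OF f]
  obtain G where G: "G \<in> hardy_space 2" "\<And>z. z \<in> unit_disc \<Longrightarrow> cmod (f z) powr (p / 2) \<le> Re (G z)"
    using hardy_majorant[OF f p0] by blast
  note holG = hardy_space_holomorphic[OF G(1)]
  have ReG: "0 \<le> Re (G z)" if "z \<in> unit_disc" for z
    using order_trans[OF powr_ge_zero G(2)[OF that]] .
  have fG: "cmod (f z) powr p \<le> (cmod (G z))\<^sup>2" if "z \<in> unit_disc" for z
  proof -
    have "cmod (f z) powr p = (cmod (f z) powr (p / 2))\<^sup>2"
      by (simp add: power2_eq_square flip: powr_add)
    also have "\<dots> \<le> (cmod (G z))\<^sup>2"
      using order_trans[OF G(2)[OF that] complex_Re_le_cmod] by (intro power_mono) auto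
    finally show ?thesis .
  qed
  \<comment> \<open>The remainder E enters with the factor \<open>2 powr p * 2\<close>, so this
    choice limits its share to \<open>d / 4\<close>; N below limits the bounded part to
    \<open>d / 2\<close>.\<close>
  define \<delta> where "\<delta> = d / (8 * 2 powr p)"
  have \<delta>: "0 < \<delta>" using d by (simp add: \<delta>_def)
  obtain \<rho> where \<rho>: "0 < \<rho>" "\<rho> < 1"
    "\<And>r. 0 < r \<Longrightarrow> r < 1 \<Longrightarrow> hardy_mean 2 (\<lambda>z. G z - G (of_real \<rho> * z)) r \<le> \<delta>"
    using hardy_dilation_approx[OF G(1) \<delta>] by blast
  define E where "E = (\<lambda>z. G z - G (of_real \<rho> * z))"
  have "compact (G ` cball 0 \<rho>)"
    using \<rho> by (intro compact_continuous_image holomorphic_on_imp_continuous_on holomorphic_on_subset[OF holG]) auto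
  then obtain C where C: "\<And>z. z \<in> cball 0 \<rho> \<Longrightarrow> cmod (G z) \<le> C"
    using compact_imp_bounded[of "G ` cball 0 \<rho>"] unfolding bounded_iff by blast
  have GE: "(cmod (G z))\<^sup>2 \<le> 2 * C\<^sup>2 + 2 * (cmod (E z))\<^sup>2" if z: "z \<in> unit_disc" for z
  proof -
    have "\<rho> * cmod z \<le> \<rho> * 1" using \<rho> z by (intro mult_left_mono) auto
    then have "cmod (G (of_real \<rho> * z)) \<le> C" using \<rho> by (intro C) (simp add: norm_mult)
    then have "cmod (G z) \<le> C + cmod (E z)"
      using norm_triangle_ineq[of "G (of_real \<rho> * z)" "E z"] by (simp add: E_def)
    then have "(cmod (G z))\<^sup>2 \<le> (C + cmod (E z))\<^sup>2" by (intro power_mono) auto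
    also have "\<dots> \<le> 2 * C\<^sup>2 + 2 * (cmod (E z))\<^sup>2"
      using zero_le_power2[of "C - cmod (E z)"] by (simp add: power2_eq_square algebra_simps)
    finally show ?thesis .
  qed
  define S where "S = 2 * pi + hardy_sup G"
  have S: "S > 0" using hardy_sup_nonneg[OF G(1)] pi_gt_zero unfolding S_def by linarith
  obtain N :: nat where N: "2 powr p * (2 * C\<^sup>2) * S / (d / 2) < real N" using reals_Archimedean2 by blast
  moreover have "0 \<le> 2 powr p * (2 * C\<^sup>2) * S / (d / 2)" using S d by auto
  ultimately have N0: "N > 0" by (cases N) auto
  define x where "x = (\<lambda>z. 1 / (1 + G z / N))"
  have re1: "1 \<le> Re (1 + G z / N)" if "z \<in> unit_disc" for z
    using ReG[OF that] by simp
  have nz: "1 + G z / N \<noteq> 0" if "z \<in> unit_disc" for z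
    using re1[OF that] by (metis not_one_le_zero zero_complex.sel(1))
  have m1: "1 \<le> cmod (1 + G z / N)" if "z \<in> unit_disc" for z
    using order_trans[OF re1[OF that] complex_Re_le_cmod] .
  have m2: "cmod (G z / N) \<le> cmod (1 + G z / N)" if "z \<in> unit_disc" for z
  proof (rule power2_le_imp_le)
    show "(cmod (G z / N))\<^sup>2 \<le> (cmod (1 + G z / N))\<^sup>2"
      unfolding cmod_power2 using ReG[OF that] by (intro add_mono) (auto intro!: power_mono)
  qed auto
  have x1: "cmod (x z) \<le> 1" if "z \<in> unit_disc" for z
    using m1[OF that] by (simp add: x_def norm_divide divide_simps)
  have one_x: "1 - x z = G z / N * x z" if "z \<in> unit_disc" for z
    using nz[OF that] N0 by (simp add: x_def field_simps)
  have one_x1: "cmod (1 - x z) \<le> 1" and one_x2: "cmod (1 - x z) \<le> cmod (G z) / N" if "z \<in> unit_disc" for z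
  proof -
    have "cmod (1 - x z) = cmod (G z / N) / cmod (1 + G z / N)"
      unfolding one_x[OF that] by (simp add: x_def norm_mult norm_divide)
    also have "\<dots> \<le> 1" using m2[OF that] m1[OF that] by (intro divide_le_eq_1[THEN iffD2]) auto
    finally show "cmod (1 - x z) \<le> 1" .
    have "cmod (1 - x z) = cmod (G z / N) * cmod (x z)" unfolding one_x[OF that] by (rule norm_mult)
    also have "\<dots> \<le> cmod (G z / N) * 1" by (intro mult_left_mono x1[OF that]) auto
    finally show "cmod (1 - x z) \<le> cmod (G z) / N" by (simp add: norm_divide)
  qed
  have holx: "x holomorphic_on unit_disc"
    unfolding x_def using nz N0 by (intro holomorphic_intros holG) auto
  define F where "F = (\<lambda>z. f z * (x z)\<^sup>2)"
  show ?thesis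
  proof (rule that)
    show "F \<in> bounded_analytic"
    proof (rule bounded_analyticI)
      show "F holomorphic_on unit_disc" unfolding F_def by (intro holomorphic_intros holf holx)
      show "F z = 0" if "z \<notin> unit_disc" for z using hardy_space_outside[OF f that] by (simp add: F_def)
      fix z assume z: "z \<in> unit_disc"
      \<comment> \<open>This explains the square of \<open>x\<close> in \<open>F\<close>: f grows at
        most like the square of \<open>1 + cmod (G z)\<close>, and the product of
        \<open>1 + cmod (G z)\<close> with \<open>cmod (x z)\<close> is bounded.\<close>
      have "cmod (f z) \<le> (1 + cmod (G z))\<^sup>2"
      proof (cases "cmod (f z) \<le> 1")
        case True
        moreover have "1 \<le> (1 + cmod (G z))\<^sup>2" by (rule one_le_power) simp
        ultimately show ?thesis by linarith
      next
        case False
        then have "cmod (f z) powr 1 \<le> cmod (f z) powr p" using p by (intro powr_mono) auto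
        also have "\<dots> \<le> (cmod (G z))\<^sup>2" by (rule fG[OF z])
        also have "\<dots> \<le> (1 + cmod (G z))\<^sup>2" by (intro power_mono) auto
        finally show ?thesis using False by simp
      qed
      moreover have "(1 + cmod (G z)) * cmod (x z) \<le> 1 + real N"
      proof -
        have "cmod (G z) \<le> N * cmod (1 + G z / N)" using m2[OF z] N0 by (simp add: norm_divide field_simps)
        then have "1 + cmod (G z) \<le> (1 + real N) * cmod (1 + G z / N)" using m1[OF z] by (simp add: algebra_simps)
        then show ?thesis using m1[OF z] by (simp add: x_def norm_divide divide_simps split: if_splits)
      qed
      then have "((1 + cmod (G z)) * cmod (x z))\<^sup>2 \<le> (1 + real N)\<^sup>2" by (intro power_mono) auto
      ultimately show "cmod (F z) \<le> (1 + real N)\<^sup>2"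
        using mult_right_mono[of "cmod (f z)" "(1 + cmod (G z))\<^sup>2" "(cmod (x z))\<^sup>2"]
        by (simp add: F_def norm_mult norm_power power_mult_distrib)
    qed
    fix r :: real assume r: "0 < r" "r < 1"
    have pt: "cmod (f z - F z) powr p \<le> 2 powr p * (2 * C\<^sup>2 * ((1 + (cmod (G z))\<^sup>2) / N) + 2 * (cmod (E z))\<^sup>2)"
      if z: "z \<in> unit_disc" for z
    proof -
      have "f z - F z = f z * ((1 + x z) * (1 - x z))" by (simp add: F_def power2_eq_square algebra_simps)
      then have "cmod (f z - F z) powr p = cmod (f z) powr p * (cmod (1 + x z) * cmod (1 - x z)) powr p"
        by (simp add: norm_mult powr_mult)
      also have "\<dots> \<le> (cmod (G z))\<^sup>2 * (2 powr p * cmod (1 - x z))"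
      proof (intro mult_mono fG z)
        have "cmod (1 + x z) \<le> 2" using norm_triangle_ineq[of 1 "x z"] x1[OF z] by simp
        then have "cmod (1 + x z) powr p \<le> 2 powr p" using p by (intro powr_mono2) auto
        moreover have "cmod (1 - x z) powr p \<le> cmod (1 - x z) powr 1"
          using one_x1[OF z] p by (intro powr_mono') auto
        ultimately show "(cmod (1 + x z) * cmod (1 - x z)) powr p \<le> 2 powr p * cmod (1 - x z)"
          by (simp add: powr_mult mult_mono)
      qed auto
      also have "\<dots> = 2 powr p * ((cmod (G z))\<^sup>2 * cmod (1 - x z))" by simp
      also have "(cmod (G z))\<^sup>2 * cmod (1 - x z) \<le> (2 * C\<^sup>2 + 2 * (cmod (E z))\<^sup>2) * cmod (1 - x z)"
        by (intro mult_right_mono GE z) auto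
      also have "\<dots> = 2 * C\<^sup>2 * cmod (1 - x z) + 2 * (cmod (E z))\<^sup>2 * cmod (1 - x z)"
        by (simp add: algebra_simps)
      also have "\<dots> \<le> 2 * C\<^sup>2 * ((1 + (cmod (G z))\<^sup>2) / N) + 2 * (cmod (E z))\<^sup>2 * 1"
      proof (intro add_mono mult_left_mono one_x1 z)
        have "cmod (G z) \<le> 1 + (cmod (G z))\<^sup>2"
          using zero_le_power2[of "cmod (G z) - 1"] norm_ge_zero[of "G z"] unfolding power2_diff power_one mult_1_right by linarith
        then have "cmod (G z) / N \<le> (1 + (cmod (G z))\<^sup>2) / N" by (rule divide_right_mono) simp
        with one_x2[OF z] show "cmod (1 - x z) \<le> (1 + (cmod (G z))\<^sup>2) / N" by (rule order_trans)
      qed auto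
      finally show ?thesis by simp
    qed
    have i2: "(\<lambda>t. (cmod (h (of_real r * cis t)))\<^sup>2) integrable_on {0..2*pi}" if "h holomorphic_on unit_disc" for h
      using hardy_mean_integrable[OF that, of r 2] r by simp
    have holE: "E holomorphic_on unit_disc"
    proof -
      have "(G \<circ> (\<lambda>z. of_real \<rho> * z)) holomorphic_on unit_disc"
      proof (rule holomorphic_on_compose_gen[OF _ holG image_subsetI])
        fix z :: complex assume "z \<in> unit_disc"
        then have "\<rho> * cmod z < 1 * 1" using \<rho> by (intro mult_strict_mono) auto
        then show "of_real \<rho> * z \<in> unit_disc" using \<rho> by (simp add: norm_mult)
      qed (intro holomorphic_intros)
      then show ?thesis unfolding E_def by (intro holomorphic_intros holG) (simp add: o_def)
    qed
    have "hardy_mean p (\<lambda>z. f z - F z) r \<le> integral {0..2*pi} (\<lambda>t. 2 powr p * (2 * C\<^sup>2 *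
       ((1 + (cmod (G (of_real r * cis t)))\<^sup>2) / N) + 2 * (cmod (E (of_real r * cis t)))\<^sup>2))"
      unfolding hardy_mean_def
    proof (intro integral_le)
      show "(\<lambda>t. cmod (f (of_real r * cis t) - F (of_real r * cis t)) powr p) integrable_on {0..2*pi}"
        by (rule hardy_mean_integrable[of "\<lambda>z. f z - F z"])
           (use r p in \<open>auto simp: F_def intro!: holomorphic_intros holf holx\<close>)
      show "(\<lambda>t. 2 powr p * (2 * C\<^sup>2 * ((1 + (cmod (G (of_real r * cis t)))\<^sup>2) / N)
           + 2 * (cmod (E (of_real r * cis t)))\<^sup>2)) integrable_on {0..2*pi}"
        using r N0 by (intro integrable_continuous_interval continuous_intros
            continuous_on_disc_circle holG holE) auto
    qed (use pt r in auto)
    also have "\<dots> = 2 powr p * (2 * C\<^sup>2 * ((2 * pi + hardy_mean 2 G r) / N) + 2 * hardy_mean 2 E r)"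
    proof (intro integral_unique has_integral_mult_right has_integral_add has_integral_divide)
      show "((\<lambda>t. (cmod (G (of_real r * cis t)))\<^sup>2) has_integral hardy_mean 2 G r) {0..2*pi}"
        unfolding hardy_mean_two by (rule integrable_integral[OF i2[OF holG]])
      show "((\<lambda>t. (cmod (E (of_real r * cis t)))\<^sup>2) has_integral hardy_mean 2 E r) {0..2*pi}"
        unfolding hardy_mean_two by (rule integrable_integral[OF i2[OF holE]])
      show "((\<lambda>t. 1::real) has_integral 2 * pi) {0..2*pi}"
        using has_integral_const_real[of "1::real" 0 "2*pi"] by simp
    qed
    also have "\<dots> \<le> 2 powr p * (2 * C\<^sup>2 * (S / N) + 2 * \<delta>)"
    proof (intro mult_left_mono add_mono divide_right_mono)
      show "2 * pi + hardy_mean 2 G r \<le> S" using hardy_mean_le_sup[OF G(1) r] by (simp add: S_def)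
      show "hardy_mean 2 E r \<le> \<delta>" unfolding E_def by (rule \<rho>(3)[OF r])
    qed auto
    also have "\<dots> = 2 powr p * (2 * C\<^sup>2) * S / N + 2 powr p * 2 * \<delta>" by (simp add: algebra_simps)
    also have "\<dots> \<le> d / 2 + d / 4"
    proof (rule add_mono)
      have "2 powr p * (2 * C\<^sup>2) * S < real N * (d / 2)"
        using N d by (simp only: pos_divide_less_eq[of "d / 2"] half_gt_zero_iff)
      then show "2 powr p * (2 * C\<^sup>2) * S / N \<le> d / 2"
        using N0 by (simp add: pos_divide_le_eq mult.commute)
      show "2 powr p * 2 * \<delta> \<le> d / 4" by (simp add: \<delta>_def)
    qed
    also have "\<dots> \<le> d" using d by simp
    finally show "hardy_mean p (\<lambda>z. f z - F z) r \<le> d" .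
  qed
qed

lemma bounded_functional_eq_0:
  assumes l: "l \<in> bounded_functionals (hardy_space p) (hardy_norm p)" and p: "p \<ge> 1"
    and 0: "\<And>f. f \<in> bounded_analytic \<Longrightarrow> l f = 0" and f: "f \<in> hardy_space p"
  shows "l f = 0"
proof (rule ccontr)
  assume nz: "l f \<noteq> 0"
  have p0: "p > 0" using p by simp
  obtain K where K: "K > 0" "\<And>f. f \<in> hardy_space p \<Longrightarrow> cmod (l f) \<le> K * hardy_norm p f"
    using bounded_functional_bound[OF l] by blast
  define d where "d = cmod (l f) / (2 * K)"
  have d: "d > 0" using nz K by (simp add: d_def)
  then have "0 < d powr p" by simp
  then obtain F where F: "F \<in> bounded_analytic" "\<And>r. 0 < r \<Longrightarrow> r < 1 \<Longrightarrow> hardy_mean p (\<lambda>z. f z - F z) r \<le> d powr p"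
    using hardy_bounded_approx[OF f p] by blast
  note FV = bounded_analytic_hardy[OF F(1) p0]
  have "l (\<lambda>z. f z + (-1) * F z) = l f + (-1) * l F"
    using bounded_functionalD(1)[OF l f hardy_space_scale(1)[OF FV p0, of "-1"]]
      bounded_functionalD(2)[OF l FV, of "-1"] by simp
  then have "l (\<lambda>z. f z - F z) = l f" using 0[OF F(1)] by simp
  then have "cmod (l f) \<le> K * hardy_norm p (\<lambda>z. f z - F z)"
    using K(2)[OF hardy_space_diff[OF f FV p0]] by simp
  also have "\<dots> \<le> K * (d powr p) powr (1 / p)"
    using K(1) by (intro mult_left_mono hardy_norm_le p0 F) auto
  also have "\<dots> = cmod (l f) / 2" using d p0 K by (simp add: powr_powr d_def)
  finally show False using nz by simp
qed

section \<open>Resolvents and Runge's theorem\<close>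

lemma bounded_pointwise_limit_holomorphic:
  fixes F :: "nat \<Rightarrow> complex \<Rightarrow> complex"
  assumes S: "open S" and F: "\<And>n. F n holomorphic_on S" "\<And>n z. z \<in> S \<Longrightarrow> cmod (F n z) \<le> C"
    and lim: "\<And>z. z \<in> S \<Longrightarrow> (\<lambda>n. F n z) \<longlonglongrightarrow> f z"
  shows "f holomorphic_on S"
proof (rule montel_pointwise_bound[OF S F(1), of "\<lambda>_. C"])
  fix g and r :: "nat \<Rightarrow> nat"
  assume g: "g holomorphic_on S" "strict_mono r" "\<And>x. x \<in> S \<Longrightarrow> (\<lambda>n. F (r n) x) \<longlonglongrightarrow> g x"
  have "g z = f z" if "z \<in> S" for z
    using LIMSEQ_unique[OF g(3)[OF that]] LIMSEQ_subseq_LIMSEQ[OF lim[OF that] g(2)] by (simp add: o_def)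
  then show ?thesis by (rule holomorphic_transform[OF g(1)])
qed (use F(2) in auto)

text \<open>Unlike in the classical disc algebra, no continuity up to the circle is asked. By
  \<open>cong\<close> membership depends only on the values on the disc, so members may be written
  as formulas without cutting them off.\<close>

locale disc_algebra =
  fixes \<A> :: "(complex \<Rightarrow> complex) set"
  assumes holo: "f \<in> \<A> \<Longrightarrow> f holomorphic_on unit_disc"
    and bdd: "f \<in> \<A> \<Longrightarrow> \<exists>C. \<forall>z\<in>unit_disc. cmod (f z) \<le> C"
    and cong: "f \<in> \<A> \<Longrightarrow> (\<And>z. z \<in> unit_disc \<Longrightarrow> f z = g z) \<Longrightarrow> g \<in> \<A>"
    and const: "(\<lambda>z. c) \<in> \<A>"
    and add: "f \<in> \<A> \<Longrightarrow> g \<in> \<A> \<Longrightarrow> (\<lambda>z. f z + g z) \<in> \<A>"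
    and mult: "f \<in> \<A> \<Longrightarrow> g \<in> \<A> \<Longrightarrow> (\<lambda>z. f z * g z) \<in> \<A>"
    and lim: "(\<And>n::nat. F n \<in> \<A>) \<Longrightarrow> (\<And>n z. z \<in> unit_disc \<Longrightarrow> cmod (F n z) \<le> C) \<Longrightarrow>
       (\<And>z. z \<in> unit_disc \<Longrightarrow> (\<lambda>n. F n z) \<longlonglongrightarrow> f z) \<Longrightarrow> f \<in> \<A>"
begin

lemma cmult: "f \<in> \<A> \<Longrightarrow> (\<lambda>z. c * f z) \<in> \<A>"
  by (rule mult[OF const])

lemma diff:
  assumes "f \<in> \<A>" "g \<in> \<A>"
  shows "(\<lambda>z. f z - g z) \<in> \<A>"
  using add[OF assms(1) cmult[OF assms(2), of "-1"]] by simp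

lemma sum:
  assumes "\<And>i. i \<in> I \<Longrightarrow> f i \<in> \<A>"
  shows "(\<lambda>z. \<Sum>i\<in>I. f i z) \<in> \<A>"
  using assms
proof (induction I rule: infinite_finite_induct)
  case (insert i I)
  then show ?case using add[of "f i" "\<lambda>z. \<Sum>i\<in>I. f i z"] by simp
qed (simp_all add: const)

lemma pow: "f \<in> \<A> \<Longrightarrow> (\<lambda>z. f z ^ n) \<in> \<A>"
  by (induction n) (simp_all add: const mult)

text \<open>The bound below 1 has to be uniform on the disc: it bounds all partial sums by
  \<open>1 / (1 - \<rho>)\<close>, as \<open>lim\<close> requires.\<close>

lemma geometric:
  assumes f: "f \<in> \<A>" and \<rho>: "\<And>z. z \<in> unit_disc \<Longrightarrow> cmod (f z) \<le> \<rho>" "\<rho> < 1"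
  shows "(\<lambda>z. 1 / (1 - f z)) \<in> \<A>"
proof (rule lim[where F = "\<lambda>n z. \<Sum>i<n. f z ^ i" and C = "1 / (1 - \<rho>)"])
  show "(\<lambda>z. \<Sum>i<n. f z ^ i) \<in> \<A>" for n by (intro sum pow f)
  fix z :: complex assume z: "z \<in> unit_disc"
  have lt: "cmod (f z) < 1" using \<rho>(1)[OF z] \<rho>(2) by linarith
  show "(\<lambda>n. \<Sum>i<n. f z ^ i) \<longlonglongrightarrow> 1 / (1 - f z)"
    using geometric_sums[OF lt] by (simp add: sums_def)
  fix n :: nat
  have \<rho>0: "0 \<le> \<rho>" using order_trans[OF norm_ge_zero \<rho>(1)[OF z]] .
  have "cmod (\<Sum>i<n. f z ^ i) \<le> (\<Sum>i<n. \<rho> ^ i)"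
    using \<rho>(1)[OF z] by (intro sum_norm_le) (simp add: norm_power power_mono)
  also have "\<dots> = (1 - \<rho> ^ n) / (1 - \<rho>)" using \<rho>(2) by (simp add: sum_gp_strict)
  also have "\<dots> \<le> 1 / (1 - \<rho>)" using \<rho>(2) \<rho>0 by (intro divide_right_mono) auto
  finally show "cmod (\<Sum>i<n. f z ^ i) \<le> 1 / (1 - \<rho>)" .
qed

text \<open>Neumann series about the old pole: \<open>1 / (k - c')\<close> is
  \<open>1 / (k - c)\<close> divided by \<open>1 - (c' - c) / (k - c)\<close>, and half the distance
  to the image makes the ratio at most 1/2.\<close>

lemma resolvent_step:
  assumes r: "(\<lambda>z. 1 / (k z - c)) \<in> \<A>" and d: "d > 0" "\<And>z. z \<in> unit_disc \<Longrightarrow> d \<le> cmod (k z - c)"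
    and c': "cmod (c' - c) \<le> d / 2"
  shows "(\<lambda>z. 1 / (k z - c')) \<in> \<A>"
proof -
  have "(\<lambda>z. 1 / (1 - (c' - c) * (1 / (k z - c)))) \<in> \<A>"
  proof (rule geometric[OF cmult[OF r], of _ "1/2"])
    fix z :: complex assume z: "z \<in> unit_disc"
    have "cmod ((c' - c) * (1 / (k z - c))) = cmod (c' - c) / cmod (k z - c)"
      by (simp add: norm_mult norm_divide)
    also have "\<dots> \<le> (d / 2) / d" using d(1) d(2)[OF z] c' by (intro frac_le) auto
    finally show "cmod ((c' - c) * (1 / (k z - c))) \<le> 1/2" using d(1) by simp
  qed simp
  from mult[OF r this] show ?thesis
  proof (rule cong)
    fix z :: complex assume z: "z \<in> unit_disc"
    have "k z \<noteq> c" using d(1) d(2)[OF z] by auto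
    then show "1 / (k z - c) * (1 / (1 - (c' - c) * (1 / (k z - c)))) = 1 / (k z - c')"
      by (simp add: divide_simps)
  qed
qed

lemma resolvent:
  assumes k: "k \<in> \<A>" and conn: "connected (- closure (k ` unit_disc))" and c: "c \<notin> closure (k ` unit_disc)"
  shows "(\<lambda>z. 1 / (k z - c)) \<in> \<A>"
proof -
  define K where "K = closure (k ` unit_disc)"
  obtain C where C: "\<And>z. z \<in> unit_disc \<Longrightarrow> cmod (k z) \<le> C" using bdd[OF k] by blast
  have C0: "0 \<le> C" using order_trans[OF norm_ge_zero C[of 0]] by simp
  \<comment> \<open>A starting pole so far away that \<open>k / a\<close> is at most 1/2 in modulus
    and the geometric series in \<open>k\<close> itself converges.\<close>
  define a :: complex where "a = of_real (2 * C + 1)"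
  have na: "cmod a = 2 * C + 1" using C0 by (simp only: a_def norm_of_real)
  have "k ` unit_disc \<subseteq> cball 0 C" using C by auto
  then have KC: "K \<subseteq> cball 0 C" unfolding K_def by (rule closure_minimal) simp
  then have aK: "a \<in> - K" using na C0 by auto
  show ?thesis
  proof (rule connected_induction_simple[of "- K" a c "\<lambda>c. (\<lambda>z. 1 / (k z - c)) \<in> \<A>"])
    show "connected (- K)" "c \<in> - K" using conn c by (simp_all add: K_def)
    show "a \<in> - K" by (rule aK)
    have "(\<lambda>z. 1 / (1 - (1 / a) * k z)) \<in> \<A>"
    proof (rule geometric[OF cmult[OF k], of _ "1/2"])
      fix z :: complex assume z: "z \<in> unit_disc"
      have "cmod ((1 / a) * k z) = cmod (k z) / (2 * C + 1)" by (simp add: norm_mult norm_divide na)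
      also have "\<dots> \<le> 1/2" using C[OF z] C0 by (simp add: divide_simps)
      finally show "cmod ((1 / a) * k z) \<le> 1/2" .
    qed simp
    from cmult[OF this, of "- 1 / a"] show "(\<lambda>z. 1 / (k z - a)) \<in> \<A>"
    proof (rule cong)
      fix z :: complex assume z: "z \<in> unit_disc"
      have "a \<noteq> 0" using na C0 by auto
      moreover have "k z \<noteq> a" using C[OF z] na C0 by auto
      ultimately show "- 1 / a * (1 / (1 - (1 / a) * k z)) = 1 / (k z - a)"
        by (simp add: divide_simps)
    qed
  next
    fix b assume b: "b \<in> - K"
    have "open (- K)" unfolding K_def by (simp add: open_Compl)
    then obtain e where e: "e > 0" "ball b e \<subseteq> - K" using b openE by blast
    \<comment> \<open>Two points of this ball are less than \<open>e / 4\<close> apart and both keep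
      distance at least \<open>e / 2\<close> from the image of \<open>k\<close>, as
      \<open>resolvent_step\<close> wants for a displacement of half the distance.\<close>
    let ?T = "ball b (e / 8)"
    show "\<exists>T. openin (top_of_set (- K)) T \<and> b \<in> T \<and>
       (\<forall>x\<in>T. \<forall>y\<in>T. (\<lambda>z. 1 / (k z - x)) \<in> \<A> \<longrightarrow> (\<lambda>z. 1 / (k z - y)) \<in> \<A>)"
    proof (intro exI[of _ ?T] conjI ballI impI)
      have "?T \<subseteq> ball b e" using e(1) by (intro subset_ball) simp
      then show "openin (top_of_set (- K)) ?T" using e(2) by (intro openin_open_subtopology[THEN iffD2] | simp add: openin_open_eq \<open>open (- K)\<close>)+
      show "b \<in> ?T" using e(1) by simp
      fix x y assume x: "x \<in> ?T" and y: "y \<in> ?T" and r: "(\<lambda>z. 1 / (k z - x)) \<in> \<A>"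
      show "(\<lambda>z. 1 / (k z - y)) \<in> \<A>"
      proof (rule resolvent_step[OF r, of "e / 2"])
        show "e / 2 > 0" using e by simp
        have "dist y x < e / 4" using x y dist_triangle2[of y x b] by (simp add: dist_commute)
        then show "cmod (y - x) \<le> e / 2 / 2" by (simp add: dist_norm)
        fix z :: complex assume z: "z \<in> unit_disc"
        have "k z \<in> K" using z closure_subset[of "k ` unit_disc"] by (auto simp: K_def)
        then have "e \<le> dist b (k z)" using e(2) by (auto simp: not_less[symmetric] subset_iff)
        then show "e / 2 \<le> cmod (k z - x)"
          using x e(1) dist_triangle[of b "k z" x] by (simp add: dist_norm norm_minus_commute)
      qed
    qed
  qed
qed

end

text \<open>The algebra is closed under limits of sequences, so integrals enter it through explicit
  finite sums; the number of pieces is \<open>Suc n\<close> to exclude the empty partition.\<close>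

lemma riemann_sum_tendsto:
  fixes \<phi> :: "real \<Rightarrow> complex"
  assumes c: "continuous_on {0..1} \<phi>"
  shows "(\<lambda>n. \<Sum>i<Suc n. \<phi> (real i / real (Suc n)) / of_nat (Suc n)) \<longlonglongrightarrow> integral {0..1} \<phi>"
proof (rule LIMSEQ_I)
  fix e :: real assume e: "0 < e"
  have "uniformly_continuous_on {0..1} \<phi>" by (intro compact_uniformly_continuous c) simp
  then have "\<exists>d>0. \<forall>x\<in>{0..1}. \<forall>y\<in>{0..1}. dist y x < d \<longrightarrow> dist (\<phi> y) (\<phi> x) < e / 2"
    unfolding uniformly_continuous_on_def using e by (elim allE[of _ "e / 2"]) simp
  then obtain d where d: "d > 0" "\<And>x y. x \<in> {0..1} \<Longrightarrow> y \<in> {0..1} \<Longrightarrow> dist y x < d \<Longrightarrow> dist (\<phi> y) (\<phi> x) < e / 2"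
    by blast
  obtain N where N: "1 / real (Suc N) < d" using d(1) nat_approx_posE by blast
  show "\<exists>no. \<forall>n\<ge>no. norm ((\<Sum>i<Suc n. \<phi> (real i / real (Suc n)) / of_nat (Suc n)) - integral {0..1} \<phi>) < e"
  proof (intro exI[of _ N] allI impI)
    fix n assume n: "N \<le> n"
    define M where "M = real (Suc n)"
    have M: "M > 0" by (simp add: M_def)
    have Md: "1 / M < d"
      using N n by (intro le_less_trans[OF _ N]) (auto simp: M_def intro!: divide_left_mono)
    have ic: "\<phi> integrable_on {a..b}" if "0 \<le> a" "b \<le> 1" for a b
      using that by (intro integrable_continuous_interval continuous_on_subset[OF c]) auto
    have sub: "0 \<le> real i / M" "real i / M \<le> real (Suc i) / M" for i
      using M by (auto intro!: divide_right_mono)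
    have sub1: "real i / M \<le> 1" if "i \<le> Suc n" for i
      using that M by (simp add: M_def)
    have split: "integral {0..real m / M} \<phi> = (\<Sum>i<m. integral {real i / M..real (Suc i) / M} \<phi>)" if "m \<le> Suc n" for m
      using that
    proof (induction m)
      case (Suc m)
      have "integral {0..real m / M} \<phi> + integral {real m / M..real (Suc m) / M} \<phi> = integral {0..real (Suc m) / M} \<phi>"
        using sub[of m] sub1[OF Suc.prems] by (intro Henstock_Kurzweil_Integration.integral_combine ic) auto
      then show ?case using Suc by simp
    qed simp
    have one: "real (Suc n) / M = 1" by (simp add: M_def)
    have piece: "norm (\<phi> (real i / M) / of_real M - integral {real i / M..real (Suc i) / M} \<phi>) \<le> e / 2 / M"
      if "i < Suc n" for i
    proof -
      let ?a = "real i / M" and ?b = "real (Suc i) / M"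
      have ab: "?a \<le> ?b" "0 \<le> ?a" "?b \<le> 1" "?b - ?a = 1 / M"
        using sub[of i] sub1[of "Suc i"] that by (auto simp: diff_divide_distrib[symmetric])
      have "integral {?a..?b} (\<lambda>x. \<phi> ?a - \<phi> x) = integral {?a..?b} (\<lambda>x. \<phi> ?a) - integral {?a..?b} \<phi>"
        using ab by (intro integral_diff ic) auto
      also have "integral {?a..?b} (\<lambda>x. \<phi> ?a) = \<phi> ?a / of_real M"
        using ab by (simp add: scaleR_conv_of_real)
      finally have eq: "\<phi> ?a / of_real M - integral {?a..?b} \<phi> = integral {?a..?b} (\<lambda>x. \<phi> ?a - \<phi> x)" by simp
      have "norm (integral {?a..?b} (\<lambda>x. \<phi> ?a - \<phi> x)) \<le> e / 2 * (?b - ?a)"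
      proof (rule integral_bound)
        show "continuous_on {?a..?b} (\<lambda>x. \<phi> ?a - \<phi> x)"
          using ab by (intro continuous_intros continuous_on_subset[OF c]) auto
        fix x assume x: "x \<in> {?a..?b}"
        then have "dist ?a x < d" using Md ab by (auto simp: dist_real_def)
        then have "dist (\<phi> ?a) (\<phi> x) < e / 2" using x ab by (intro d(2)) auto
        then show "norm (\<phi> ?a - \<phi> x) \<le> e / 2" by (simp add: dist_norm)
      qed (rule ab)
      then show ?thesis unfolding eq ab(4) by simp
    qed
    have "norm ((\<Sum>i<Suc n. \<phi> (real i / M) / of_real M) - integral {0..1} \<phi>)
        = norm (\<Sum>i<Suc n. \<phi> (real i / M) / of_real M - integral {real i / M..real (Suc i) / M} \<phi>)"
      using split[of "Suc n"] unfolding one by (simp only: sum_subtractf order_refl)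
    also have "\<dots> \<le> (\<Sum>i<Suc n. e / 2 / M)"
      by (intro sum_norm_le piece) simp
    also have "\<dots> = e / 2"
      using M unfolding sum_constant card_lessThan M_def by (simp del: of_nat_Suc)
    also have "\<dots> < e" using e by simp
    finally show "norm ((\<Sum>i<Suc n. \<phi> (real i / real (Suc n)) / of_nat (Suc n)) - integral {0..1} \<phi>) < e"
      by (simp only: M_def of_real_of_nat_eq)
  qed
qed

text \<open>The Riemann sums of the integral are linear combinations of resolvents with poles on the
  segment. The positive distance from the segment to the closure of the image bounds them
  uniformly.\<close>

lemma (in disc_algebra) segment_integral:
  assumes k: "k \<in> \<A>" and conn: "connected (- closure (k ` unit_disc))"
    and disj: "closed_segment a b \<inter> closure (k ` unit_disc) = {}" and g: "continuous_on (closed_segment a b) g"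
  shows "(\<lambda>z. contour_integral (linepath a b) (\<lambda>\<zeta>. g \<zeta> / (\<zeta> - k z))) \<in> \<A>"
proof -
  define K where "K = closure (k ` unit_disc)"
  have "compact (g ` closed_segment a b)" by (intro compact_continuous_image g compact_segment)
  then obtain B where B: "\<And>\<zeta>. \<zeta> \<in> closed_segment a b \<Longrightarrow> cmod (g \<zeta>) \<le> B"
    using compact_imp_bounded[of "g ` closed_segment a b"] unfolding bounded_iff by blast
  have B0: "0 \<le> B" using order_trans[OF norm_ge_zero B[of a]] by simp
  obtain d where d: "d > 0" "\<And>\<zeta> y. \<zeta> \<in> closed_segment a b \<Longrightarrow> y \<in> K \<Longrightarrow> d \<le> dist \<zeta> y"
    using separate_compact_closed[of "closed_segment a b" K] disj by (auto simp: K_def)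
  have kK: "k z \<in> K" if "z \<in> unit_disc" for z
    using that closure_subset[of "k ` unit_disc"] by (auto simp: K_def)
  define \<phi> where "\<phi> = (\<lambda>z t. g (linepath a b t) / (linepath a b t - k z) * (b - a))"
  have seg: "linepath a b t \<in> closed_segment a b" if "t \<in> {0..1}" for t
    using that by (metis path_image_linepath imageI path_image_def)
  have in01: "real i / real (Suc n) \<in> {0..1}" if "i < Suc n" for i n using that by simp
  show ?thesis
  proof (rule lim[where F = "\<lambda>n z. \<Sum>i<Suc n. \<phi> z (real i / real (Suc n)) / of_nat (Suc n)" and C = "B / d * cmod (b - a)"])
    fix n :: nat
    show "(\<lambda>z. \<Sum>i<Suc n. \<phi> z (real i / real (Suc n)) / of_nat (Suc n)) \<in> \<A>"
    proof (rule sum)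
      fix i assume i: "i \<in> {..<Suc n}"
      define c where "c = linepath a b (real i / real (Suc n))"
      have "c \<in> closed_segment a b" unfolding c_def using i by (intro seg in01) simp
      then have "c \<notin> closure (k ` unit_disc)" using disj by blast
      from cmult[OF resolvent[OF k conn this], of "- g c * (b - a) / of_nat (Suc n)"]
      show "(\<lambda>z. \<phi> z (real i / real (Suc n)) / of_nat (Suc n)) \<in> \<A>"
      proof (rule cong)
        fix z :: complex assume "z \<in> unit_disc"
        have "1 / (k z - c) = - (1 / (c - k z))" by (metis minus_diff_eq minus_divide_right)
        then show "- g c * (b - a) / of_nat (Suc n) * (1 / (k z - c)) = \<phi> z (real i / real (Suc n)) / of_nat (Suc n)"
          unfolding \<phi>_def c_def[symmetric] by simp
      qed
    qed
    fix z :: complex assume z: "z \<in> unit_disc"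
    have nz: "linepath a b t - k z \<noteq> 0" "d \<le> cmod (linepath a b t - k z)" if "t \<in> {0..1}" for t
      using d(2)[OF seg[OF that] kK[OF z]] d(1) by (auto simp: dist_norm)
    have bd: "cmod (\<phi> z t) \<le> B / d * cmod (b - a)" if "t \<in> {0..1}" for t
      unfolding \<phi>_def norm_mult norm_divide using B[OF seg[OF that]] nz[OF that] d(1) B0
      by (intro mult_right_mono frac_le) auto
    have "cmod (\<Sum>i<Suc n. \<phi> z (real i / real (Suc n)) / of_nat (Suc n)) \<le> (\<Sum>i<Suc n. B / d * cmod (b - a) / real (Suc n))"
    proof (rule sum_norm_le)
      fix i assume "i \<in> {..<Suc n}"
      then have "cmod (\<phi> z (real i / real (Suc n))) \<le> B / d * cmod (b - a)" by (intro bd in01) simp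
      then show "cmod (\<phi> z (real i / real (Suc n)) / of_nat (Suc n)) \<le> B / d * cmod (b - a) / real (Suc n)"
        unfolding norm_divide norm_of_nat by (rule divide_right_mono) simp
    qed
    also have "\<dots> = B / d * cmod (b - a)" by (simp only: sum_constant card_lessThan) simp
    finally show "cmod (\<Sum>i<Suc n. \<phi> z (real i / real (Suc n)) / of_nat (Suc n)) \<le> B / d * cmod (b - a)" .
  next
    fix z :: complex assume z: "z \<in> unit_disc"
    have nz: "linepath a b t - k z \<noteq> 0" if "t \<in> {0..1}" for t
      using d(2)[OF seg[OF that] kK[OF z]] d(1) by auto
    have cont: "continuous_on {0..1} (\<phi> z)"
      unfolding \<phi>_def using nz seg
      by (intro continuous_intros continuous_on_compose2[OF g] continuous_on_linepath) auto
    have "((\<lambda>\<zeta>. g \<zeta> / (\<zeta> - k z)) has_contour_integral integral {0..1} (\<phi> z)) (linepath a b)"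
      unfolding has_contour_integral_linepath
      using integrable_integral[OF integrable_continuous_interval[OF cont]] by (simp add: \<phi>_def)
    then have "contour_integral (linepath a b) (\<lambda>\<zeta>. g \<zeta> / (\<zeta> - k z)) = integral {0..1} (\<phi> z)"
      by (rule contour_integral_unique)
    then show "(\<lambda>n. \<Sum>i<Suc n. \<phi> z (real i / real (Suc n)) / of_nat (Suc n))
        \<longlonglongrightarrow> contour_integral (linepath a b) (\<lambda>\<zeta>. g \<zeta> / (\<zeta> - k z))"
      using riemann_sum_tendsto[OF cont] by simp
  qed
qed

section \<open>Cauchy's formula on unions of grid squares and Runge's theorem\<close>

definition grid_point :: "real \<Rightarrow> int \<Rightarrow> int \<Rightarrow> complex" where
  "grid_point s i j = Complex (s * of_int i) (s * of_int j)"

definition grid_square :: "real \<Rightarrow> int \<Rightarrow> int \<Rightarrow> complex set" where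
  "grid_square s i j = cbox (grid_point s i j) (grid_point s (i + 1) (j + 1))"

lemma mem_grid_square:
  "z \<in> grid_square s i j \<longleftrightarrow> s * of_int i \<le> Re z \<and> Re z \<le> s * of_int (i + 1) \<and>
     s * of_int j \<le> Im z \<and> Im z \<le> s * of_int (j + 1)"
  by (auto simp: grid_square_def grid_point_def in_cbox_complex_iff)

lemma segment_subset_grid_square:
  "a \<in> grid_square s i j \<Longrightarrow> b \<in> grid_square s i j \<Longrightarrow> closed_segment a b \<subseteq> grid_square s i j"
  by (intro closed_segment_subset) (auto simp: grid_square_def convex_box)

lemma horizontal_edge_subset:
  assumes "s > 0"
  shows "closed_segment (grid_point s i j) (grid_point s (i + 1) j) \<subseteq> grid_square s i j"
    and "closed_segment (grid_point s i j) (grid_point s (i + 1) j) \<subseteq> grid_square s i (j - 1)"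
  by (intro segment_subset_grid_square; use assms in \<open>simp add: mem_grid_square grid_point_def\<close>)+

lemma vertical_edge_subset:
  assumes "s > 0"
  shows "closed_segment (grid_point s i j) (grid_point s i (j + 1)) \<subseteq> grid_square s i j"
    and "closed_segment (grid_point s i j) (grid_point s i (j + 1)) \<subseteq> grid_square s (i - 1) j"
  by (intro segment_subset_grid_square; use assms in \<open>simp add: mem_grid_square grid_point_def\<close>)+

definition horizontal_integral :: "real \<Rightarrow> (complex \<Rightarrow> complex) \<Rightarrow> complex \<Rightarrow> int \<times> int \<Rightarrow> complex" where
  "horizontal_integral s F w = (\<lambda>(i, j). contour_integral (linepath (grid_point s i j) (grid_point s (i + 1) j)) (\<lambda>\<zeta>. F \<zeta> / (\<zeta> - w)))"

definition vertical_integral :: "real \<Rightarrow> (complex \<Rightarrow> complex) \<Rightarrow> complex \<Rightarrow> int \<times> int \<Rightarrow> complex" where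
  "vertical_integral s F w = (\<lambda>(i, j). contour_integral (linepath (grid_point s i j) (grid_point s i (j + 1))) (\<lambda>\<zeta>. F \<zeta> / (\<zeta> - w)))"

text \<open>Keeps w away from every edge, so that no edge integral has a singularity on its path and
  w is interior to exactly one square.\<close>

definition off_grid :: "real \<Rightarrow> complex \<Rightarrow> bool" where
  "off_grid s w \<longleftrightarrow> (\<forall>i::int. Re w \<noteq> s * of_int i) \<and> (\<forall>j::int. Im w \<noteq> s * of_int j)"

lemma off_grid_square:
  assumes s: "s > 0" and w: "off_grid s w"
  shows "w \<in> box (grid_point s i j) (grid_point s (i + 1) (j + 1)) \<longleftrightarrow> w \<in> grid_square s i j"
    and "w \<in> grid_square s i j \<longleftrightarrow> (i, j) = (\<lfloor>Re w / s\<rfloor>, \<lfloor>Im w / s\<rfloor>)"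
proof -
  have ne: "Re w \<noteq> s * of_int i" "Re w \<noteq> s * of_int (i + 1)" "Im w \<noteq> s * of_int j" "Im w \<noteq> s * of_int (j + 1)"
    using w unfolding off_grid_def by blast+
  have *: "w \<in> grid_square s i j \<longleftrightarrow> s * of_int i < Re w \<and> Re w < s * of_int (i + 1) \<and>
     s * of_int j < Im w \<and> Im w < s * of_int (j + 1)"
    unfolding mem_grid_square using ne by (auto simp: less_le)
  then show "w \<in> box (grid_point s i j) (grid_point s (i + 1) (j + 1)) \<longleftrightarrow> w \<in> grid_square s i j"
    by (auto simp: in_box_complex_iff grid_point_def)
  have fl: "s * of_int m < x \<and> x < s * of_int (m + 1) \<longleftrightarrow> m = \<lfloor>x / s\<rfloor>"
    if "x \<noteq> s * of_int m" for x m
  proof -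
    have "x / s \<noteq> of_int m" using that s by (simp add: field_simps)
    then have "m = \<lfloor>x / s\<rfloor> \<longleftrightarrow> of_int m < x / s \<and> x / s < of_int m + 1"
      by (auto simp: floor_eq_iff eq_commute[of m])
    then show ?thesis using s by (simp add: pos_less_divide_eq pos_divide_less_eq mult.commute)
  qed
  show "w \<in> grid_square s i j \<longleftrightarrow> (i, j) = (\<lfloor>Re w / s\<rfloor>, \<lfloor>Im w / s\<rfloor>)"
    unfolding * using fl[OF ne(1)] fl[OF ne(3)] by auto
qed

text \<open>Edges are indexed by their lower or left end points and always run right or up. In a
  counterclockwise boundary the top and left edges are traversed backwards, hence the two minus
  signs.\<close>

lemma grid_square_contour:
  assumes s: "s > 0" and w: "off_grid s w" and F: "F holomorphic_on grid_square s i j"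
  shows "horizontal_integral s F w (i, j) + vertical_integral s F w (i + 1, j)
       - horizontal_integral s F w (i, j + 1) - vertical_integral s F w (i, j)
       = (if w \<in> grid_square s i j then 2 * pi * \<i> * F w else 0)"
proof -
  let ?a = "grid_point s i j" and ?b = "grid_point s (i + 1) j"
  let ?c = "grid_point s (i + 1) (j + 1)" and ?d = "grid_point s i (j + 1)"
  let ?Q = "grid_square s i j" and ?f = "\<lambda>\<zeta>. F \<zeta> / (\<zeta> - w)"
  have cF: "continuous_on ?Q F" by (rule holomorphic_on_imp_continuous_on[OF F])
  have sub: "closed_segment ?a ?b \<subseteq> ?Q" "closed_segment ?b ?c \<subseteq> ?Q" "closed_segment ?d ?c \<subseteq> ?Q" "closed_segment ?a ?d \<subseteq> ?Q"
    using horizontal_edge_subset[OF s, of i j] horizontal_edge_subset[OF s, of i "j + 1"]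
      vertical_edge_subset[OF s, of i j] vertical_edge_subset[OF s, of "i + 1" j] by auto
  have off: "w \<notin> closed_segment ?a ?b" "w \<notin> closed_segment ?b ?c" "w \<notin> closed_segment ?d ?c" "w \<notin> closed_segment ?a ?d"
  proof -
    have "Im x = s * of_int j" if x: "x \<in> closed_segment (grid_point s i j) (grid_point s (i + 1) j)" for x i j
    proof -
      obtain u where "x = (1 - u) *\<^sub>R grid_point s i j + u *\<^sub>R grid_point s (i + 1) j"
        using x unfolding closed_segment_def by blast
      then have "Im x = (1 - u) * (s * of_int j) + u * (s * of_int j)" by (simp add: grid_point_def)
      then show ?thesis by (simp add: left_diff_distrib)
    qed
    moreover have "Re x = s * of_int i" if x: "x \<in> closed_segment (grid_point s i j) (grid_point s i (j + 1))" for x i j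
    proof -
      obtain u where "x = (1 - u) *\<^sub>R grid_point s i j + u *\<^sub>R grid_point s i (j + 1)"
        using x unfolding closed_segment_def by blast
      then have "Re x = (1 - u) * (s * of_int i) + u * (s * of_int i)" by (simp add: grid_point_def)
      then show ?thesis by (simp add: left_diff_distrib)
    qed
    ultimately show "w \<notin> closed_segment ?a ?b" "w \<notin> closed_segment ?b ?c" "w \<notin> closed_segment ?d ?c" "w \<notin> closed_segment ?a ?d"
      using w unfolding off_grid_def by blast+
  qed
  have c: "continuous_on (closed_segment x y) ?f" if "closed_segment x y \<subseteq> ?Q" "w \<notin> closed_segment x y" for x y
    using that by (intro continuous_intros continuous_on_subset[OF cF]) auto
  note cont = c[OF sub(1) off(1)] c[OF sub(2) off(2)] c[OF sub(3) off(3)] c[OF sub(4) off(4)]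
  have ci: "?f contour_integrable_on linepath ?a ?b" "?f contour_integrable_on linepath ?b ?c"
    "?f contour_integrable_on linepath ?c ?d" "?f contour_integrable_on linepath ?d ?a"
    using cont by (auto intro!: contour_integrable_continuous_linepath simp: closed_segment_commute)
  have rp: "rectpath ?a ?c = linepath ?a ?b +++ linepath ?b ?c +++ linepath ?c ?d +++ linepath ?d ?a"
    by (simp add: rectpath_def Let_def grid_point_def)
  have "contour_integral (rectpath ?a ?c) ?f = contour_integral (linepath ?a ?b) ?f
     + (contour_integral (linepath ?b ?c) ?f + (contour_integral (linepath ?c ?d) ?f + contour_integral (linepath ?d ?a) ?f))"
    unfolding rp using ci by (simp add: valid_path_join)
  moreover have "contour_integral (linepath ?c ?d) ?f = - contour_integral (linepath ?d ?c) ?f"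
    using contour_integral_reverse_linepath[OF cont(3)] by simp
  moreover have "contour_integral (linepath ?d ?a) ?f = - contour_integral (linepath ?a ?d) ?f"
    using contour_integral_reverse_linepath[OF cont(4)] by simp
  ultimately have lhs: "horizontal_integral s F w (i, j) + vertical_integral s F w (i + 1, j)
       - horizontal_integral s F w (i, j + 1) - vertical_integral s F w (i, j) = contour_integral (rectpath ?a ?c) ?f"
    by (simp add: horizontal_integral_def vertical_integral_def)
  have ab: "Re ?a \<le> Re ?c" "Im ?a \<le> Im ?c" using s by (auto simp: grid_point_def)
  have pi_eq: "path_image (rectpath ?a ?c) = ?Q - box ?a ?c"
    using path_image_rectpath_cbox_minus_box[OF ab] by (simp add: grid_square_def)
  show ?thesis
  proof (cases "w \<in> ?Q")
    case True
    then have wb: "w \<in> box ?a ?c" using off_grid_square(1)[OF s w] by simp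
    have "(?f has_contour_integral (2*pi * \<i> * winding_number (rectpath ?a ?c) w * F w)) (rectpath ?a ?c)"
    proof (rule Cauchy_integral_formula_convex_simple[OF _ F])
      show "convex ?Q" unfolding grid_square_def by (rule convex_box)
      show "w \<in> interior ?Q" unfolding grid_square_def interior_cbox by (rule wb)
      show "path_image (rectpath ?a ?c) \<subseteq> ?Q - {w}" unfolding pi_eq using wb by auto
    qed simp_all
    then show ?thesis
      unfolding lhs using winding_number_rectpath[OF wb] True by (simp add: contour_integral_unique)
  next
    case False
    have "(?f has_contour_integral 0) (rectpath ?a ?c)"
    proof (rule Cauchy_theorem_convex_simple[where S = ?Q])
      show "?f holomorphic_on ?Q" using False by (intro holomorphic_intros F) auto
      show "convex ?Q" unfolding grid_square_def by (rule convex_box)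
      show "path_image (rectpath ?a ?c) \<subseteq> ?Q" unfolding pi_eq by auto
    qed simp_all
    then show ?thesis unfolding lhs using False by (simp add: contour_integral_unique)
  qed
qed

lemma sum_diff_cancel_common:
  fixes f :: "'a \<Rightarrow> 'b::ab_group_add"
  assumes "finite A" "finite B"
  shows "sum f A - sum f B = sum f (A - B) - sum f (B - A)"
proof -
  have "sum f A = sum f (A - B) + sum f (A \<inter> B)" "sum f B = sum f (B - A) + sum f (A \<inter> B)"
    using assms by (subst sum.union_disjoint[symmetric]; auto intro!: sum.cong)+
  then show ?thesis by simp
qed

text \<open>Edges shared by two squares of \<open>S\<close> cancel, so only edges bordering a square outside \<open>S\<close> remain.\<close>
lemma grid_cauchy_formula:
  assumes s: "s > 0" and w: "off_grid s w" and S: "finite S" "(\<lfloor>Re w / s\<rfloor>, \<lfloor>Im w / s\<rfloor>) \<in> S"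
    and F: "\<And>i j. (i, j) \<in> S \<Longrightarrow> F holomorphic_on grid_square s i j"
  defines "H \<equiv> (\<lambda>(i, j). (i, j + 1)) ` S" and "V \<equiv> (\<lambda>(i, j). (i + 1, j)) ` S"
  shows "2 * pi * \<i> * F w =
     (\<Sum>e\<in>S - H. horizontal_integral s F w e) - (\<Sum>e\<in>H - S. horizontal_integral s F w e) +
     ((\<Sum>e\<in>V - S. vertical_integral s F w e) - (\<Sum>e\<in>S - V. vertical_integral s F w e))"
proof -
  let ?h = "horizontal_integral s F w" and ?v = "vertical_integral s F w"
  have "2 * pi * \<i> * F w = (\<Sum>e\<in>S. if e = (\<lfloor>Re w / s\<rfloor>, \<lfloor>Im w / s\<rfloor>) then 2 * pi * \<i> * F w else 0)"
    using S by simp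
  also have "\<dots> = (\<Sum>(i, j)\<in>S. ?h (i, j) + ?v (i + 1, j) - ?h (i, j + 1) - ?v (i, j))"
  proof (rule sum.cong[OF refl])
    fix e assume e: "e \<in> S"
    obtain i j where ij: "e = (i, j)" by (cases e)
    show "(if e = (\<lfloor>Re w / s\<rfloor>, \<lfloor>Im w / s\<rfloor>) then 2 * pi * \<i> * F w else 0) =
      (case e of (i, j) \<Rightarrow> ?h (i, j) + ?v (i + 1, j) - ?h (i, j + 1) - ?v (i, j))"
      using grid_square_contour[OF s w F, of i j] e off_grid_square(2)[OF s w, of i j] unfolding ij by simp
  qed
  also have "\<dots> = (sum ?h S - (\<Sum>(i, j)\<in>S. ?h (i, j + 1))) + ((\<Sum>(i, j)\<in>S. ?v (i + 1, j)) - sum ?v S)"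
    by (simp add: split_def sum.distrib sum_subtractf)
  also have "(\<Sum>(i, j)\<in>S. ?h (i, j + 1)) = sum ?h H"
    unfolding H_def by (subst sum.reindex) (auto simp: inj_on_def split_def)
  also have "(\<Sum>(i, j)\<in>S. ?v (i + 1, j)) = sum ?v V"
    unfolding V_def by (subst sum.reindex) (auto simp: inj_on_def split_def)
  also have "sum ?h S - sum ?h H = sum ?h (S - H) - sum ?h (H - S)"
    using S by (intro sum_diff_cancel_common) (auto simp: H_def)
  also have "sum ?v V - sum ?v S = sum ?v (V - S) - sum ?v (S - V)"
    using S by (intro sum_diff_cancel_common) (auto simp: V_def)
  finally show ?thesis .
qed

text \<open>Only countably many diagonal shifts of \<open>w0\<close> hit a grid line, so one among
  the small ones misses all of them.\<close>

lemma off_grid_dense: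
  assumes s: "s > 0" and V: "open V" "w0 \<in> V"
  obtains w where "w \<in> V" "off_grid s w"
proof -
  obtain e where e: "e > 0" "ball w0 e \<subseteq> V" using V openE by blast
  let ?X = "range (\<lambda>i::int. s * of_int i - Re w0) \<union> range (\<lambda>j::int. s * of_int j - Im w0)"
  have "countable ?X" by simp
  moreover have "uncountable {0<..<e / 2}" using e(1) by (simp add: uncountable_open_interval)
  ultimately have "\<not> {0<..<e / 2} \<subseteq> ?X" using countable_subset by blast
  then obtain x where "x \<in> {0<..<e / 2}" and xX: "x \<notin> ?X" by blast
  then have x: "0 < x" "x < e / 2" by simp_all
  define w where "w = w0 + Complex x x"
  have "cmod (Complex x x) \<le> \<bar>x\<bar> + \<bar>x\<bar>" using cmod_le[of "Complex x x"] by simp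
  then have "dist w0 w < e" using x by (simp add: w_def dist_norm)
  then have "w \<in> V" using e(2) by auto
  moreover have "off_grid s w"
    unfolding off_grid_def
  proof (intro conjI allI notI)
    fix i :: int assume "Re w = s * of_int i"
    then have "x = s * of_int i - Re w0" by (simp add: w_def)
    then show False using xX by blast
  next
    fix j :: int assume "Im w = s * of_int j"
    then have "x = s * of_int j - Im w0" by (simp add: w_def)
    then show False using xX by blast
  qed
  ultimately show ?thesis by (rule that)
qed

text \<open>Cauchy's formula over the squares meeting the closure of the image expresses F as a sum
  of edge integrals that lie in the algebra. Injectivity makes \<open>k\<close> an open map, so that
  points with \<open>k z\<close> off the grid are dense in the disc.\<close>

lemma (in disc_algebra) runge:
  assumes k: "k \<in> \<A>" and inj: "inj_on k unit_disc" and conn: "connected (- closure (k ` unit_disc))"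
    and U: "open U" "closure (k ` unit_disc) \<subseteq> U" and F: "F holomorphic_on U"
  shows "(\<lambda>z. F (k z)) \<in> \<A>"
proof -
  define K where "K = closure (k ` unit_disc)"
  obtain C where C: "\<And>z. z \<in> unit_disc \<Longrightarrow> cmod (k z) \<le> C" using bdd[OF k] by blast
  have "K \<subseteq> cball 0 C" unfolding K_def using C by (intro closure_minimal) auto
  then have KC: "cmod x \<le> C" if "x \<in> K" for x using that by auto
  then have "compact K" unfolding K_def compact_closure bounded_iff using closure_subset by blast
  moreover have "K \<subseteq> U" using U by (simp add: K_def)
  ultimately obtain d where d: "d > 0" "(\<Union>x\<in>K. ball x d) \<subseteq> U"
    using compact_subset_open_imp_ball_epsilon_subset[OF _ U(1)] by blast
  have kK: "k z \<in> K" if "z \<in> unit_disc" for z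
    using that closure_subset[of "k ` unit_disc"] by (auto simp: K_def)
  \<comment> \<open>Points of one square differ by at most \<open>2 * s = d / 2\<close>, so every
    square meeting \<open>K\<close> lies in \<open>U\<close>.\<close>
  define s where "s = d / 4"
  have s: "s > 0" using d by (simp add: s_def)
  define S where "S = {(i, j). grid_square s i j \<inter> K \<noteq> {}}"
  have SU: "grid_square s i j \<subseteq> U" if ij: "(i, j) \<in> S" for i j
  proof
    fix x assume x: "x \<in> grid_square s i j"
    obtain y where y: "y \<in> grid_square s i j" "y \<in> K" using ij by (auto simp: S_def)
    have "\<bar>Re (y - x)\<bar> \<le> s" "\<bar>Im (y - x)\<bar> \<le> s"
      using x y(1) by (auto simp: mem_grid_square abs_le_iff algebra_simps)
    then have "cmod (y - x) < d" using cmod_le[of "y - x"] d(1) by (simp add: s_def)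
    then have "x \<in> ball y d" by (simp add: dist_norm)
    then show "x \<in> U" using d(2) y(2) by blast
  qed
  have "finite S"
  proof -
    define m where "m = \<lceil>C / s\<rceil> + 1"
    have b: "\<bar>n\<bar> \<le> m" if "s * of_int n \<le> x" "x \<le> s * of_int (n + 1)" "\<bar>x\<bar> \<le> C" for n x
    proof -
      have "s * of_int n \<le> C" "- C \<le> s * of_int (n + 1)" using that by auto
      then have "of_int n \<le> C / s" "- (C / s) \<le> of_int (n + 1)" using s by (simp_all add: field_simps)
      then show ?thesis unfolding m_def by linarith
    qed
    have "S \<subseteq> {-m..m} \<times> {-m..m}"
    proof (rule subsetI)
      fix e assume "e \<in> S"
      then obtain i j y where e: "e = (i, j)" "y \<in> grid_square s i j" "y \<in> K" by (auto simp: S_def)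
      have "\<bar>Re y\<bar> \<le> C" "\<bar>Im y\<bar> \<le> C"
        using KC[OF e(3)] abs_Re_le_cmod[of y] abs_Im_le_cmod[of y] by linarith+
      then have "\<bar>i\<bar> \<le> m" "\<bar>j\<bar> \<le> m" using e(2) by (auto simp: mem_grid_square intro!: b)
      then show "e \<in> {-m..m} \<times> {-m..m}" by (auto simp: e abs_le_iff)
    qed
    then show ?thesis by (rule finite_subset) simp
  qed
  \<comment> \<open>\<open>H\<close> indexes the top edges and \<open>V\<close>, below, the right
    edges of squares in \<open>S\<close>. An edge in exactly one of \<open>S\<close> and
    \<open>H\<close>, or of \<open>S\<close> and \<open>V\<close>, also lies in a square outside
    \<open>S\<close> and therefore misses \<open>K\<close>.\<close>
  define H where "H = (\<lambda>(i, j). (i, j + 1)) ` S"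
  define V where "V = (\<lambda>(i, j). (i + 1, j)) ` S"
  have Himp: "(i, j - 1) \<in> S" if "(i, j) \<in> H" for i j using that by (auto simp: H_def)
  have Vimp: "(i - 1, j) \<in> S" if "(i, j) \<in> V" for i j using that by (auto simp: V_def)
  have Hmem: "(i, j) \<in> H" if "(i, j - 1) \<in> S" for i j using that unfolding H_def by force
  have Vmem: "(i, j) \<in> V" if "(i - 1, j) \<in> S" for i j using that unfolding V_def by force
  have seg: "(\<lambda>z. contour_integral (linepath a b) (\<lambda>\<zeta>. F \<zeta> / (\<zeta> - k z))) \<in> \<A>"
    if in1: "closed_segment a b \<subseteq> grid_square s i j" "(i, j) \<in> S"
      and in2: "closed_segment a b \<subseteq> grid_square s i' j'" "(i', j') \<notin> S" for a b i j i' j'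
  proof (rule segment_integral[OF k conn])
    show "closed_segment a b \<inter> closure (k ` unit_disc) = {}"
      using in2 by (auto simp: S_def K_def)
    show "continuous_on (closed_segment a b) F"
      using in1 SU[OF in1(2)] by (intro continuous_on_subset[OF holomorphic_on_imp_continuous_on[OF F]]) auto
  qed
  have h: "(\<lambda>z. horizontal_integral s F (k z) e) \<in> \<A>" if "e \<in> (S - H) \<union> (H - S)" for e
  proof -
    obtain i j where e: "e = (i, j)" by (cases e)
    note sub = horizontal_edge_subset[OF s, of i j]
    from that consider "(i, j) \<in> S" "(i, j - 1) \<notin> S" | "(i, j - 1) \<in> S" "(i, j) \<notin> S"
      using Himp[of i j] Hmem[of i j] unfolding e by blast
    then show ?thesis
      unfolding horizontal_integral_def e prod.case
    proof cases
      case 1 then show "(\<lambda>z. contour_integral (linepath (grid_point s i j) (grid_point s (i + 1) j)) (\<lambda>\<zeta>. F \<zeta> / (\<zeta> - k z))) \<in> \<A>"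
        by (intro seg[OF sub(1) _ sub(2)])
    next
      case 2 then show "(\<lambda>z. contour_integral (linepath (grid_point s i j) (grid_point s (i + 1) j)) (\<lambda>\<zeta>. F \<zeta> / (\<zeta> - k z))) \<in> \<A>"
        by (intro seg[OF sub(2) _ sub(1)])
    qed
  qed
  have v: "(\<lambda>z. vertical_integral s F (k z) e) \<in> \<A>" if "e \<in> (S - V) \<union> (V - S)" for e
  proof -
    obtain i j where e: "e = (i, j)" by (cases e)
    note sub = vertical_edge_subset[OF s, of i j]
    from that consider "(i, j) \<in> S" "(i - 1, j) \<notin> S" | "(i - 1, j) \<in> S" "(i, j) \<notin> S"
      using Vimp[of i j] Vmem[of i j] unfolding e by blast
    then show ?thesis
      unfolding vertical_integral_def e prod.case
    proof cases
      case 1 then show "(\<lambda>z. contour_integral (linepath (grid_point s i j) (grid_point s i (j + 1))) (\<lambda>\<zeta>. F \<zeta> / (\<zeta> - k z))) \<in> \<A>"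
        by (intro seg[OF sub(1) _ sub(2)])
    next
      case 2 then show "(\<lambda>z. contour_integral (linepath (grid_point s i j) (grid_point s i (j + 1))) (\<lambda>\<zeta>. F \<zeta> / (\<zeta> - k z))) \<in> \<A>"
        by (intro seg[OF sub(2) _ sub(1)])
    qed
  qed
  define \<Psi> where "\<Psi> = (\<lambda>z. 1 / (2 * pi * \<i>) *
     ((\<Sum>e\<in>S - H. horizontal_integral s F (k z) e) - (\<Sum>e\<in>H - S. horizontal_integral s F (k z) e) +
     ((\<Sum>e\<in>V - S. vertical_integral s F (k z) e) - (\<Sum>e\<in>S - V. vertical_integral s F (k z) e))))"
  have \<Psi>: "\<Psi> \<in> \<A>" unfolding \<Psi>_def by (intro cmult add diff sum h v) auto
  have eq: "\<Psi> z = F (k z)" if z: "z \<in> unit_disc" and off: "off_grid s (k z)" for z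
  proof -
    have "k z \<in> grid_square s \<lfloor>Re (k z) / s\<rfloor> \<lfloor>Im (k z) / s\<rfloor>"
      using off_grid_square(2)[OF s off] by simp
    then have inS: "(\<lfloor>Re (k z) / s\<rfloor>, \<lfloor>Im (k z) / s\<rfloor>) \<in> S" using kK[OF z] by (auto simp: S_def)
    have hol: "F holomorphic_on grid_square s i j" if "(i, j) \<in> S" for i j
      using holomorphic_on_subset[OF F SU[OF that]] .
    show ?thesis
      unfolding \<Psi>_def H_def V_def
      by (subst grid_cauchy_formula[OF s off \<open>finite S\<close> inS hol, symmetric]) simp_all
  qed
  have holFk: "(\<lambda>z. F (k z)) holomorphic_on unit_disc"
  proof -
    have "(F \<circ> k) holomorphic_on unit_disc"
      using kK \<open>K \<subseteq> U\<close> by (intro holomorphic_on_compose_gen[OF holo[OF k] F]) auto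
    then show ?thesis by (simp add: o_def)
  qed
  \<comment> \<open>If the two continuous functions differed at a point, they would differ on an
    open set, whose image under \<open>k\<close> is open and so contains an off-grid value.\<close>
  have "\<Psi> z = F (k z)" if z: "z \<in> unit_disc" for z
  proof (rule ccontr)
    assume ne: "\<Psi> z \<noteq> F (k z)"
    have "continuous_on unit_disc (\<lambda>z. \<Psi> z - F (k z))"
      by (intro continuous_intros holomorphic_on_imp_continuous_on holo \<Psi> holFk)
    then have "open (unit_disc \<inter> (\<lambda>z. \<Psi> z - F (k z)) -` (- {0}))"
      by (rule continuous_open_preimage) (simp_all add: open_Compl)
    moreover define N where "N = unit_disc \<inter> (\<lambda>z. \<Psi> z - F (k z)) -` (- {0})"
    ultimately have N: "open N" "N \<subseteq> unit_disc" "z \<in> N" using z ne by auto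
    have "open (k ` N)"
    proof (rule open_mapping_thm3)
      show "k holomorphic_on N" by (rule holomorphic_on_subset[OF holo[OF k] N(2)])
      show "inj_on k N" by (rule inj_on_subset[OF inj N(2)])
    qed (rule N)
    then obtain w where w: "w \<in> k ` N" "off_grid s w" using off_grid_dense[OF s, of "k ` N" "k z"] N(3) by blast
    then obtain y where "y \<in> N" "w = k y" by blast
    then show False using eq[of y] w(2) N(2) by (auto simp: N_def)
  qed
  then show ?thesis by (rule cong[OF \<Psi>])
qed

section \<open>Kernel convergence\<close>

text \<open>\<open>W n\<close> is the neighbourhood of \<open>K\<close> of radius
  \<open>1 / (n + 1)\<close> with its holes filled: the complement of the outer component
  \<open>Z n\<close>. It is simply connected because its complement is connected and unbounded.
  Connectedness of \<open>- K\<close> is what makes these sets shrink to \<open>K\<close>.\<close>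

lemma outer_exhaustion:
  fixes K :: "complex set"
  assumes K: "compact K" "connected K" "K \<noteq> {}" "connected (- K)"
  obtains W :: "nat \<Rightarrow> complex set" and R where
    "\<And>n. open (W n)" "\<And>n. simply_connected (W n)" "\<And>n. K \<subseteq> W n" "\<And>n. W n \<subseteq> ball 0 R"
    "\<And>c. c \<notin> K \<Longrightarrow> \<exists>e>0. \<forall>\<^sub>F n in sequentially. ball c e \<inter> W n = {}"
proof -
  obtain C where C: "\<And>x. x \<in> K \<Longrightarrow> cmod x \<le> C"
    using compact_imp_bounded[OF K(1)] unfolding bounded_iff by blast
  obtain y0 where y0: "y0 \<in> K" using K(3) by blast
  define R where "R = C + 2"
  have R: "R > 0" using C[OF y0] norm_ge_zero[of y0] unfolding R_def by linarith
  define a :: complex where "a = of_real R"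
  have na: "cmod a = R" using R by (simp add: a_def)
  define N where "N = (\<lambda>n::nat. \<Union>y\<in>K. ball y (1 / (real n + 1)))"
  define Z where "Z = (\<lambda>n. connected_component_set (- N n) a)"
  define W where "W = (\<lambda>n. - Z n)"
  have openN: "open (N n)" for n unfolding N_def by blast
  have KN: "K \<subseteq> N n" for n unfolding N_def by (intro subsetI UN_I[where A = K]) auto
  have farN: "- ball 0 R \<subseteq> - N n" for n
  proof (rule subsetI)
    fix x :: complex assume x: "x \<in> - ball 0 R"
    have "x \<notin> ball y (1 / (real n + 1))" if y: "y \<in> K" for y
    proof -
      have "1 / (real n + 1) \<le> 1" by simp
      moreover have "R - C \<le> dist y x" using x C[OF y] norm_triangle_ineq2[of x y] by (simp add: dist_norm norm_minus_commute)
      ultimately have "1 / (real n + 1) \<le> dist y x" unfolding R_def by linarith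
      then show ?thesis by simp
    qed
    then show "x \<in> - N n" by (simp add: N_def)
  qed
  have aN: "a \<in> - N n" for n using farN[of n] na by auto
  have far: "- ball 0 R \<subseteq> Z n" for n
    unfolding Z_def
  proof (rule connected_component_maximal)
    show "a \<in> - ball 0 R" using na by simp
    show "connected (- ball 0 R :: complex set)" by (rule connected_complement_bounded_convex) simp_all
  qed (rule farN)
  have connN: "connected (N n)" for n
  proof -
    let ?\<S> = "(\<lambda>y. K \<union> ball y (1 / (real n + 1))) ` K"
    have "N n = \<Union>?\<S>" using KN[of n] y0 by (auto simp: N_def)
    moreover have "connected (\<Union>?\<S>)"
    proof (rule connected_Union)
      show "connected S" if S: "S \<in> ?\<S>" for S
      proof -
        obtain y where y: "y \<in> K" "S = K \<union> ball y (1 / (real n + 1))" using S by blast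
        have "y \<in> K \<inter> ball y (1 / (real n + 1))" using y by simp
        then show ?thesis unfolding y(2) by (intro connected_Un K) auto
      qed
      show "\<Inter>?\<S> \<noteq> {}" using y0 by blast
    qed
    ultimately show ?thesis by simp
  qed
  have ZN: "Z n \<subseteq> - N n" for n unfolding Z_def by (rule connected_component_subset)
  have aZ: "a \<in> Z n" for n using far[of n] na by auto
  have connZ: "connected (Z n)" for n unfolding Z_def by (rule connected_connected_component)
  have WR: "W n \<subseteq> ball 0 R" for n using far[of n] by (auto simp: W_def)
  show ?thesis
  proof (rule that[of W R])
    fix n
    have "closed (Z n)" unfolding Z_def using openN by (intro closed_connected_component) (simp add: closed_Compl)
    then show opW: "open (W n)" unfolding W_def by (simp add: open_Compl)
    have "Z n \<in> components (- N n)" unfolding Z_def by (rule componentsI[OF aN])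
    then have connW: "connected (W n)" unfolding W_def by (rule component_complement_connected[OF connN])
    have "components (- W n) = {Z n}"
      using connZ aZ by (auto simp: W_def components_eq_sing_iff)
    moreover have "\<not> bounded (Z n)"
      using cobounded_imp_unbounded[of "Z n"] bounded_subset[OF bounded_ball WR[of n]] by (simp add: W_def)
    ultimately show "simply_connected (W n)"
      using connW by (simp add: simply_connected_eq_unbounded_complement_components[OF opW])
    show "K \<subseteq> W n" using KN[of n] ZN[of n] by (auto simp: W_def)
    show "W n \<subseteq> ball 0 R" by (rule WR)
  next
    fix c assume c: "c \<notin> K"
    have opK: "open (- K)" using K(1) by (simp add: open_Compl compact_imp_closed)
    then obtain e where e: "e > 0" "cball c e \<subseteq> - K" using c open_contains_cball_eq by blast
    have aK: "a \<in> - K" using C[of a] na by (auto simp: R_def)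
    have "path_connected (- K)" using connected_open_path_connected[OF opK K(4)] .
    then obtain g where g: "path g" "path_image g \<subseteq> - K" "pathstart g = c" "pathfinish g = a"
      using c aK unfolding path_connected_def by blast
    \<comment> \<open>A compact connected set joining a whole ball about c to the far point
      \<open>a\<close> outside \<open>K\<close>. Once the neighbourhood is thinner than its distance
      to \<open>K\<close>, it lies in the outer component.\<close>
    define L where "L = cball c e \<union> path_image g"
    have cg: "c \<in> path_image g" "a \<in> path_image g" using g pathstart_in_path_image pathfinish_in_path_image by metis+
    have L: "compact L" "connected L" "L \<inter> K = {}" "a \<in> L"
    proof -
      show "compact L" unfolding L_def by (intro compact_Un compact_cball compact_path_image g)
      have "c \<in> cball c e \<inter> path_image g" using cg e by simp
      then have "cball c e \<inter> path_image g \<noteq> {}" by blast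
      then show "connected L"
        unfolding L_def by (rule connected_Un[OF connected_cball connected_path_image[OF g(1)]])
      show "L \<inter> K = {}" using e g by (auto simp: L_def)
      show "a \<in> L" using cg by (simp add: L_def)
    qed
    obtain d where d: "d > 0" "\<And>x y. x \<in> L \<Longrightarrow> y \<in> K \<Longrightarrow> d \<le> dist x y"
      using separate_compact_closed[OF L(1) compact_imp_closed[OF K(1)] L(3)] by blast
    obtain m :: nat where m: "1 / real (Suc m) < d" using nat_approx_posE[OF d(1)] by blast
    have "ball c e \<inter> W n = {}" if n: "m \<le> n" for n
    proof -
      have "1 / (real n + 1) \<le> 1 / real (Suc m)" using n by (intro divide_left_mono) auto
      then have "L \<subseteq> - N n" using d(2) m by (force simp: N_def dist_commute)
      then have "L \<subseteq> Z n" unfolding Z_def by (intro connected_component_maximal L)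
      moreover have "ball c e \<subseteq> L" using ball_subset_cball[of c e] by (auto simp: L_def)
      ultimately show ?thesis by (auto simp: W_def)
    qed
    then show "\<exists>e>0. \<forall>\<^sub>F n in sequentially. ball c e \<inter> W n = {}"
      using e(1) eventually_sequentially by blast
  qed
qed

text \<open>The base point is sent to 0 so that the Schwarz lemma can be applied to the map
  precomposed with \<open>k\<close>.\<close>

lemma normalized_riemann_map:
  fixes W :: "complex set"
  assumes W: "open W" "simply_connected W" "W \<noteq> UNIV" "a \<in> W"
  obtains F H where "F holomorphic_on W" "H holomorphic_on unit_disc" "F a = 0"
    "\<And>w. w \<in> W \<Longrightarrow> F w \<in> unit_disc \<and> H (F w) = w" "\<And>z. z \<in> unit_disc \<Longrightarrow> H z \<in> W"
proof -
  obtain f g where fg: "f holomorphic_on W" "g holomorphic_on ball 0 1"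
    "\<And>z. z \<in> W \<Longrightarrow> f z \<in> ball 0 1 \<and> g (f z) = z" "\<And>z. z \<in> ball 0 1 \<Longrightarrow> g z \<in> W \<and> f (g z) = z"
    using Riemann_mapping_theorem[of W] W by blast
  have "f a \<in> ball 0 1" using fg(3) W by blast
  then obtain \<alpha> \<beta> where ab: "\<alpha> (f a) = 0" "\<alpha> holomorphic_on ball 0 1" "\<alpha> ` ball 0 1 \<subseteq> ball 0 1"
     "\<beta> holomorphic_on ball 0 1" "\<beta> ` ball 0 1 \<subseteq> ball 0 1"
     "\<And>z. z \<in> ball 0 1 \<Longrightarrow> \<alpha> (\<beta> z) = z" "\<And>z. z \<in> ball 0 1 \<Longrightarrow> \<beta> (\<alpha> z) = z"
    using ball_biholomorphism_exists[of "f a"] by metis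
  show ?thesis
  proof (rule that[of "\<alpha> \<circ> f" "g \<circ> \<beta>"])
    show "(\<alpha> \<circ> f) holomorphic_on W"
      by (rule holomorphic_on_compose_gen[OF fg(1) ab(2)]) (use fg(3) in blast)
    show "(g \<circ> \<beta>) holomorphic_on unit_disc"
      by (rule holomorphic_on_compose_gen[OF ab(4) fg(2)]) (use ab(5) in blast)
    show "(\<alpha> \<circ> f) w \<in> unit_disc \<and> (g \<circ> \<beta>) ((\<alpha> \<circ> f) w) = w" if "w \<in> W" for w
    proof -
      have "\<alpha> (f w) \<in> unit_disc" using fg(3)[OF that] ab(3) by blast
      then show ?thesis using fg(3)[OF that] ab(7)[of "f w"] by simp
    qed
    show "(g \<circ> \<beta>) z \<in> W" if "z \<in> unit_disc" for z
    proof -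
      have "\<beta> z \<in> unit_disc" using ab(5) that by blast
      then show ?thesis using fg(4) by simp
    qed
  qed (simp add: ab)
qed

lemma uniform_limit_diagonal:
  fixes F :: "nat \<Rightarrow> complex \<Rightarrow> complex"
  assumes F: "uniform_limit B F G sequentially" and t: "strict_mono t" and G: "continuous_on B G"
    and x: "\<And>n. x n \<in> B" "y \<in> B" "x \<longlonglongrightarrow> y"
  shows "(\<lambda>n. F (t n) (x n)) \<longlonglongrightarrow> G y"
proof (rule tendstoI)
  fix e :: real assume e: "0 < e"
  have "\<forall>\<^sub>F n in sequentially. \<forall>z\<in>B. dist (F (t n) z) (G z) < e / 2"
    using eventually_subseq[OF t uniform_limitD[OF F, of "e / 2"]] e by simp
  moreover have "(\<lambda>n. G (x n)) \<longlonglongrightarrow> G y"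
    by (rule continuous_on_tendsto_compose[OF G x(3,2)]) (simp add: x)
  then have "\<forall>\<^sub>F n in sequentially. dist (G (x n)) (G y) < e / 2"
    using e by (intro tendstoD) auto
  ultimately show "\<forall>\<^sub>F n in sequentially. dist (F (t n) (x n)) (G y) < e"
  proof eventually_elim
    case (elim n)
    then have "dist (F (t n) (x n)) (G (x n)) < e / 2" using x(1) by blast
    then show ?case using elim(2) dist_triangle[of "F (t n) (x n)" "G y" "G (x n)"] by simp
  qed
qed

context disc_algebra
begin

text \<open>Caratheodory kernel convergence: the Riemann maps \<open>F n\<close> of outer domains shrinking to the
  closure of \<open>k(\<D>)\<close> satisfy \<open>F n \<circ> k \<rightarrow> \<alpha> z\<close> along a subsequence.\<close>
lemma identity_mem:
  assumes k: "k \<in> \<A>" and inj: "inj_on k unit_disc" and conn: "connected (- closure (k ` unit_disc))"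
    and int: "interior (closure (k ` unit_disc)) = k ` unit_disc"
  shows "(\<lambda>z. z) \<in> \<A>"
proof -
  define K where "K = closure (k ` unit_disc)"
  have holk: "k holomorphic_on unit_disc" by (rule holo[OF k])
  have kK: "k z \<in> K" if "z \<in> unit_disc" for z
    using that closure_subset[of "k ` unit_disc"] by (auto simp: K_def)
  have bK: "compact K" unfolding K_def compact_closure bounded_iff using bdd[OF k] by blast
  have cK: "connected K"
    unfolding K_def by (intro connected_imp_connected_closure connected_continuous_image holomorphic_on_imp_continuous_on holk) simp
  have "K \<noteq> {}" using kK[of 0] by auto
  then obtain W :: "nat \<Rightarrow> complex set" and R where W:
    "\<And>n. open (W n)" "\<And>n. simply_connected (W n)" "\<And>n. K \<subseteq> W n" "\<And>n. W n \<subseteq> ball 0 R"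
    "\<And>c. c \<notin> K \<Longrightarrow> \<exists>e>0. \<forall>\<^sub>F n in sequentially. ball c e \<inter> W n = {}"
    using outer_exhaustion[OF bK cK] conn unfolding K_def by metis
  have "\<exists>F H. F holomorphic_on W n \<and> H holomorphic_on unit_disc \<and> F (k 0) = 0 \<and>
    (\<forall>w\<in>W n. F w \<in> unit_disc \<and> H (F w) = w) \<and> (\<forall>z\<in>unit_disc. H z \<in> W n)" for n
  proof -
    have "W n \<noteq> UNIV" using W(4)[of n] bounded_subset[OF bounded_ball] not_bounded_UNIV by metis
    moreover have "k 0 \<in> W n" using W(3)[of n] kK[of 0] by auto
    ultimately show ?thesis
      using normalized_riemann_map[OF W(1,2), of n "k 0"] by metis
  qed
  then obtain F H where FH: "\<And>n. F n holomorphic_on W n" "\<And>n. H n holomorphic_on unit_disc" "\<And>n. F n (k 0) = 0"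
    "\<And>n w. w \<in> W n \<Longrightarrow> F n w \<in> unit_disc \<and> H n (F n w) = w" "\<And>n z. z \<in> unit_disc \<Longrightarrow> H n z \<in> W n"
    by metis
  define q where "q = (\<lambda>n z. F n (k z))"
  have kW: "k z \<in> W n" if "z \<in> unit_disc" for z n using kK[OF that] W(3)[of n] by blast
  have q: "q n \<in> \<A>" for n
    unfolding q_def by (rule runge[OF k inj conn W(1) _ FH(1)]) (use W(3) in \<open>simp add: K_def\<close>)
  have q1: "cmod (q n z) < 1" if "z \<in> unit_disc" for n z
    using FH(4)[OF kW[OF that]] by (simp add: q_def)
  have qz: "cmod (q n z) \<le> cmod z" if "z \<in> unit_disc" for n z
    using Schwarz_Lemma(1)[OF holo[OF q], of n z] FH(3) q1 that by (simp add: q_def)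
  have Hq: "H n (q n z) = k z" if "z \<in> unit_disc" for n z
    using FH(4)[OF kW[OF that]] by (simp add: q_def)
  obtain G s where G: "G holomorphic_on unit_disc" "strict_mono (s :: nat \<Rightarrow> nat)"
    "\<And>x. x \<in> unit_disc \<Longrightarrow> (\<lambda>n. H (s n) x) \<longlonglongrightarrow> G x"
    "\<And>K. compact K \<Longrightarrow> K \<subseteq> unit_disc \<Longrightarrow> uniform_limit K (\<lambda>n. H (s n)) G sequentially"
  proof (rule montel_pointwise_bound[of unit_disc H "\<lambda>_. R"])
    show "cmod (H n z) \<le> R" if "z \<in> unit_disc" for n z
      using FH(5)[OF that, of n] W(4)[of n] by (auto simp: less_imp_le subset_iff)
  qed (use FH(2) in auto)
  obtain Q t where Q: "Q holomorphic_on unit_disc" "strict_mono (t :: nat \<Rightarrow> nat)"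
    "\<And>x. x \<in> unit_disc \<Longrightarrow> (\<lambda>n. q (s (t n)) x) \<longlonglongrightarrow> Q x"
  proof (rule montel_pointwise_bound[of unit_disc "\<lambda>n. q (s n)" "\<lambda>_. 1"])
    show "cmod (q (s n) z) \<le> 1" if "z \<in> unit_disc" for n z using q1[OF that, of "s n"] by simp
  qed (use holo[OF q] in auto)
  have Qz: "cmod (Q z) \<le> cmod z" if "z \<in> unit_disc" for z
    by (rule LIMSEQ_le_const2[OF tendsto_norm[OF Q(3)[OF that]]]) (use qz[OF that] in auto)
  \<comment> \<open>The limit of \<open>H n (q n z) = k z\<close>: the points \<open>q n z\<close>
    stay in a compact disc by the Schwarz lemma, where the maps \<open>H n\<close> converge
    uniformly along the subsequence.\<close>
  have GQ: "G (Q z) = k z" if z: "z \<in> unit_disc" for z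
  proof -
    have B: "compact (cball (0::complex) (cmod z))" "cball 0 (cmod z) \<subseteq> unit_disc" using z by auto
    have "(\<lambda>n. H (s (t n)) (q (s (t n)) z)) \<longlonglongrightarrow> G (Q z)"
    proof (rule uniform_limit_diagonal[OF G(4)[OF B] Q(2)])
      show "continuous_on (cball 0 (cmod z)) G"
        using B(2) by (intro holomorphic_on_imp_continuous_on holomorphic_on_subset[OF G(1)])
    qed (use Q(3)[OF z] qz[OF z] Qz[OF z] in auto)
    then show ?thesis using Hq[OF z] by (simp add: LIMSEQ_const_iff)
  qed
  \<comment> \<open>A value outside \<open>K\<close> would have a ball that eventually misses the
    sets \<open>W n\<close>, although these contain the approximating values.\<close>
  have GK: "G z \<in> K" if z: "z \<in> unit_disc" for z
  proof (rule ccontr)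
    assume "G z \<notin> K"
    then obtain e where e: "e > 0" "\<forall>\<^sub>F n in sequentially. ball (G z) e \<inter> W n = {}" using W(5) by blast
    have "\<forall>\<^sub>F n in sequentially. ball (G z) e \<inter> W (s n) = {}"
      using eventually_subseq[OF G(2) e(2)] .
    moreover have "\<forall>\<^sub>F n in sequentially. dist (H (s n) z) (G z) < e"
      using G(3)[OF z] e(1) by (rule tendstoD)
    ultimately have "\<forall>\<^sub>F n in sequentially. False"
    proof eventually_elim
      case (elim n)
      have "H (s n) z \<in> ball (G z) e \<inter> W (s n)"
        using elim(2) FH(5)[OF z, of "s n"] by (simp add: dist_commute)
      then show ?case using elim by blast
    qed
    then show False by simp
  qed
  have Qdisc: "Q z \<in> unit_disc" if "z \<in> unit_disc" for z using Qz[OF that] that by simp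
  have Gnc: "\<not> G constant_on unit_disc"
  proof
    assume "G constant_on unit_disc"
    then obtain c where c: "\<And>z. z \<in> unit_disc \<Longrightarrow> G z = c" by (auto simp: constant_on_def)
    have "k 0 = k (1/2)" using GQ[of 0] GQ[of "1/2"] c[OF Qdisc, of 0] c[OF Qdisc, of "1/2"] by simp
    then show False using inj_onD[OF inj, of 0 "1/2"] by simp
  qed
  \<comment> \<open>Openness places the image of G in the interior of \<open>K\<close>, which by
    regularity is the image of \<open>k\<close>; only so can \<open>k\<close> be inverted on values
    of G.\<close>
  have "open (G ` unit_disc)"
    by (rule open_mapping_thm[OF G(1) _ _ _ _ Gnc]) simp_all
  moreover have "G ` unit_disc \<subseteq> K" using GK by blast
  ultimately have "G ` unit_disc \<subseteq> interior K" by (simp add: interior_maximal)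
  then have Gk: "G z \<in> k ` unit_disc" if "z \<in> unit_disc" for z using that int by (auto simp: K_def)
  obtain g where g: "g holomorphic_on k ` unit_disc" "\<And>z. z \<in> unit_disc \<Longrightarrow> g (k z) = z"
    using holomorphic_has_inverse[OF holk open_ball inj] by metis
  define T where "T = g \<circ> G"
  have Td: "T z \<in> unit_disc" if z: "z \<in> unit_disc" for z
  proof -
    obtain x where "x \<in> unit_disc" "G z = k x" using Gk[OF z] by blast
    then show ?thesis using g(2) by (simp add: T_def)
  qed
  have holT: "T holomorphic_on unit_disc"
    unfolding T_def by (rule holomorphic_on_compose_gen[OF G(1) g(1)]) (use Gk in blast)
  have TQ: "T (Q z) = z" if "z \<in> unit_disc" for z using GQ[OF that] g(2)[OF that] by (simp add: T_def)
  have Q0: "Q 0 = 0" using Qz[of 0] by simp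
  have T0: "T 0 = 0" using TQ[of 0] Q0 by simp
  \<comment> \<open>Both Q and its left inverse T are self-maps of the disc fixing 0, so the two
    Schwarz inequalities meet and Q is a rotation.\<close>
  have "cmod (Q z) = cmod z" if "z \<in> unit_disc" for z
  proof (rule antisym[OF Qz[OF that]])
    have "cmod (T (Q z)) \<le> cmod (Q z)"
      using Schwarz_Lemma(1)[OF holT T0] Td Qdisc[OF that] by simp
    then show "cmod z \<le> cmod (Q z)" using TQ[OF that] by simp
  qed
  then have "cmod (Q (1/2)) = cmod (1/2)" by simp
  then have "\<exists>\<alpha>. (\<forall>z. cmod z < 1 \<longrightarrow> Q z = \<alpha> * z) \<and> cmod \<alpha> = 1"
    using Qdisc by (intro Schwarz_Lemma(3)[OF Q(1) Q0, of 0] disjI1 exI[of _ "1/2"]) auto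
  then obtain \<alpha> where \<alpha>: "\<And>z. z \<in> unit_disc \<Longrightarrow> Q z = \<alpha> * z" "cmod \<alpha> = 1" by auto
  have "Q \<in> \<A>"
    by (rule lim[of "\<lambda>n. q (s (t n))" 1, OF q _ Q(3)]) (use q1 in \<open>auto intro: less_imp_le\<close>)
  from cmult[OF this, of "1 / \<alpha>"] show ?thesis
    by (rule cong) (use \<alpha> in auto)
qed

text \<open>With the identity in the algebra, Runge's theorem is applied again with the identity in
  the place of \<open>k\<close>: dilates of f are holomorphic near the closed disc and converge
  boundedly to f.\<close>

theorem bounded_holomorphic_mem:
  assumes k: "k \<in> \<A>" "inj_on k unit_disc" "connected (- closure (k ` unit_disc))"
    "interior (closure (k ` unit_disc)) = k ` unit_disc"
    and f: "f holomorphic_on unit_disc" "\<And>z. z \<in> unit_disc \<Longrightarrow> cmod (f z) \<le> C"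
  shows "f \<in> \<A>"
proof -
  note id = identity_mem[OF k]
  define \<rho> where "\<rho> = (\<lambda>n::nat. 1 - 1 / (real n + 2))"
  have \<rho>: "0 < \<rho> n" "\<rho> n < 1" for n by (auto simp: \<rho>_def field_simps)
  have \<rho>1: "\<rho> \<longlonglongrightarrow> 1" unfolding \<rho>_def by real_asymp
  have in_disc: "of_real (\<rho> n) * z \<in> unit_disc" if "z \<in> unit_disc" for n z
  proof -
    have "\<rho> n * cmod z < 1 * 1" using \<rho>[of n] that by (intro mult_strict_mono) auto
    then show ?thesis using \<rho>[of n] by (simp add: norm_mult)
  qed
  show ?thesis
  proof (rule lim[where F = "\<lambda>n z. f (of_real (\<rho> n) * z)" and C = C])
    fix n
    have cl: "closure ((\<lambda>z. z) ` unit_disc) = cball 0 1" by simp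
    show "(\<lambda>z. f (of_real (\<rho> n) * z)) \<in> \<A>"
    proof (rule runge[OF id, where U = "ball 0 (1 / \<rho> n)" and F = "\<lambda>z. f (of_real (\<rho> n) * z)"])
      show "connected (- closure ((\<lambda>z. z) ` unit_disc))"
        unfolding cl by (rule connected_complement_bounded_convex) simp_all
      show "closure ((\<lambda>z. z) ` unit_disc) \<subseteq> ball 0 (1 / \<rho> n)"
        unfolding cl
      proof (rule subsetI)
        fix x :: complex assume "x \<in> cball 0 1"
        then have "cmod x * \<rho> n \<le> 1 * \<rho> n" using \<rho>[of n] by (intro mult_right_mono) auto
        then have "cmod x * \<rho> n < 1" using \<rho>[of n] by linarith
        then show "x \<in> ball 0 (1 / \<rho> n)" using \<rho>[of n] by (simp add: field_simps)
      qed
      have "(f \<circ> (\<lambda>z. of_real (\<rho> n) * z)) holomorphic_on ball 0 (1 / \<rho> n)"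
      proof (rule holomorphic_on_compose_gen[OF _ f(1) image_subsetI])
        show "of_real (\<rho> n) * z \<in> unit_disc" if "z \<in> ball 0 (1 / \<rho> n)" for z
          using that \<rho>[of n] by (simp add: norm_mult field_simps)
      qed (intro holomorphic_intros)
      then show "(\<lambda>z. f (of_real (\<rho> n) * z)) holomorphic_on ball 0 (1 / \<rho> n)" by (simp add: o_def)
    qed (auto simp: inj_on_def)
    show "cmod (f (of_real (\<rho> n) * z)) \<le> C" if "z \<in> unit_disc" for z
      by (rule f(2)[OF in_disc[OF that]])
  next
    fix z :: complex assume z: "z \<in> unit_disc"
    have "isCont f z"
      using holomorphic_on_imp_continuous_on[OF f(1)] z by (simp add: continuous_on_eq_continuous_at)
    moreover have "(\<lambda>n. complex_of_real (\<rho> n) * z) \<longlonglongrightarrow> of_real 1 * z"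
      by (intro tendsto_intros \<rho>1)
    ultimately show "(\<lambda>n. f (of_real (\<rho> n) * z)) \<longlonglongrightarrow> f z"
      by (intro isCont_tendsto_compose[of z f]) auto
  qed
qed

end

section \<open>Totality of the exponentials\<close>

definition on_disc :: "(complex \<Rightarrow> complex) \<Rightarrow> complex \<Rightarrow> complex" where
  "on_disc f = (\<lambda>z. if z \<in> unit_disc then f z else 0)"

text \<open>Inductive, so that limits of limits are included and vanishing of a functional passes to
  the closure by induction. Convergence is asked only on the disc; the last premise of
  \<open>lim\<close> fixes the limit outside it.\<close>

inductive_set bp_closure :: "(complex \<Rightarrow> complex) set \<Rightarrow> (complex \<Rightarrow> complex) set" for E where
  gen: "f \<in> E \<Longrightarrow> f \<in> bp_closure E"
| add: "f \<in> bp_closure E \<Longrightarrow> g \<in> bp_closure E \<Longrightarrow> (\<lambda>z. f z + g z) \<in> bp_closure E"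
| scale: "f \<in> bp_closure E \<Longrightarrow> (\<lambda>z. c * f z) \<in> bp_closure E"
| lim: "(\<And>n::nat. F n \<in> bp_closure E) \<Longrightarrow> (\<And>n z. z \<in> unit_disc \<Longrightarrow> cmod (F n z) \<le> C) \<Longrightarrow>
     (\<And>z. z \<in> unit_disc \<Longrightarrow> (\<lambda>n. F n z) \<longlonglongrightarrow> f z) \<Longrightarrow> f \<in> bounded_analytic \<Longrightarrow> f \<in> bp_closure E"

lemma bounded_analyticE:
  assumes "f \<in> bounded_analytic"
  obtains C where "f holomorphic_on unit_disc" "\<And>z. z \<notin> unit_disc \<Longrightarrow> f z = 0"
    "\<And>z. z \<in> unit_disc \<Longrightarrow> cmod (f z) \<le> C"
  using assms unfolding bounded_analytic_def by blast

lemma bounded_analytic_add: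
  assumes "f \<in> bounded_analytic" "g \<in> bounded_analytic"
  shows "(\<lambda>z. f z + g z) \<in> bounded_analytic"
proof -
  obtain C where f: "f holomorphic_on unit_disc" "\<And>z. z \<notin> unit_disc \<Longrightarrow> f z = 0"
    "\<And>z. z \<in> unit_disc \<Longrightarrow> cmod (f z) \<le> C" using bounded_analyticE[OF assms(1)] by blast
  obtain D where g: "g holomorphic_on unit_disc" "\<And>z. z \<notin> unit_disc \<Longrightarrow> g z = 0"
    "\<And>z. z \<in> unit_disc \<Longrightarrow> cmod (g z) \<le> D" using bounded_analyticE[OF assms(2)] by blast
  show ?thesis
  proof (rule bounded_analyticI[of _ "C + D"])
    show "cmod (f z + g z) \<le> C + D" if "z \<in> unit_disc" for z
      using f(3)[OF that] g(3)[OF that] norm_triangle_ineq[of "f z" "g z"] by linarith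
  qed (use f g in \<open>auto intro!: holomorphic_intros\<close>)
qed

lemma bounded_analytic_mult:
  assumes "f \<in> bounded_analytic" "g \<in> bounded_analytic"
  shows "(\<lambda>z. f z * g z) \<in> bounded_analytic"
proof -
  obtain C where f: "f holomorphic_on unit_disc" "\<And>z. z \<notin> unit_disc \<Longrightarrow> f z = 0"
    "\<And>z. z \<in> unit_disc \<Longrightarrow> cmod (f z) \<le> C" using bounded_analyticE[OF assms(1)] by blast
  obtain D where g: "g holomorphic_on unit_disc" "\<And>z. z \<notin> unit_disc \<Longrightarrow> g z = 0"
    "\<And>z. z \<in> unit_disc \<Longrightarrow> cmod (g z) \<le> D" using bounded_analyticE[OF assms(2)] by blast
  have C: "0 \<le> C" using order_trans[OF norm_ge_zero f(3)[of 0]] by simp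
  show ?thesis
  proof (rule bounded_analyticI[of _ "C * D"])
    show "cmod (f z * g z) \<le> C * D" if "z \<in> unit_disc" for z
      unfolding norm_mult using f(3)[OF that] g(3)[OF that] C by (intro mult_mono) auto
  qed (use f g in \<open>auto intro!: holomorphic_intros\<close>)
qed

lemma bounded_analytic_scale:
  assumes "f \<in> bounded_analytic"
  shows "(\<lambda>z. c * f z) \<in> bounded_analytic"
proof -
  obtain C where f: "f holomorphic_on unit_disc" "\<And>z. z \<notin> unit_disc \<Longrightarrow> f z = 0"
    "\<And>z. z \<in> unit_disc \<Longrightarrow> cmod (f z) \<le> C" using bounded_analyticE[OF assms] by blast
  show ?thesis
  proof (rule bounded_analyticI[of _ "cmod c * C"])
    show "cmod (c * f z) \<le> cmod c * C" if "z \<in> unit_disc" for z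
      unfolding norm_mult using f(3)[OF that] by (intro mult_left_mono) auto
  qed (use f in \<open>auto intro!: holomorphic_intros\<close>)
qed

lemma bp_closure_bounded:
  assumes "E \<subseteq> bounded_analytic" "f \<in> bp_closure E"
  shows "f \<in> bounded_analytic"
  using assms(2)
proof induction
  case (gen f)
  then show ?case using assms(1) by blast
qed (simp_all add: bounded_analytic_add bounded_analytic_scale)

text \<open>Induction on one factor at a time: first against a generator, then, after exchanging the
  factors, against an arbitrary member.\<close>

lemma bp_closure_mult:
  assumes E: "E \<subseteq> bounded_analytic" "\<And>e e'. e \<in> E \<Longrightarrow> e' \<in> E \<Longrightarrow> (\<lambda>z. e z * e' z) \<in> E"
    and f: "f \<in> bp_closure E" and g: "g \<in> bp_closure E"
  shows "(\<lambda>z. f z * g z) \<in> bp_closure E"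
proof -
  have step: "(\<lambda>z. f z * g z) \<in> bp_closure E"
    if g: "g \<in> bp_closure E" and gen: "\<And>e. e \<in> E \<Longrightarrow> (\<lambda>z. e z * g z) \<in> bp_closure E"
      and f: "f \<in> bp_closure E" for f g
    using f
  proof induction
    case (add f f')
    then show ?case using bp_closure.add[OF add.IH] by (simp add: distrib_right)
  next
    case (scale f c)
    then show ?case using bp_closure.scale[OF scale.IH, of c] by (simp add: mult.assoc)
  next
    case (lim F C f)
    obtain D where D: "\<And>z. z \<in> unit_disc \<Longrightarrow> cmod (g z) \<le> D"
      using bp_closure_bounded[OF E(1) g] unfolding bounded_analytic_def by blast
    have C: "0 \<le> C" using order_trans[OF norm_ge_zero lim.hyps(2)[of 0 0]] by simp
    show ?case
    proof (rule bp_closure.lim[of "\<lambda>n z. F n z * g z" E "C * D"])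
      show "(\<lambda>z. F n z * g z) \<in> bp_closure E" for n by (rule lim.IH)
      show "cmod (F n z * g z) \<le> C * D" if "z \<in> unit_disc" for n z
        unfolding norm_mult using lim.hyps(2)[OF that] D[OF that] C by (intro mult_mono) auto
      show "(\<lambda>n. F n z * g z) \<longlonglongrightarrow> f z * g z" if "z \<in> unit_disc" for z
        by (intro tendsto_mult lim.hyps(3)[OF that] tendsto_const)
      show "(\<lambda>z. f z * g z) \<in> bounded_analytic"
        by (rule bounded_analytic_mult[OF lim.hyps(4) bp_closure_bounded[OF E(1) g]])
    qed
  qed (rule gen)
  have "(\<lambda>z. e z * g z) \<in> bp_closure E" if e: "e \<in> E" for e
  proof -
    have "(\<lambda>z. g z * e z) \<in> bp_closure E"
    proof (rule step[OF bp_closure.gen[OF e] _ g])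
      show "(\<lambda>z. e' z * e z) \<in> bp_closure E" if "e' \<in> E" for e'
        by (rule bp_closure.gen[OF E(2)[OF that e]])
    qed
    then show ?thesis by (simp add: mult.commute)
  qed
  from step[OF g this f] show ?thesis .
qed

lemma bounded_functional_bp_closure:
  assumes l: "l \<in> bounded_functionals (hardy_space p) (hardy_norm p)" and p: "p > 0"
    and E: "E \<subseteq> bounded_analytic" "\<And>f. f \<in> E \<Longrightarrow> l f = 0" and f: "f \<in> bp_closure E"
  shows "l f = 0"
  using f
proof induction
  case (gen f)
  then show ?case by (rule E(2))
next
  case (add f g)
  have "f \<in> hardy_space p" "g \<in> hardy_space p"
    by (rule bounded_analytic_hardy[OF bp_closure_bounded[OF E(1)] p], rule add.hyps)+
  then show ?case using bounded_functionalD(1)[OF l] add.IH by simp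
next
  case (scale f c)
  have "f \<in> hardy_space p"
    by (rule bounded_analytic_hardy[OF bp_closure_bounded[OF E(1) scale.hyps] p])
  then show ?case using bounded_functionalD(2)[OF l] scale.IH by simp
next
  case (lim F C f)
  have "(\<lambda>n. l (F n)) \<longlonglongrightarrow> l f"
    by (rule bounded_functional_tendsto[OF l p bp_closure_bounded[OF E(1) lim.hyps(1)] lim.hyps(2) lim.hyps(4) lim.hyps(3)])
  then show ?case by (simp add: lim.IH LIMSEQ_const_iff)
qed

lemma on_disc_eq_self: "f \<in> bounded_analytic \<Longrightarrow> on_disc f = f"
  by (auto simp: on_disc_def bounded_analytic_def fun_eq_iff)

lemma on_disc_bounded_analytic:
  assumes "f holomorphic_on unit_disc" "\<And>z. z \<in> unit_disc \<Longrightarrow> cmod (f z) \<le> C"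
  shows "on_disc f \<in> bounded_analytic"
proof (rule bounded_analyticI)
  show "on_disc f holomorphic_on unit_disc"
    by (rule holomorphic_transform[OF assms(1)]) (simp add: on_disc_def)
qed (use assms(2) in \<open>auto simp: on_disc_def\<close>)

lemma disc_algebra_bp_closure:
  assumes E: "E \<subseteq> bounded_analytic" "\<And>e e'. e \<in> E \<Longrightarrow> e' \<in> E \<Longrightarrow> (\<lambda>z. e z * e' z) \<in> E" "on_disc (\<lambda>z. 1) \<in> E"
  shows "disc_algebra {f. on_disc f \<in> bp_closure E}"
proof
  fix f assume f: "f \<in> {f. on_disc f \<in> bp_closure E}"
  then have bf: "on_disc f \<in> bounded_analytic" using bp_closure_bounded[OF E(1)] by simp
  then obtain C where C: "on_disc f holomorphic_on unit_disc" "\<And>z. z \<in> unit_disc \<Longrightarrow> cmod (on_disc f z) \<le> C"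
    using bf unfolding bounded_analytic_def by blast
  show "f holomorphic_on unit_disc"
    by (rule holomorphic_transform[OF C(1)]) (simp add: on_disc_def)
  show "\<exists>C. \<forall>z\<in>unit_disc. cmod (f z) \<le> C"
  proof (intro exI[of _ C] ballI)
    show "cmod (f z) \<le> C" if "z \<in> unit_disc" for z
      using C(2)[OF that] that by (simp add: on_disc_def)
  qed
next
  fix f g assume f: "f \<in> {f. on_disc f \<in> bp_closure E}" and eq: "\<And>z. z \<in> unit_disc \<Longrightarrow> f z = g z"
  have "on_disc f = on_disc g" using eq by (auto simp: on_disc_def fun_eq_iff)
  then show "g \<in> {f. on_disc f \<in> bp_closure E}" using f by simp
next
  fix c
  have eq: "on_disc (\<lambda>z. c) = (\<lambda>z. c * on_disc (\<lambda>z. 1) z)" by (auto simp: on_disc_def)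
  show "(\<lambda>z. c) \<in> {f. on_disc f \<in> bp_closure E}"
    unfolding mem_Collect_eq by (subst eq) (rule bp_closure.scale[OF bp_closure.gen[OF E(3)]])
next
  fix f g assume "f \<in> {f. on_disc f \<in> bp_closure E}" "g \<in> {f. on_disc f \<in> bp_closure E}"
  then have fg: "on_disc f \<in> bp_closure E" "on_disc g \<in> bp_closure E" by simp_all
  have eq: "on_disc (\<lambda>z. f z + g z) = (\<lambda>z. on_disc f z + on_disc g z)"
    "on_disc (\<lambda>z. f z * g z) = (\<lambda>z. on_disc f z * on_disc g z)" by (auto simp: on_disc_def)
  show "(\<lambda>z. f z + g z) \<in> {f. on_disc f \<in> bp_closure E}"
    unfolding mem_Collect_eq eq(1) by (rule bp_closure.add[OF fg])
  show "(\<lambda>z. f z * g z) \<in> {f. on_disc f \<in> bp_closure E}"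
    unfolding mem_Collect_eq eq(2) by (rule bp_closure_mult[OF E(1,2) fg])
next
  fix F :: "nat \<Rightarrow> complex \<Rightarrow> complex" and C f
  assume F: "\<And>n. F n \<in> {f. on_disc f \<in> bp_closure E}" "\<And>n z. z \<in> unit_disc \<Longrightarrow> cmod (F n z) \<le> C"
    and lim: "\<And>z. z \<in> unit_disc \<Longrightarrow> (\<lambda>n. F n z) \<longlonglongrightarrow> f z"
  have hol: "on_disc (F n) holomorphic_on unit_disc" for n
    using bp_closure_bounded[OF E(1), of "on_disc (F n)"] F(1)[of n] by (simp add: bounded_analytic_def)
  have lim': "(\<lambda>n. on_disc (F n) z) \<longlonglongrightarrow> on_disc f z" if "z \<in> unit_disc" for z
    using lim[OF that] that by (simp add: on_disc_def)
  have bd: "cmod (on_disc (F n) z) \<le> C" if "z \<in> unit_disc" for n z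
    using F(2)[OF that] that by (simp add: on_disc_def)
  have "on_disc f holomorphic_on unit_disc"
    by (rule bounded_pointwise_limit_holomorphic[OF open_ball hol bd lim'])
  moreover have "on_disc f z = 0" if "z \<notin> unit_disc" for z using that by (simp add: on_disc_def)
  moreover have "cmod (on_disc f z) \<le> C" if "z \<in> unit_disc" for z
    by (rule LIMSEQ_le_const2[OF tendsto_norm[OF lim'[OF that]]]) (use bd[OF that] in blast)
  ultimately have "on_disc f \<in> bounded_analytic"
    by (rule bounded_analyticI)
  then have "on_disc f \<in> bp_closure E"
    using F(1) by (intro bp_closure.lim[of "\<lambda>n. on_disc (F n)" E C "on_disc f"] bd lim') simp_all
  then show "f \<in> {f. on_disc f \<in> bp_closure E}" by simp
qed

text \<open>The terms are reciprocals of difference quotients of \<open>1 - exp (- h * v)\<close> at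
  0, whose derivative there is v.\<close>

lemma exp_quotient_tendsto:
  fixes v :: complex
  assumes "v \<noteq> 0"
  shows "(\<lambda>n. of_real (1 / real (Suc n)) * (1 / (1 - exp (- of_real (1 / real (Suc n)) * v)))) \<longlonglongrightarrow> 1 / v"
proof -
  have "((\<lambda>h. exp (- h * v)) has_field_derivative - v) (at 0)"
    by (auto intro!: derivative_eq_intros)
  then have "(\<lambda>h. (exp (- (0 + h) * v) - exp (- 0 * v)) / h) \<midarrow>0\<rightarrow> - v"
    unfolding DERIV_def .
  moreover have "filterlim (\<lambda>n. complex_of_real (1 / real (Suc n))) (at 0) sequentially"
  proof (rule filterlim_atI)
    have "(\<lambda>n. 1 / real (Suc n)) \<longlonglongrightarrow> 0" by real_asymp
    from tendsto_of_real[OF this, where 'a = complex]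
    show "(\<lambda>n. complex_of_real (1 / real (Suc n))) \<longlonglongrightarrow> 0" unfolding of_real_0 .
  qed (simp del: of_nat_Suc)
  ultimately have "(\<lambda>n. (exp (- (0 + of_real (1 / real (Suc n))) * v) - exp (- 0 * v)) / of_real (1 / real (Suc n))) \<longlonglongrightarrow> - v"
    by (rule filterlim_compose)
  then have "(\<lambda>n. - 1 / ((exp (- (0 + of_real (1 / real (Suc n))) * v) - exp (- 0 * v)) / of_real (1 / real (Suc n)))) \<longlonglongrightarrow> - 1 / - v"
    using assms by (intro tendsto_divide tendsto_const) auto
  moreover have "- 1 / ((exp (- (0 + d) * v) - exp (- 0 * v)) / d) = d * (1 / (1 - exp (- d * v)))" for d :: complex
  proof -
    have "exp (- (0 + d) * v) - exp (- 0 * v) = - (1 - exp (- d * v))" by simp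
    then show ?thesis by (simp only: divide_divide_eq_right minus_divide_right[symmetric]) simp
  qed
  ultimately show ?thesis using assms by (simp only: minus_divide_divide)
qed

text \<open>The resolvent \<open>1 / (1 + u) = \<integral>\<^sub>0\<^sup>\<infinity> exp (-s (1 + u)) ds\<close> as a limit of geometric series.\<close>
lemma (in disc_algebra) resolvent_of_exponentials:
  assumes e: "\<And>s::real. 0 \<le> s \<Longrightarrow> (\<lambda>z. exp (- of_real s * u z)) \<in> \<A>" and u: "\<And>z. z \<in> unit_disc \<Longrightarrow> 0 < Re (u z)"
  shows "(\<lambda>z. 1 / (1 + u z)) \<in> \<A>"
proof (rule lim[where F = "\<lambda>n z. of_real (1 / real (Suc n)) * (1 / (1 - exp (- of_real (1 / real (Suc n)) * (1 + u z))))" and C = 2])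
  define \<delta> where "\<delta> = (\<lambda>n. 1 / real (Suc n))"
  have \<delta>: "0 < \<delta> n" "\<delta> n \<le> 1" for n by (auto simp: \<delta>_def)
  have \<delta>_eq: "1 / real (Suc n) = \<delta> n" for n by (simp only: \<delta>_def)
  \<comment> \<open>The summand 1 in \<open>1 + u\<close> provides the strict bound
    \<open>exp (- \<delta> n) < 1\<close>; the real part of u may come arbitrarily close to
    0.\<close>
  have small: "cmod (exp (- of_real (\<delta> n) * (1 + u z))) \<le> exp (- \<delta> n)" if "z \<in> unit_disc" for n z
  proof -
    have "0 \<le> \<delta> n * Re (u z)" using u[OF that] \<delta>[of n] by (intro mult_nonneg_nonneg) auto
    then show ?thesis by (simp add: algebra_simps)
  qed
  fix n
  have "(\<lambda>z. of_real (exp (- \<delta> n)) * exp (- of_real (\<delta> n) * u z)) \<in> \<A>"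
    using \<delta>[of n] by (intro cmult e) simp
  then have x: "(\<lambda>z. exp (- of_real (\<delta> n) * (1 + u z))) \<in> \<A>"
  proof (rule cong)
    fix z
    have "- of_real (\<delta> n) * (1 + u z) = of_real (- \<delta> n) + (- of_real (\<delta> n) * u z)"
      by (simp add: algebra_simps)
    then show "of_real (exp (- \<delta> n)) * exp (- of_real (\<delta> n) * u z) = exp (- of_real (\<delta> n) * (1 + u z))"
      by (simp only: exp_add exp_of_real)
  qed
  have lt: "exp (- \<delta> n) < 1" using \<delta>[of n] by simp
  show "(\<lambda>z. of_real (1 / real (Suc n)) * (1 / (1 - exp (- of_real (1 / real (Suc n)) * (1 + u z))))) \<in> \<A>"
    unfolding \<delta>_eq by (rule cmult[OF geometric[OF x small lt]])
  fix z :: complex assume z: "z \<in> unit_disc"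
  \<comment> \<open>Source of the uniform bound 2: for step sizes in the unit interval
    \<open>1 - exp (- \<delta> n)\<close> is at least \<open>\<delta> n / 2\<close>.\<close>
  have "1 + \<delta> n \<le> exp (\<delta> n)" by (rule exp_ge_add_one_self)
  then have "exp (- \<delta> n) \<le> 1 / (1 + \<delta> n)" using \<delta>[of n] by (simp add: exp_minus field_simps)
  also have "\<dots> \<le> 1 - \<delta> n / 2"
  proof -
    have "\<delta> n * \<delta> n \<le> \<delta> n * 1" using \<delta>[of n] by (intro mult_left_mono) auto
    then have "1 \<le> (1 - \<delta> n / 2) * (1 + \<delta> n)" by (simp add: algebra_simps)
    then show ?thesis using \<delta>[of n] by (simp add: pos_divide_le_eq)
  qed
  finally have "\<delta> n / 2 \<le> 1 - cmod (exp (- of_real (\<delta> n) * (1 + u z)))"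
    using small[OF z, of n] by linarith
  also have "\<dots> \<le> cmod (1 - exp (- of_real (\<delta> n) * (1 + u z)))"
    using norm_triangle_ineq2[of 1 "exp (- of_real (\<delta> n) * (1 + u z))"] by simp
  finally have "\<delta> n / 2 \<le> cmod (1 - exp (- of_real (\<delta> n) * (1 + u z)))" .
  moreover have "cmod (of_real (\<delta> n) * (1 / (1 - exp (- of_real (\<delta> n) * (1 + u z)))))
      = \<delta> n / cmod (1 - exp (- of_real (\<delta> n) * (1 + u z)))"
    using \<delta>[of n] by (simp add: norm_mult norm_divide)
  moreover have "d / x \<le> 2" if "0 < d" "d / 2 \<le> x" for d x :: real
    using that by (simp add: pos_divide_le_eq)
  ultimately have "cmod (of_real (\<delta> n) * (1 / (1 - exp (- of_real (\<delta> n) * (1 + u z))))) \<le> 2"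
    using \<delta>(1)[of n] by (simp only:)
  then show "cmod (of_real (1 / real (Suc n)) * (1 / (1 - exp (- of_real (1 / real (Suc n)) * (1 + u z))))) \<le> 2"
    by (simp only: \<delta>_eq)
next
  fix z :: complex assume z: "z \<in> unit_disc"
  have "1 + u z \<noteq> 0" using u[OF z] by (auto simp: complex_eq_iff)
  then show "(\<lambda>n. of_real (1 / real (Suc n)) * (1 / (1 - exp (- of_real (1 / real (Suc n)) * (1 + u z)))))
      \<longlonglongrightarrow> 1 / (1 + u z)" by (rule exp_quotient_tendsto)
qed

section \<open>Geometry of a shift-invariant region under inversion\<close>

lemma Re_one_divide: "Re (1 / w) = Re w / (cmod w)\<^sup>2"
  by (simp add: Re_divide cmod_power2)

lemma inverse_half_plane:
  fixes y :: complex
  assumes "y \<noteq> 0"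
  shows "cmod (y - 1/2) \<le> 1/2 \<longleftrightarrow> 1 \<le> Re (1 / y)"
proof -
  have pos: "0 < (cmod y)\<^sup>2" using assms by simp
  have "cmod (y - 1/2) \<le> 1/2 \<longleftrightarrow> (cmod (y - 1/2))\<^sup>2 \<le> (1/2)\<^sup>2"
    using abs_le_square_iff[of "cmod (y - 1/2)" "1/2"] by simp
  also have "(cmod (y - 1/2))\<^sup>2 = (cmod y)\<^sup>2 - Re y + (1/2)\<^sup>2"
    unfolding cmod_power2 by (simp add: power2_eq_square algebra_simps)
  also have "(cmod y)\<^sup>2 - Re y + (1/2)\<^sup>2 \<le> (1/2)\<^sup>2 \<longleftrightarrow> (cmod y)\<^sup>2 \<le> Re y" by linarith
  also have "\<dots> \<longleftrightarrow> 1 \<le> Re y / (cmod y)\<^sup>2" using pos by (simp add: field_simps)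
  also have "Re y / (cmod y)\<^sup>2 = Re (1 / y)"
    by (rule Re_one_divide[symmetric])
  finally show ?thesis .
qed

text \<open>Abstracts the image of the Koenigs domain under
  \<open>w \<mapsto> cnj a * w - b\<close>, which takes the given half-plane to the right half-plane
  and translation by t to translation by t times \<open>c\<close>.\<close>

locale right_half_plane_region =
  fixes V :: "complex set" and c :: complex
  assumes pos: "v \<in> V \<Longrightarrow> 0 < Re v"
    and shift: "v \<in> V \<Longrightarrow> 0 \<le> t \<Longrightarrow> v + of_real t * c \<in> V"
    and c: "0 < Re c" and ne: "V \<noteq> {}" and reg: "interior (closure V) = V"
begin

definition T :: "complex set" where
  "T = (\<lambda>v. 1 / (1 + v)) ` V"

lemma shift_closure:
  assumes "v \<in> closure V" "0 \<le> t"
  shows "v + of_real t * c \<in> closure V"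
proof -
  obtain x where x: "\<And>n. x n \<in> V" "x \<longlonglongrightarrow> v"
    using assms(1) unfolding closure_sequential by blast
  have "(\<lambda>n. x n + of_real t * c) \<longlonglongrightarrow> v + of_real t * c" by (intro tendsto_intros x)
  then show ?thesis
    unfolding closure_sequential using shift[OF x(1) assms(2)]
    by (intro exI[of _ "\<lambda>n. x n + of_real t * c"]) simp
qed

lemma closure_T_inverse:
  assumes "y \<in> closure T" "y \<noteq> 0"
  shows "1 / y - 1 \<in> closure V"
proof -
  obtain x where x: "\<And>n. x n \<in> T" "x \<longlonglongrightarrow> y"
    using assms(1) unfolding closure_sequential by blast
  have "1 / x n - 1 \<in> V" for n
  proof -
    obtain v where v: "v \<in> V" "x n = 1 / (1 + v)" using x(1)[of n] unfolding T_def by blast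
    then show ?thesis by simp
  qed
  moreover have "(\<lambda>n. 1 / x n - 1) \<longlonglongrightarrow> 1 / y - 1" by (intro tendsto_intros x assms)
  ultimately show ?thesis unfolding closure_sequential by (intro exI[of _ "\<lambda>n. 1 / x n - 1"]) simp
qed

lemma T_in_disc:
  assumes "y \<in> T"
  shows "0 < Re y" "cmod (y - 1/2) \<le> 1/2"
proof -
  obtain v where v: "v \<in> V" "y = 1 / (1 + v)" using assms unfolding T_def by blast
  have re: "1 < Re (1 + v)" using pos[OF v(1)] by simp
  have nz: "1 + v \<noteq> 0"
  proof
    assume "1 + v = 0"
    then have "Re (1 + v) = 0" by (simp only: zero_complex.sel)
    then show False using re by linarith
  qed
  have "0 < Re (1 + v)" using re by linarith
  moreover have "0 < (cmod (1 + v))\<^sup>2" using nz by simp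
  ultimately have "0 < Re (1 + v) / (cmod (1 + v))\<^sup>2" by (rule divide_pos_pos)
  then show "0 < Re y" unfolding v(2) Re_one_divide .
  have y0: "y \<noteq> 0" unfolding v(2) using nz by simp
  have "1 / y = 1 + v" unfolding v(2) by simp
  then have "1 \<le> Re (1 / y)" using re by (elim ssubst) (rule less_imp_le)
  then show "cmod (y - 1/2) \<le> 1/2" by (simp only: inverse_half_plane[OF y0])
qed

lemma closure_T_disc: "closure T \<subseteq> cball (1/2) (1/2)"
proof (rule closure_minimal)
  show "T \<subseteq> cball (1/2) (1/2)"
  proof
    fix y assume "y \<in> T"
    from T_in_disc(2)[OF this] show "y \<in> cball (1/2) (1/2)"
      unfolding mem_cball dist_norm by (subst norm_minus_commute)
  qed
qed simp

lemma closure_T_Re: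
  assumes "y \<in> closure T"
  shows "0 \<le> Re y"
proof -
  have "T \<subseteq> {y. 0 \<le> Re y}"
  proof
    fix x assume "x \<in> T"
    from T_in_disc(1)[OF this] show "x \<in> {y. 0 \<le> Re y}" by simp
  qed
  then have "closure T \<subseteq> {y. 0 \<le> Re y}"
    by (rule closure_minimal) (rule closed_halfspace_Re_ge)
  then show ?thesis using assms by blast
qed

text \<open>Shifting along \<open>c\<close> tends to infinity, whose image under the inversion is 0.
  Hence points outside the closure of \<open>T\<close> are nonzero and have a coordinate v.\<close>

lemma zero_in_closure_T: "0 \<in> closure T"
proof -
  obtain v where v: "v \<in> V" using ne by blast
  let ?x = "\<lambda>n::nat. 1 / (1 + (v + of_real (real n) * c))"
  have "?x n \<in> T" for n unfolding T_def by (rule imageI, rule shift[OF v]) simp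
  moreover have "?x \<longlonglongrightarrow> 0"
  proof -
    have c0: "c \<noteq> 0" using c by auto
    have eq: "cmod (of_real (real n) * c) - cmod (1 + v) = - cmod (1 + v) + cmod c * real n" for n
      by (simp add: norm_mult)
    have "filterlim (\<lambda>n. cmod c * real n) at_top sequentially"
      by (rule filterlim_tendsto_pos_mult_at_top[OF tendsto_const _ filterlim_real_sequentially])
         (use c0 in simp)
    then have lim: "filterlim (\<lambda>n. cmod (of_real (real n) * c) - cmod (1 + v)) at_top sequentially"
      unfolding eq by (rule filterlim_tendsto_add_at_top[OF tendsto_const])
    have le: "cmod (of_real (real n) * c) - cmod (1 + v) \<le> cmod (1 + (v + of_real (real n) * c))" for n
      using norm_triangle_ineq4[of "1 + (v + of_real (real n) * c)" "1 + v"] by simp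
    have "filterlim (\<lambda>n. cmod (1 + (v + of_real (real n) * c))) at_top sequentially"
      by (rule filterlim_at_top_mono[OF lim always_eventually[OF allI[OF le]]])
    then have "filterlim (\<lambda>n. 1 + (v + of_real (real n) * c)) at_infinity sequentially"
      by (rule filterlim_norm_at_top_imp_at_infinity)
    then show ?thesis by (rule tendsto_divide_0[OF tendsto_const])
  qed
  ultimately show ?thesis unfolding closure_sequential by (intro exI[of _ ?x] conjI allI)
qed

text \<open>Away from 0 the inversion carries regularity of \<open>V\<close> over to
  \<open>T\<close>; 0 itself is not interior because the closure of \<open>T\<close> lies in the
  closed right half-plane.\<close>

lemma interior_closure_T_subset: "interior (closure T) \<subseteq> T"
proof
  fix y assume y: "y \<in> interior (closure T)"
  have y0: "y \<noteq> 0"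
  proof
    assume "y = 0"
    then obtain e where e: "e > 0" "ball 0 e \<subseteq> closure T" using y unfolding mem_interior by blast
    have "of_real (- e / 2) \<in> ball (0::complex) e" using e(1) by simp
    then have "of_real (- e / 2) \<in> closure T" using e(2) by blast
    then have "0 \<le> Re (complex_of_real (- e / 2))" by (rule closure_T_Re)
    then show False using e(1) by simp
  qed
  define v where "v = 1 / y - 1"
  have v1: "1 + v = 1 / y" by (simp add: v_def)
  define D where "D = interior (closure T) - {0}"
  have D: "open D" "D \<subseteq> closure T" "0 \<notin> D" "y \<in> D"
    unfolding D_def using interior_subset[of "closure T"] y y0 by (auto simp: open_delete)
  define N where "N = (\<lambda>v. 1 / (1 + v)) -` D \<inter> (- {-1})"
  have "open N"
    unfolding N_def Int_commute[of _ "- {-1}"]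
  proof (rule continuous_open_preimage)
    show "continuous_on (- {-1}) (\<lambda>v::complex. 1 / (1 + v))"
      by (intro continuous_intros) (auto simp: add_eq_0_iff)
  qed (auto simp: D(1) open_Compl)
  moreover have "v \<in> N"
  proof -
    have "v \<noteq> -1" using v1 y0 by auto
    then show ?thesis unfolding N_def using D(4) v1 y0 by simp
  qed
  moreover have "N \<subseteq> closure V"
  proof
    fix x assume x: "x \<in> N"
    then have xD: "1 / (1 + x) \<in> D" unfolding N_def by simp
    then have "1 / (1 + x) \<noteq> 0" using D(3) by auto
    with subsetD[OF D(2) xD] have "1 / (1 / (1 + x)) - 1 \<in> closure V" by (rule closure_T_inverse)
    then show "x \<in> closure V" by simp
  qed
  ultimately have "v \<in> interior (closure V)" by (rule interiorI)
  then have "v \<in> V" using reg by simp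
  moreover have "y = 1 / (1 + v)" using v1 by simp
  ultimately show "y \<in> T" unfolding T_def by blast
qed

text \<open>In the coordinate \<open>v\<close>, a point outside the closure flows in direction \<open>-c\<close> out of the right
  half-plane, that is, out of the disc containing \<open>T\<close>.\<close>
lemma connected_complement_closure_T: "connected (- closure T)"
proof -
  define X :: "complex set" where "X = - cball (1/2) (1/2)"
  have X: "connected X" "X \<subseteq> - closure T" "X \<noteq> {}"
  proof -
    show "connected X" unfolding X_def by (rule connected_complement_bounded_convex) simp_all
    show "X \<subseteq> - closure T" unfolding X_def using closure_T_disc by blast
    have "-1 \<in> X" by (simp add: X_def dist_norm norm_divide)
    then show "X \<noteq> {}" by blast
  qed
  have ex: "\<exists>S. connected S \<and> S \<subseteq> - closure T \<and> y \<in> S \<and> S \<inter> X \<noteq> {}" if y: "y \<in> - closure T" for y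
  proof (cases "y \<in> X")
    case True
    then have "{y} \<inter> X \<noteq> {}" by blast
    then show ?thesis using y by (intro exI[of _ "{y}"] conjI) simp_all
  next
    case False
    have y0: "y \<noteq> 0" using y zero_in_closure_T by auto
    define v where "v = 1 / y - 1"
    have "cmod (y - 1/2) \<le> 1/2" using False by (simp add: X_def dist_norm norm_minus_commute)
    then have Rev: "0 \<le> Re v" unfolding inverse_half_plane[OF y0] by (simp add: v_def)
    have vc: "v \<notin> closure V"
    proof
      assume v: "v \<in> closure V"
      obtain x where x: "\<And>n. x n \<in> V" "x \<longlonglongrightarrow> v"
        using v unfolding closure_sequential by blast
      have v1: "1 + v = 1 / y" by (simp add: v_def)
      have "(\<lambda>n. 1 / (1 + x n)) \<longlonglongrightarrow> 1 / (1 + v)" using v1 y0 by (intro tendsto_intros x) simp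
      moreover have "1 / (1 + x n) \<in> T" for n unfolding T_def by (rule imageI, rule x(1))
      ultimately have "1 / (1 + v) \<in> closure T"
        unfolding closure_sequential by (intro exI[of _ "\<lambda>n. 1 / (1 + x n)"]) simp
      then show False using y v1 by simp
    qed
    \<comment> \<open>The time at which the real part of v has dropped to -1/2. Then
      \<open>1 + v\<close> still has real part 1/2, so no pole is met, but it is below 1, so the
      image has left the disc.\<close>
    define t1 where "t1 = (Re v + 1/2) / Re c"
    have t1: "0 \<le> t1" "Re v - t1 * Re c = - 1/2" using Rev c by (auto simp: t1_def)
    define \<gamma> where "\<gamma> = (\<lambda>t. 1 / (1 + (v - of_real t * c)))"
    have Reg: "1/2 \<le> Re (1 + (v - of_real t * c))" if "t \<in> {0..t1}" for t
    proof -
      have "t * Re c \<le> t1 * Re c" using that c by (intro mult_right_mono) auto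
      then show ?thesis using t1(2) by simp
    qed
    have nz: "1 + (v - of_real t * c) \<noteq> 0" if t: "t \<in> {0..t1}" for t
    proof
      assume "1 + (v - of_real t * c) = 0"
      then have "Re (1 + (v - of_real t * c)) = 0" by (simp only: zero_complex.sel)
      then show False using Reg[OF t] by linarith
    qed
    have "connected (\<gamma> ` {0..t1})"
      unfolding \<gamma>_def using nz by (intro connected_continuous_image continuous_intros connected_Icc) auto
    moreover have "\<gamma> ` {0..t1} \<subseteq> - closure T"
    proof (rule image_subsetI, rule ComplI)
      fix t assume t: "t \<in> {0..t1}" and "\<gamma> t \<in> closure T"
      moreover have "\<gamma> t \<noteq> 0" using nz[OF t] by (simp add: \<gamma>_def)
      ultimately have "1 / \<gamma> t - 1 \<in> closure V" by (intro closure_T_inverse)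
      then have "v - of_real t * c \<in> closure V" using nz[OF t] by (simp add: \<gamma>_def)
      then have "v - of_real t * c + of_real t * c \<in> closure V" using t by (intro shift_closure) auto
      then show False using vc by simp
    qed
    moreover have "y \<in> \<gamma> ` {0..t1}"
    proof (rule image_eqI[of _ _ 0])
      show "y = \<gamma> 0" using y0 by (simp add: \<gamma>_def v_def)
    qed (use t1 in simp)
    moreover have "\<gamma> ` {0..t1} \<inter> X \<noteq> {}"
    proof -
      have "\<gamma> t1 \<in> X"
      proof -
        have t: "t1 \<in> {0..t1}" using t1 by simp
        have g0: "\<gamma> t1 \<noteq> 0" using nz[OF t] by (simp add: \<gamma>_def)
        have "Re (1 / \<gamma> t1) = 1/2" using t1(2) by (simp add: \<gamma>_def)
        then have "\<not> cmod (\<gamma> t1 - 1/2) \<le> 1/2" unfolding inverse_half_plane[OF g0] by simp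
        then show ?thesis by (simp add: X_def dist_norm norm_minus_commute)
      qed
      moreover have "\<gamma> t1 \<in> \<gamma> ` {0..t1}" using t1(1) by simp
      ultimately show ?thesis by blast
    qed
    ultimately show ?thesis by (intro exI[of _ "\<gamma> ` {0..t1}"] conjI)
  qed
  \<comment> \<open>Adding \<open>X\<close> to each connecting set gives all members a common part,
    from which connectedness of the union follows.\<close>
  define \<S> where "\<S> = {X \<union> S |S. connected S \<and> S \<subseteq> - closure T \<and> S \<inter> X \<noteq> {}}"
  have "\<Union>\<S> = - closure T"
  proof (rule subset_antisym)
    show "\<Union>\<S> \<subseteq> - closure T" using X(2) unfolding \<S>_def by blast
    show "- closure T \<subseteq> \<Union>\<S>"
    proof
      fix y assume "y \<in> - closure T"
      from ex[OF this] obtain S where S: "connected S" "S \<subseteq> - closure T" "y \<in> S" "S \<inter> X \<noteq> {}" by blast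
      then have "X \<union> S \<in> \<S>" unfolding \<S>_def by blast
      then show "y \<in> \<Union>\<S>" using S(3) by blast
    qed
  qed
  moreover have "connected (\<Union>\<S>)"
  proof (rule connected_Union)
    show "connected A" if A: "A \<in> \<S>" for A
    proof -
      obtain S where S: "A = X \<union> S" "connected S" "S \<inter> X \<noteq> {}" using A unfolding \<S>_def by blast
      have "X \<inter> S \<noteq> {}" using S(3) by blast
      then show ?thesis unfolding S(1) by (rule connected_Un[OF X(1) S(2)])
    qed
    have "X \<subseteq> \<Inter>\<S>" unfolding \<S>_def by blast
    then show "\<Inter>\<S> \<noteq> {}" using X(3) by blast
  qed
  ultimately show ?thesis by simp
qed

end

theorem exponentials_total:
  assumes u: "u holomorphic_on unit_disc" "inj_on u unit_disc" and V: "right_half_plane_region (u ` unit_disc) c"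
    and l: "l \<in> bounded_functionals (hardy_space p) (hardy_norm p)" and p: "p \<ge> 1"
    and 0: "\<And>s. 0 \<le> s \<Longrightarrow> l (on_disc (\<lambda>z. exp (- of_real s * u z))) = 0"
    and f: "f \<in> hardy_space p"
  shows "l f = 0"
proof (rule bounded_functional_eq_0[OF l p _ f])
  interpret V: right_half_plane_region "u ` unit_disc" c by (rule V)
  have p0: "p > 0" using p by simp
  have Reu: "0 < Re (u z)" if "z \<in> unit_disc" for z using V.pos that by blast
  define E where "E = (\<lambda>s. on_disc (\<lambda>z. exp (- of_real s * u z))) ` {0..}"
  have E1: "E \<subseteq> bounded_analytic"
    unfolding E_def
  proof (rule image_subsetI)
    fix s :: real assume s: "s \<in> {0..}"
    show "on_disc (\<lambda>z. exp (- of_real s * u z)) \<in> bounded_analytic"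
    proof (rule on_disc_bounded_analytic[where C = 1])
      show "(\<lambda>z. exp (- of_real s * u z)) holomorphic_on unit_disc" by (intro holomorphic_intros u)
      show "cmod (exp (- of_real s * u z)) \<le> 1" if "z \<in> unit_disc" for z
        using s Reu[OF that] by simp
    qed
  qed
  have E2: "(\<lambda>z. e z * e' z) \<in> E" if "e \<in> E" "e' \<in> E" for e e'
  proof -
    obtain s s' where s: "0 \<le> s" "0 \<le> s'" "e = on_disc (\<lambda>z. exp (- of_real s * u z))" "e' = on_disc (\<lambda>z. exp (- of_real s' * u z))"
      using \<open>e \<in> E\<close> \<open>e' \<in> E\<close> unfolding E_def by auto
    have "(\<lambda>z. e z * e' z) = on_disc (\<lambda>z. exp (- of_real (s + s') * u z))"
      unfolding s(3,4) by (auto simp: on_disc_def fun_eq_iff algebra_simps simp flip: exp_add)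
    then show ?thesis unfolding E_def by (rule image_eqI[where x = "s + s'"]) (use s(1,2) in simp)
  qed
  have E3: "on_disc (\<lambda>z. 1) \<in> E"
    unfolding E_def by (intro image_eqI[of _ _ 0]) auto
  interpret A: disc_algebra "{f. on_disc f \<in> bp_closure E}"
    by (rule disc_algebra_bp_closure[OF E1 E2 E3])
  have k: "(\<lambda>z. 1 / (1 + u z)) \<in> {f. on_disc f \<in> bp_closure E}"
  proof (rule A.resolvent_of_exponentials[OF _ Reu])
    show "(\<lambda>z. exp (- of_real s * u z)) \<in> {f. on_disc f \<in> bp_closure E}" if "0 \<le> s" for s :: real
      using that by (auto simp: E_def intro!: bp_closure.gen)
  qed
  have nz: "1 + u z \<noteq> 0" if "z \<in> unit_disc" for z using Reu[OF that] by (auto simp: complex_eq_iff)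
  have inj: "inj_on (\<lambda>z. 1 / (1 + u z)) unit_disc"
  proof (rule inj_onI)
    fix x y assume "x \<in> unit_disc" "y \<in> unit_disc" "1 / (1 + u x) = 1 / (1 + u y)"
    then show "x = y" using nz[of x] nz[of y] u(2) by (auto simp: field_simps dest: inj_onD)
  qed
  have im: "(\<lambda>z. 1 / (1 + u z)) ` unit_disc = V.T" by (auto simp: V.T_def)
  have "open V.T"
    unfolding im[symmetric]
    by (rule open_mapping_thm3[OF _ _ inj]) (use nz in \<open>auto intro!: holomorphic_intros u\<close>)
  then have int: "interior (closure V.T) = V.T"
    using V.interior_closure_T_subset interior_maximal[OF closure_subset] by blast
  fix g assume g: "g \<in> bounded_analytic"
  then obtain C where C: "g holomorphic_on unit_disc" "\<And>z. z \<in> unit_disc \<Longrightarrow> cmod (g z) \<le> C"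
    unfolding bounded_analytic_def by blast
  have "g \<in> {f. on_disc f \<in> bp_closure E}"
    by (rule A.bounded_holomorphic_mem[OF k inj _ _ C])
       (use V.connected_complement_closure_T int in \<open>simp_all add: im\<close>)
  then have "g \<in> bp_closure E" using on_disc_eq_self[OF g] by simp
  then show "l g = 0"
    by (rule bounded_functional_bp_closure[OF l p0 E1, rotated]) (use 0 in \<open>auto simp: E_def\<close>)
qed

section \<open>Commutants\<close>

lemma bounded_opsD:
  assumes "A \<in> bounded_ops V N"
  shows "A \<in> V \<rightarrow>\<^sub>E V" and "f \<in> V \<Longrightarrow> A f \<in> V"
    and "f \<in> V \<Longrightarrow> g \<in> V \<Longrightarrow> A (\<lambda>s. f s + g s) = (\<lambda>s. A f s + A g s)"
    and "f \<in> V \<Longrightarrow> A (\<lambda>s. c * f s) = (\<lambda>s. c * A f s)"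
  using assms by (auto simp: bounded_ops_def linear_ops_on_def)

lemma bounded_ops_eqI:
  assumes "A \<in> bounded_ops V N" "B \<in> bounded_ops V N" "\<And>f. f \<in> V \<Longrightarrow> A f = B f"
  shows "A = B"
  using PiE_ext[OF bounded_opsD(1)[OF assms(1)] bounded_opsD(1)[OF assms(2)] assms(3)] .

lemma hardy_op_bound:
  assumes "A \<in> bounded_ops V (hardy_norm p)"
  obtains K where "0 \<le> K" "\<And>f. f \<in> V \<Longrightarrow> hardy_norm p (A f) \<le> K * hardy_norm p f"
proof -
  obtain K where K: "\<And>f. f \<in> V \<Longrightarrow> hardy_norm p (A f) \<le> K * hardy_norm p f"
    using assms unfolding bounded_ops_def by blast
  have "hardy_norm p (A f) \<le> \<bar>K\<bar> * hardy_norm p f" if "f \<in> V" for f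
    using K[OF that] mult_right_mono[OF abs_ge_self[of K] hardy_norm_nonneg[of p f]] by linarith
  then show ?thesis using that[of "\<bar>K\<bar>"] by simp
qed

lemma commutant_iff:
  "A \<in> commutant V N T \<longleftrightarrow> A \<in> bounded_ops V N \<and> (\<forall>f\<in>V. A (T f) = T (A f))"
proof -
  have "compose V A T = compose V T A \<longleftrightarrow> (\<forall>f\<in>V. A (T f) = T (A f))"
  proof
    assume eq: "compose V A T = compose V T A"
    show "\<forall>f\<in>V. A (T f) = T (A f)"
    proof
      fix f assume "f \<in> V"
      then show "A (T f) = T (A f)" using fun_cong[OF eq, of f] by (simp add: compose_eq)
    qed
  next
    assume "\<forall>f\<in>V. A (T f) = T (A f)"
    then show "compose V A T = compose V T A" by (intro ext) (simp add: compose_def)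
  qed
  then show ?thesis by (simp add: commutant_def)
qed

lemma functional_commutant_imp_abelian:
  assumes "functional_commutant_property V N T"
  shows "abelian_ops V (commutant V N T)"
proof -
  obtain G \<A> \<Phi> where iso: "algebra_iso_to_ops V \<A> (commutant V N T) \<Phi>"
    using assms unfolding functional_commutant_property_def by blast
  have surj: "\<Phi> ` \<A> = commutant V N T" using iso unfolding algebra_iso_to_ops_def by (simp add: bij_betw_imp_surj_on)
  have mult: "\<Phi> (\<lambda>z. f z * g z) = compose V (\<Phi> f) (\<Phi> g)" if "f \<in> \<A>" "g \<in> \<A>" for f g
    using iso that unfolding algebra_iso_to_ops_def by blast
  show ?thesis
    unfolding abelian_ops_def
  proof (intro ballI)
    fix A B assume AB: "A \<in> commutant V N T" "B \<in> commutant V N T"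
    obtain f where f: "f \<in> \<A>" "A = \<Phi> f" using AB(1) unfolding surj[symmetric] by blast
    obtain g where g: "g \<in> \<A>" "B = \<Phi> g" using AB(2) unfolding surj[symmetric] by blast
    show "compose V A B = compose V B A"
      unfolding f(2) g(2) mult[OF f(1) g(1), symmetric] mult[OF g(1) f(1), symmetric] by (simp only: mult.commute)
  qed
qed

lemma continuous_idempotent_trivial:
  fixes f :: "complex \<Rightarrow> complex"
  assumes "connected G" "continuous_on G f" "\<And>z. f z * f z = f z"
  shows "(\<forall>z\<in>G. f z = 0) \<or> (\<forall>z\<in>G. f z = 1)"
proof -
  have "f ` G \<subseteq> {0, 1}"
  proof (rule image_subsetI)
    fix z
    have "f z * (f z - 1) = 0" using assms(3)[of z] by (simp add: algebra_simps)
    then show "f z \<in> {0, 1}" by auto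
  qed
  then have "finite (f ` G)" by (rule finite_subset) simp
  moreover have "connected (f ` G)" by (rule connected_continuous_image[OF assms(2,1)])
  ultimately have "f ` G = {} \<or> (\<exists>x. f ` G = {x})" by (simp add: connected_finite_iff_sing)
  then show ?thesis
  proof
    assume "\<exists>x. f ` G = {x}"
    then obtain x where x: "f ` G = {x}" by blast
    then have "x = 0 \<or> x = 1" using \<open>f ` G \<subseteq> {0, 1}\<close> by auto
    then show ?thesis using x by blast
  qed simp
qed

text \<open>A continuous idempotent function on a connected set is 0 or 1. Since the subalgebra may
  lack the constant 1, the second case uses the preimage \<open>e\<close> of the identity operator:
  from \<open>f * e = e\<close> it follows that J is the identity.\<close>

lemma functional_commutant_no_idempotent:
  assumes fcp: "functional_commutant_property V N T" and id: "op_id V \<in> commutant V N T"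
    and J: "J \<in> commutant V N T"
  shows "\<not> nontrivial_idempotent V N J"
proof
  assume ni: "nontrivial_idempotent V N J"
  have J1: "J \<in> bounded_ops V N" "compose V J J = J" "J \<noteq> op_zero V" "J \<noteq> op_id V"
    using ni by (auto simp: nontrivial_idempotent_def)
  obtain G \<A> \<Phi> where G: "connected G" and sub: "subalgebra_of_continuous G \<A>"
    and iso: "algebra_iso_to_ops V \<A> (commutant V N T) \<Phi>"
    using fcp unfolding functional_commutant_property_def by blast
  have bij: "bij_betw \<Phi> \<A> (commutant V N T)" using iso unfolding algebra_iso_to_ops_def by blast
  have mult: "\<Phi> (\<lambda>z. f z * g z) = compose V (\<Phi> f) (\<Phi> g)" if "f \<in> \<A>" "g \<in> \<A>" for f g
    using iso that unfolding algebra_iso_to_ops_def by blast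
  have scale: "\<Phi> (\<lambda>z. c * f z) = op_scale V c (\<Phi> f)" if "f \<in> \<A>" for c f
    using iso that unfolding algebra_iso_to_ops_def by blast
  have cont: "continuous_on G f" "z \<notin> G \<Longrightarrow> f z = 0" if "f \<in> \<A>" for f z
    using sub that unfolding subalgebra_of_continuous_def continuous_functions_def by blast+
  have multA: "(\<lambda>z. f z * g z) \<in> \<A>" if "f \<in> \<A>" "g \<in> \<A>" for f g
    using sub that unfolding subalgebra_of_continuous_def by blast
  obtain f where f: "f \<in> \<A>" "\<Phi> f = J" using J unfolding bij_betw_imp_surj_on[OF bij, symmetric] by (rule imageE) simp
  obtain e where e: "e \<in> \<A>" "\<Phi> e = op_id V" using id unfolding bij_betw_imp_surj_on[OF bij, symmetric] by (rule imageE) simp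
  have "\<Phi> (\<lambda>z. f z * f z) = \<Phi> f" using mult[OF f(1) f(1)] J1(2) f(2) by simp
  then have ff: "(\<lambda>z. f z * f z) = f"
    by (rule inj_onD[OF bij_betw_imp_inj_on[OF bij] _ multA[OF f(1) f(1)] f(1)])
  consider "\<forall>z\<in>G. f z = 0" | "\<forall>z\<in>G. f z = 1"
    using continuous_idempotent_trivial[OF G cont(1)[OF f(1)] fun_cong[OF ff]] by blast
  then show False
  proof cases
    case 1
    then have "f z = 0" for z using cont(2)[OF f(1), of z] by (cases "z \<in> G") auto
    then have "(\<lambda>z. 0 * f z) = f" by auto
    then have "op_scale V 0 J = J" using scale[OF f(1), of 0] f(2) by simp
    moreover have "op_scale V 0 J = op_zero V" by (simp add: op_scale_def op_zero_def)
    ultimately show False using J1(3) by simp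
  next
    case 2
    then have "f z * e z = e z" for z using cont(2)[OF e(1), of z] by (cases "z \<in> G") auto
    then have "(\<lambda>z. f z * e z) = e" by (rule ext)
    then have "compose V J (op_id V) = op_id V"
      using mult[OF f(1) e(1)] unfolding f(2) e(2) by (simp only: e(2))
    moreover have "compose V J (op_id V) = J"
    proof
      fix x show "compose V J (op_id V) x = J x"
        using PiE_arb[OF bounded_opsD(1)[OF J1(1)], of x] by (simp add: compose_def op_id_def)
    qed
    ultimately show False using J1(4) by simp
  qed
qed

section \<open>The commutant as a unital algebra, and weak operator closure\<close>

lemma hardy_op_add:
  assumes A: "A \<in> bounded_ops (hardy_space p) (hardy_norm p)" and B: "B \<in> bounded_ops (hardy_space p) (hardy_norm p)"
    and p: "p > 0"
  shows "op_add (hardy_space p) A B \<in> bounded_ops (hardy_space p) (hardy_norm p)"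
proof -
  let ?V = "hardy_space p"
  note V = hardy_space_add(1)[OF _ _ p] hardy_space_scale(1)[OF _ p]
  have "op_add ?V A B \<in> linear_ops_on ?V"
    unfolding linear_ops_on_def op_add_def
    by (auto simp: V bounded_opsD[OF A] bounded_opsD[OF B] algebra_simps)
  moreover have "\<exists>K. \<forall>f\<in>?V. hardy_norm p (op_add ?V A B f) \<le> K * hardy_norm p f"
  proof -
    obtain K where K: "0 \<le> K" "\<And>f. f \<in> ?V \<Longrightarrow> hardy_norm p (A f) \<le> K * hardy_norm p f"
      using hardy_op_bound[OF A] by blast
    obtain L where L: "0 \<le> L" "\<And>f. f \<in> ?V \<Longrightarrow> hardy_norm p (B f) \<le> L * hardy_norm p f"
      using hardy_op_bound[OF B] by blast
    show ?thesis
    proof (intro exI ballI)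
      fix f assume f: "f \<in> ?V"
      have Af: "A f \<in> ?V" and Bf: "B f \<in> ?V" using bounded_opsD(2)[OF A f] bounded_opsD(2)[OF B f] .
      have "hardy_norm p (\<lambda>z. A f z + B f z) powr p \<le> 2 powr p * (hardy_norm p (A f) powr p + hardy_norm p (B f) powr p)"
        by (rule hardy_space_add(2)[OF Af Bf p])
      also have "\<dots> \<le> 2 powr p * ((K * hardy_norm p f) powr p + (L * hardy_norm p f) powr p)"
        using p f by (intro mult_left_mono add_mono powr_mono2 K L hardy_norm_nonneg) auto
      also have "\<dots> = (2 powr p * (K powr p + L powr p)) * hardy_norm p f powr p"
        by (simp add: powr_mult algebra_simps)
      finally have "(hardy_norm p (\<lambda>z. A f z + B f z) powr p) powr (1/p)
         \<le> ((2 powr p * (K powr p + L powr p)) * hardy_norm p f powr p) powr (1/p)"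
        using p by (intro powr_mono2) auto
      then show "hardy_norm p (op_add ?V A B f) \<le> (2 powr p * (K powr p + L powr p)) powr (1/p) * hardy_norm p f"
        using p f by (simp add: op_add_def powr_powr powr_mult hardy_norm_nonneg)
    qed
  qed
  ultimately show ?thesis unfolding bounded_ops_def by blast
qed

lemma hardy_op_scale:
  assumes A: "A \<in> bounded_ops (hardy_space p) (hardy_norm p)" and p: "p > 0"
  shows "op_scale (hardy_space p) c A \<in> bounded_ops (hardy_space p) (hardy_norm p)"
proof -
  let ?V = "hardy_space p"
  note V = hardy_space_add(1)[OF _ _ p] hardy_space_scale(1)[OF _ p]
  have "op_scale ?V c A \<in> linear_ops_on ?V"
    unfolding linear_ops_on_def op_scale_def
    by (auto simp: V bounded_opsD[OF A] algebra_simps)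
  moreover have "\<exists>K. \<forall>f\<in>?V. hardy_norm p (op_scale ?V c A f) \<le> K * hardy_norm p f"
  proof -
    obtain K where K: "0 \<le> K" "\<And>f. f \<in> ?V \<Longrightarrow> hardy_norm p (A f) \<le> K * hardy_norm p f"
      using hardy_op_bound[OF A] by blast
    have "hardy_norm p (op_scale ?V c A f) \<le> (cmod c * K) * hardy_norm p f" if f: "f \<in> ?V" for f
    proof -
      have "hardy_norm p (\<lambda>z. c * A f z) \<le> cmod c * hardy_norm p (A f)"
        by (rule hardy_space_scale(2)[OF bounded_opsD(2)[OF A f] p])
      also have "\<dots> \<le> cmod c * (K * hardy_norm p f)" by (intro mult_left_mono K f) simp
      finally show ?thesis using f by (simp add: op_scale_def mult.assoc)
    qed
    then show ?thesis by blast
  qed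
  ultimately show ?thesis unfolding bounded_ops_def by blast
qed

lemma hardy_op_compose:
  assumes A: "A \<in> bounded_ops (hardy_space p) (hardy_norm p)" and B: "B \<in> bounded_ops (hardy_space p) (hardy_norm p)"
    and p: "p > 0"
  shows "compose (hardy_space p) A B \<in> bounded_ops (hardy_space p) (hardy_norm p)"
proof -
  let ?V = "hardy_space p"
  note V = hardy_space_add(1)[OF _ _ p] hardy_space_scale(1)[OF _ p]
  have "compose ?V A B \<in> linear_ops_on ?V"
    unfolding linear_ops_on_def compose_def
    by (auto simp: V bounded_opsD(2-)[OF A] bounded_opsD(2-)[OF B])
  moreover have "\<exists>K. \<forall>f\<in>?V. hardy_norm p (compose ?V A B f) \<le> K * hardy_norm p f"
  proof -
    obtain K where K: "0 \<le> K" "\<And>f. f \<in> ?V \<Longrightarrow> hardy_norm p (A f) \<le> K * hardy_norm p f"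
      using hardy_op_bound[OF A] by blast
    obtain L where L: "0 \<le> L" "\<And>f. f \<in> ?V \<Longrightarrow> hardy_norm p (B f) \<le> L * hardy_norm p f"
      using hardy_op_bound[OF B] by blast
    have "hardy_norm p (compose ?V A B f) \<le> (K * L) * hardy_norm p f" if f: "f \<in> ?V" for f
    proof -
      have "hardy_norm p (A (B f)) \<le> K * hardy_norm p (B f)" by (rule K(2)[OF bounded_opsD(2)[OF B f]])
      also have "\<dots> \<le> K * (L * hardy_norm p f)" by (intro mult_left_mono K L f)
      finally show ?thesis using f by (simp add: compose_def mult.assoc)
    qed
    then show ?thesis by blast
  qed
  ultimately show ?thesis unfolding bounded_ops_def by blast
qed

lemma hardy_op_id:
  assumes p: "p > 0"
  shows "op_id (hardy_space p) \<in> bounded_ops (hardy_space p) (hardy_norm p)"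
proof -
  note V = hardy_space_add(1)[OF _ _ p] hardy_space_scale(1)[OF _ p]
  have "op_id (hardy_space p) \<in> linear_ops_on (hardy_space p)"
    unfolding linear_ops_on_def op_id_def by (auto simp: V)
  moreover have "\<forall>f\<in>hardy_space p. hardy_norm p (op_id (hardy_space p) f) \<le> 1 * hardy_norm p f"
    by (simp add: op_id_def)
  ultimately show ?thesis unfolding bounded_ops_def by blast
qed

lemma hardy_commutant_closed:
  assumes T: "T \<in> bounded_ops (hardy_space p) (hardy_norm p)" and p: "p > 0"
  shows "A \<in> commutant (hardy_space p) (hardy_norm p) T \<Longrightarrow> B \<in> commutant (hardy_space p) (hardy_norm p) T \<Longrightarrow>
      op_add (hardy_space p) A B \<in> commutant (hardy_space p) (hardy_norm p) T"
    and "A \<in> commutant (hardy_space p) (hardy_norm p) T \<Longrightarrow>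
      op_scale (hardy_space p) c A \<in> commutant (hardy_space p) (hardy_norm p) T"
    and "A \<in> commutant (hardy_space p) (hardy_norm p) T \<Longrightarrow> B \<in> commutant (hardy_space p) (hardy_norm p) T \<Longrightarrow>
      compose (hardy_space p) A B \<in> commutant (hardy_space p) (hardy_norm p) T"
    and "op_id (hardy_space p) \<in> commutant (hardy_space p) (hardy_norm p) T"
proof -
  let ?V = "hardy_space p" and ?C = "commutant (hardy_space p) (hardy_norm p) T"
  note TD = bounded_opsD(2-)[OF T]
  show "op_add ?V A B \<in> ?C" if AB: "A \<in> ?C" "B \<in> ?C"
    unfolding commutant_iff
  proof (intro conjI ballI)
    have A: "A \<in> bounded_ops ?V (hardy_norm p)" "\<And>f. f \<in> ?V \<Longrightarrow> A (T f) = T (A f)"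
      and B: "B \<in> bounded_ops ?V (hardy_norm p)" "\<And>f. f \<in> ?V \<Longrightarrow> B (T f) = T (B f)"
      using AB unfolding commutant_iff by blast+
    show "op_add ?V A B \<in> bounded_ops ?V (hardy_norm p)" by (rule hardy_op_add[OF A(1) B(1) p])
    show "op_add ?V A B (T f) = T (op_add ?V A B f)" if f: "f \<in> ?V" for f
      using f by (simp add: op_add_def TD A(2) B(2) bounded_opsD(2)[OF A(1)] bounded_opsD(2)[OF B(1)])
  qed
  show "op_scale ?V c A \<in> ?C" if A: "A \<in> ?C"
    unfolding commutant_iff
  proof (intro conjI ballI)
    have B: "A \<in> bounded_ops ?V (hardy_norm p)" "\<And>f. f \<in> ?V \<Longrightarrow> A (T f) = T (A f)"
      using A unfolding commutant_iff by blast+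
    show "op_scale ?V c A \<in> bounded_ops ?V (hardy_norm p)" by (rule hardy_op_scale[OF B(1) p])
    show "op_scale ?V c A (T f) = T (op_scale ?V c A f)" if f: "f \<in> ?V" for f
      using f by (simp add: op_scale_def TD B(2) bounded_opsD(2)[OF B(1)])
  qed
  show "compose ?V A B \<in> ?C" if AB: "A \<in> ?C" "B \<in> ?C"
    unfolding commutant_iff
  proof (intro conjI ballI)
    have A: "A \<in> bounded_ops ?V (hardy_norm p)" "\<And>f. f \<in> ?V \<Longrightarrow> A (T f) = T (A f)"
      and B: "B \<in> bounded_ops ?V (hardy_norm p)" "\<And>f. f \<in> ?V \<Longrightarrow> B (T f) = T (B f)"
      using AB unfolding commutant_iff by blast+
    show "compose ?V A B \<in> bounded_ops ?V (hardy_norm p)" by (rule hardy_op_compose[OF A(1) B(1) p])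
    show "compose ?V A B (T f) = T (compose ?V A B f)" if f: "f \<in> ?V" for f
      using f by (simp add: compose_def TD A(2) B(2) bounded_opsD(2)[OF A(1)] bounded_opsD(2)[OF B(1)])
  qed
  show "op_id ?V \<in> ?C"
    unfolding commutant_iff
  proof (intro conjI ballI)
    show "op_id ?V \<in> bounded_ops ?V (hardy_norm p)" by (rule hardy_op_id[OF p])
    show "op_id ?V (T f) = T (op_id ?V f)" if f: "f \<in> ?V" for f
      using f by (simp add: op_id_def TD)
  qed
qed

lemma op_point_functional:
  assumes A: "A \<in> bounded_ops (hardy_space p) (hardy_norm p)" and p: "p > 0"
  shows "(\<lambda>f. A f z) \<in> bounded_functionals (hardy_space p) (hardy_norm p)"
proof -
  obtain K where K: "0 \<le> K" "\<And>f. f \<in> hardy_space p \<Longrightarrow> hardy_norm p (A f) \<le> K * hardy_norm p f"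
    using hardy_op_bound[OF A] by blast
  obtain C where C: "C > 0" "\<And>f. f \<in> hardy_space p \<Longrightarrow> cmod (f z) \<le> C * hardy_norm p f"
    using bounded_functional_bound[OF point_evaluation_bounded[OF p, of z]] by blast
  have "cmod (A f z) \<le> (C * K) * hardy_norm p f" if f: "f \<in> hardy_space p" for f
  proof -
    have "cmod (A f z) \<le> C * hardy_norm p (A f)" by (rule C(2)[OF bounded_opsD(2)[OF A f]])
    also have "\<dots> \<le> C * (K * hardy_norm p f)" using C(1) by (intro mult_left_mono K f) simp
    finally show ?thesis by (simp add: mult.assoc)
  qed
  moreover have "A (\<lambda>s. f s + g s) z = A f z + A g z" if "f \<in> hardy_space p" "g \<in> hardy_space p" for f g
    by (simp add: bounded_opsD(3)[OF A that])
  moreover have "A (\<lambda>s. c * f s) z = c * A f z" if "f \<in> hardy_space p" for f c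
    by (simp add: bounded_opsD(4)[OF A that])
  ultimately show ?thesis unfolding bounded_functionals_def by blast
qed

lemma op_poly_commutes:
  assumes T: "T \<in> bounded_ops (hardy_space p) (hardy_norm p)" and p: "p > 0"
    and B: "B \<in> commutant (hardy_space p) (hardy_norm p) T" and f: "f \<in> hardy_space p"
  shows "B (op_poly (hardy_space p) q T f) = op_poly (hardy_space p) q T (B f)"
proof -
  let ?V = "hardy_space p"
  have Bb: "B \<in> bounded_ops ?V (hardy_norm p)" and BT: "\<And>f. f \<in> ?V \<Longrightarrow> B (T f) = T (B f)"
    using B unfolding commutant_iff by auto
  have Tf: "(T ^^ i) f \<in> ?V" for i by (induction i) (simp_all add: f bounded_opsD(2)[OF T])
  have pw: "B ((T ^^ i) f) = (T ^^ i) (B f)" for i by (induction i) (simp_all add: BT Tf)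
  have "(\<lambda>s. \<Sum>i\<in>I. c i * (T ^^ i) f s) \<in> ?V \<and>
     B (\<lambda>s. \<Sum>i\<in>I. c i * (T ^^ i) f s) = (\<lambda>s. \<Sum>i\<in>I. c i * (T ^^ i) (B f) s)" if "finite I" for I c
    using that
  proof (induction I rule: finite_induct)
    case empty
    have z: "(\<lambda>s. 0 * f s) \<in> ?V" "B (\<lambda>s. 0 * f s) = (\<lambda>s. 0 * B f s)"
      using hardy_space_scale(1)[OF f p, of 0] bounded_opsD(4)[OF Bb f, of 0] by blast+
    then show ?case by simp
  next
    case (insert j I)
    have j: "(\<lambda>s. c j * (T ^^ j) f s) \<in> ?V" by (rule hardy_space_scale(1)[OF Tf p])
    show ?case
      using insert hardy_space_add(1)[OF j _ p] bounded_opsD(3)[OF Bb j] bounded_opsD(4)[OF Bb Tf, of "c j" j] pw[of j]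
      by simp
  qed
  from this[of "{..degree q}" "coeff q"] show ?thesis
    using f bounded_opsD(2)[OF Bb f] by (simp add: op_poly_def)
qed

text \<open>Commuting with a fixed B of the commutant is a weakly closed condition: for fixed f and
  z both \<open>S (B f) z\<close> and \<open>B (S f) z\<close> are obtained from S by bounded
  functionals. Polynomials in T satisfy it, hence so does every operator in their closure.\<close>

lemma minimal_commutant_imp_abelian:
  assumes T: "T \<in> bounded_ops (hardy_space p) (hardy_norm p)" and p: "p > 0"
    and min: "minimal_commutant (hardy_space p) (hardy_norm p) T"
  shows "abelian_ops (hardy_space p) (commutant (hardy_space p) (hardy_norm p) T)"
  unfolding abelian_ops_def
proof (intro ballI)
  let ?V = "hardy_space p" and ?N = "hardy_norm p"
  let ?C = "commutant ?V ?N T" and ?W = "weak_operator_topology ?V ?N"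
  fix A B assume A: "A \<in> ?C" and B: "B \<in> ?C"
  have Ab: "A \<in> bounded_ops ?V ?N" and Bb: "B \<in> bounded_ops ?V ?N" using A B by (auto simp: commutant_iff)
  have Acl: "A \<in> ?W closure_of op_alg ?V T" using A min unfolding minimal_commutant_def by simp
  have openW: "openin ?W {T \<in> bounded_ops ?V ?N. l (T f) \<in> U}"
    if "l \<in> bounded_functionals ?V ?N" "f \<in> ?V" "open U" for l f U
    unfolding weak_operator_topology_def by (rule topology_generated_by_Basis) (use that in blast)
  have eq: "A (B f) z = B (A f) z" if f: "f \<in> ?V" for f z
  proof (rule ccontr)
    assume ne: "A (B f) z \<noteq> B (A f) z"
    obtain U1 U2 where U: "open U1" "open U2" "A (B f) z \<in> U1" "B (A f) z \<in> U2" "U1 \<inter> U2 = {}"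
      using hausdorff[OF ne] by blast
    let ?O1 = "{S \<in> bounded_ops ?V ?N. S (B f) z \<in> U1}" and ?O2 = "{S \<in> bounded_ops ?V ?N. B (S f) z \<in> U2}"
    have "openin ?W (?O1 \<inter> ?O2)"
      using openW[OF point_evaluation_bounded[OF p, of z] bounded_opsD(2)[OF Bb f] U(1)]
        openW[OF op_point_functional[OF Bb p, of z] f U(2)] by (rule openin_Int)
    moreover have "A \<in> ?O1 \<inter> ?O2" using Ab U by simp
    ultimately have "\<exists>S. S \<in> op_alg ?V T \<and> S \<in> ?O1 \<inter> ?O2"
      using Acl[unfolded in_closure_of, THEN conjunct2, THEN spec[of _ "?O1 \<inter> ?O2"]] by (simp only: simp_thms)
    then obtain S where S: "S \<in> op_alg ?V T" "S \<in> ?O1 \<inter> ?O2" by (elim exE conjE)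
    obtain q where "S = op_poly ?V q T" using S(1) unfolding op_alg_def by blast
    then have "B (S f) z = S (B f) z" using op_poly_commutes[OF T p B f, of q] by simp
    moreover have "S (B f) z \<in> U1" "B (S f) z \<in> U2" using S(2) by simp_all
    ultimately have "S (B f) z \<in> U1 \<inter> U2" by simp
    then show False unfolding U(5) by simp
  qed
  have "compose ?V A B f = compose ?V B A f" for f
  proof (cases "f \<in> ?V")
    case True
    then show ?thesis unfolding compose_eq[OF True] using eq by (intro ext)
  qed (simp add: compose_def)
  then show "compose ?V A B = compose ?V B A" by (rule ext)
qed

section \<open>Composition semigroups\<close>

locale semiflow_model =
  fixes \<psi> :: "real \<Rightarrow> complex \<Rightarrow> complex" and h :: "complex \<Rightarrow> complex"
  assumes semiflow: "holomorphic_semiflow \<psi>" and koenigs: "koenigs_function \<psi> h"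
begin

lemma \<psi>_hol: "0 \<le> t \<Longrightarrow> \<psi> t holomorphic_on unit_disc"
  and \<psi>_maps: "0 \<le> t \<Longrightarrow> \<psi> t \<in> unit_disc \<rightarrow> unit_disc"
  and \<psi>_add: "0 \<le> t \<Longrightarrow> 0 \<le> s \<Longrightarrow> z \<in> unit_disc \<Longrightarrow> \<psi> (t + s) z = \<psi> t (\<psi> s z)"
  using semiflow unfolding holomorphic_semiflow_def by blast+

lemma \<psi>_disc: "0 \<le> t \<Longrightarrow> z \<in> unit_disc \<Longrightarrow> \<psi> t z \<in> unit_disc"
  by (rule funcset_mem[OF \<psi>_maps])

lemma h_hol: "h holomorphic_on unit_disc" and h_inj: "inj_on h unit_disc"
  using koenigs unfolding koenigs_function_def by blast+

lemma h_\<psi>: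
  assumes "0 \<le> t" "z \<in> unit_disc"
  shows "h (\<psi> t z) = h z + of_real t"
proof -
  have "h z + of_real t \<in> h ` unit_disc" "\<psi> t z = inv_into unit_disc h (h z + of_real t)"
    using koenigs assms unfolding koenigs_function_def by blast+
  then show ?thesis by (simp add: f_inv_into_f)
qed

lemma iterate_disc: "(\<psi> 1 ^^ n) 0 \<in> unit_disc"
proof (induction n)
  case (Suc n)
  then show ?case using \<psi>_disc[OF zero_le_one Suc] by simp
qed simp

lemma h_iterate: "h ((\<psi> 1 ^^ n) 0) = h 0 + of_nat n"
  by (induction n) (simp_all add: h_\<psi>[OF _ iterate_disc] algebra_simps)

lemma eigenfunction_unique:
  assumes sum: "\<not> summable (\<lambda>n. 1 - cmod ((\<psi> 1 ^^ Suc n) 0))" and p: "p > 0"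
    and f: "f \<in> hardy_space p" "\<And>z. z \<in> unit_disc \<Longrightarrow> f (\<psi> 1 z) = \<mu> * f z"
    and g: "g \<in> hardy_space p" "\<And>z. z \<in> unit_disc \<Longrightarrow> g (\<psi> 1 z) = \<mu> * g z" "g 0 \<noteq> 0"
  shows "f z = f 0 / g 0 * g z"
proof -
  define D where "D = (\<lambda>z. f z + (- (f 0 / g 0)) * g z)"
  have D: "D \<in> hardy_space p"
    unfolding D_def by (rule hardy_space_add(1)[OF f(1) hardy_space_scale(1)[OF g(1) p] p])
  have iter: "F ((\<psi> 1 ^^ n) 0) = \<mu> ^ n * F 0" if "\<And>z. z \<in> unit_disc \<Longrightarrow> F (\<psi> 1 z) = \<mu> * F z" for F n
    by (induction n) (simp_all add: that[OF iterate_disc])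
  have D0: "D ((\<psi> 1 ^^ n) 0) = 0" for n
    unfolding D_def using iter[of f n, OF f(2)] iter[of g n, OF g(2)] g(3) by simp
  have "\<not> (\<exists>w\<in>unit_disc. D w \<noteq> 0)"
  proof
    assume nz: "\<exists>w\<in>unit_disc. D w \<noteq> 0"
    \<comment> \<open>The orbit is taken from its first iterate on, since the Blaschke condition is
      stated for nonzero points. As h grows by 1 at each step, the points are distinct and never
      return to 0.\<close>
    have "summable (\<lambda>n. 1 - cmod ((\<psi> 1 ^^ Suc n) 0))"
    proof (rule blaschke_summable[OF D p nz])
      show "inj (\<lambda>n. (\<psi> 1 ^^ Suc n) 0)"
      proof (rule injI)
        fix m n assume "(\<psi> 1 ^^ Suc m) 0 = (\<psi> 1 ^^ Suc n) 0"
        then have "h 0 + of_nat (Suc m) = h 0 + of_nat (Suc n)"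
          using h_iterate[of "Suc m"] h_iterate[of "Suc n"] by simp
        then show "m = n" by simp
      qed
      show "(\<psi> 1 ^^ Suc n) 0 \<in> unit_disc" for n by (rule iterate_disc)
      show "(\<psi> 1 ^^ Suc n) 0 \<noteq> 0" for n
      proof
        assume "(\<psi> 1 ^^ Suc n) 0 = 0"
        then have "h 0 + of_nat (Suc n) = h 0" using h_iterate[of "Suc n"] by simp
        then show False by (simp del: of_nat_Suc)
      qed
      show "D ((\<psi> 1 ^^ Suc n) 0) = 0" for n by (rule D0)
    qed
    then show False using sum by simp
  qed
  then have "D z = 0" using hardy_space_outside[OF D, of z] by blast
  then show ?thesis unfolding D_def by simp
qed

lemma composition_\<psi>_bounded:
  assumes "0 \<le> t" "p > 0"
  shows "composition_op p (\<psi> t) \<in> bounded_ops (hardy_space p) (hardy_norm p)"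
  by (rule composition_op_bounded[OF \<psi>_hol \<psi>_maps]) (use assms in auto)

lemma commutant_not_abelian:
  assumes sub: "h ` unit_disc \<subseteq> {w. Im w > - \<eta>}" and p: "p > 0"
  shows "\<not> abelian_ops (hardy_space p) (commutant (hardy_space p) (hardy_norm p) (composition_op p (\<psi> 1)))"
proof
  let ?V = "hardy_space p" and ?T = "composition_op p (\<psi> 1)"
  assume ab: "abelian_ops ?V (commutant ?V (hardy_norm p) ?T)"
  define g where "g = (\<lambda>z. exp (2 * of_real pi * \<i> * h z))"
  define M where "M = multiplication_op p g"
  define C where "C = composition_op p (\<psi> (1/2))"
  have ghol: "g holomorphic_on unit_disc" unfolding g_def by (intro holomorphic_intros h_hol)
  have gb: "cmod (g z) \<le> exp (2 * pi * \<eta>)" if "z \<in> unit_disc" for z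
  proof -
    have "- \<eta> < Im (h z)" using sub that by blast
    then have "2 * pi * (- Im (h z)) \<le> 2 * pi * \<eta>" by (intro mult_left_mono) auto
    then show ?thesis by (simp add: g_def)
  qed
  have g1: "g (\<psi> 1 z) = g z" if "z \<in> unit_disc" for z
    using that exp_two_pi_i by (simp add: g_def h_\<psi> distrib_left exp_add mult.assoc)
  have g2: "g (\<psi> (1/2) z) = - g z" if "z \<in> unit_disc" for z
    using that by (simp add: g_def h_\<psi> distrib_left exp_add mult.assoc)
  have Mb: "M \<in> bounded_ops ?V (hardy_norm p)"
    unfolding M_def by (rule multiplication_op_bounded[OF ghol gb p])
  have Cb: "C \<in> bounded_ops ?V (hardy_norm p)"
    unfolding C_def by (rule composition_\<psi>_bounded) (use p in auto)
  have Tb: "?T \<in> bounded_ops ?V (hardy_norm p)"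
    by (rule composition_\<psi>_bounded) (use p in auto)
  have appT: "?T f = (\<lambda>z. if z \<in> unit_disc then f (\<psi> 1 z) else 0)" if "f \<in> ?V" for f
    using that by (simp add: composition_op_def)
  have appC: "C f = (\<lambda>z. if z \<in> unit_disc then f (\<psi> (1/2) z) else 0)" if "f \<in> ?V" for f
    using that by (simp add: composition_op_def C_def)
  have appM: "M f = (\<lambda>z. g z * f z)" if "f \<in> ?V" for f
    using that by (simp add: multiplication_op_def M_def)
  have "M (?T f) = ?T (M f)" if f: "f \<in> ?V" for f
    unfolding appM[OF bounded_opsD(2)[OF Tb f]] appT[OF bounded_opsD(2)[OF Mb f]]
    unfolding appM[OF f] appT[OF f] using g1 by (simp add: fun_eq_iff)
  then have McT: "M \<in> commutant ?V (hardy_norm p) ?T" unfolding commutant_iff using Mb by blast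
  have half: "\<psi> 1 (\<psi> (1/2) z) = \<psi> (1/2) (\<psi> 1 z)" if "z \<in> unit_disc" for z
    using \<psi>_add[of 1 "1/2" z] \<psi>_add[of "1/2" 1 z] that by (simp add: add.commute)
  have "C (?T f) = ?T (C f)" if f: "f \<in> ?V" for f
  proof
    fix z show "C (?T f) z = ?T (C f) z"
    proof (cases "z \<in> unit_disc")
      case True
      then have "\<psi> (1/2) z \<in> unit_disc" "\<psi> 1 z \<in> unit_disc"
        using \<psi>_disc[of "1/2" z] \<psi>_disc[of 1 z] by simp_all
      then show ?thesis
        unfolding appC[OF bounded_opsD(2)[OF Tb f]] appT[OF bounded_opsD(2)[OF Cb f]]
        unfolding appC[OF f] appT[OF f] using True half[OF True] by simp
    next
      case False
      then show ?thesis
        unfolding appC[OF bounded_opsD(2)[OF Tb f]] appT[OF bounded_opsD(2)[OF Cb f]] by simp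
    qed
  qed
  then have CcT: "C \<in> commutant ?V (hardy_norm p) ?T" unfolding commutant_iff using Cb by blast
  \<comment> \<open>The constant function and the point 0 suffice as a test: the two orders of
    composition give \<open>- g 0\<close> and \<open>g 0\<close>, and an exponential does not
    vanish.\<close>
  have one: "on_disc (\<lambda>z. 1) \<in> ?V"
    by (rule bounded_analytic_hardy[OF on_disc_bounded_analytic p]) auto
  have "compose ?V C M = compose ?V M C" using ab McT CcT unfolding abelian_ops_def by blast
  then have "compose ?V C M (on_disc (\<lambda>z. 1)) 0 = compose ?V M C (on_disc (\<lambda>z. 1)) 0" by simp
  then have "C (M (on_disc (\<lambda>z. 1))) 0 = M (C (on_disc (\<lambda>z. 1))) 0"
    by (simp only: compose_eq[OF one])
  moreover have "C (M (on_disc (\<lambda>z. 1))) 0 = - g 0"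
    unfolding appC[OF bounded_opsD(2)[OF Mb one]] unfolding appM[OF one]
    using g2[of 0] \<psi>_disc[of "1/2" 0] by (simp add: on_disc_def)
  moreover have "M (C (on_disc (\<lambda>z. 1))) 0 = g 0"
    unfolding appM[OF bounded_opsD(2)[OF Cb one]] unfolding appC[OF one]
    using \<psi>_disc[of "1/2" 0] by (simp add: on_disc_def)
  ultimately have "- g 0 = g 0" by simp
  then show False by (simp add: g_def)
qed

text \<open>If \<open>Re a = 0\<close>, then \<open>exp (\<plusminus> 2 \<pi> \<i> h)\<close> would be a second fixed function of the composition operator.\<close>
lemma half_plane_normal:
  assumes sum: "\<not> summable (\<lambda>n. 1 - cmod ((\<psi> 1 ^^ Suc n) 0))"
    and a: "a \<noteq> 0" "\<And>z. z \<in> unit_disc \<Longrightarrow> b < a \<bullet> h z"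
  shows "0 < Re a"
proof (rule ccontr)
  assume "\<not> 0 < Re a"
  then consider "Re a < 0" | "Re a = 0" by linarith
  then show False
  proof cases
    case 1
    \<comment> \<open>The flow time after which \<open>a \<bullet> h\<close> would have dropped
      exactly to the forbidden value b.\<close>
    define t where "t = (a \<bullet> h 0 - b) / (- Re a)"
    have "b < a \<bullet> h 0" using a(2)[of 0] by simp
    then have t: "0 \<le> t" using 1 unfolding t_def by (intro divide_nonneg_pos) auto
    have "b < a \<bullet> h (\<psi> t 0)" using t by (intro a(2) \<psi>_disc) auto
    also have "\<dots> = a \<bullet> h 0 + t * Re a" using h_\<psi>[OF t, of 0] by (simp add: inner_complex_def algebra_simps)
    also have "t * Re a = - (a \<bullet> h 0 - b)" using 1 by (simp add: t_def)
    finally show False by simp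
  next
    case 2
    define m where "m = Im a"
    have m: "m \<noteq> 0" using a(1) 2 by (auto simp: complex_eq_iff m_def)
    \<comment> \<open>The sign makes \<sigma> times the imaginary part of h bounded below, and hence
      the exponential bounded.\<close>
    define \<sigma> where "\<sigma> = sgn m"
    have \<sigma>: "\<sigma> = 1 \<or> \<sigma> = -1" using m by (auto simp: \<sigma>_def sgn_if)
    define g where "g = (\<lambda>z. exp (of_real (2 * pi * \<sigma>) * \<i> * h z))"
    have ghol: "g holomorphic_on unit_disc" unfolding g_def by (intro holomorphic_intros h_hol)
    have gb: "cmod (g z) \<le> exp (2 * pi * (- b / \<bar>m\<bar>))" if z: "z \<in> unit_disc" for z
    proof -
      have "b < m * Im (h z)" using a(2)[OF z] 2 by (simp add: inner_complex_def m_def)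
      moreover have "m = \<bar>m\<bar> * \<sigma>" unfolding \<sigma>_def by (simp add: abs_mult_sgn)
      ultimately have "b < \<bar>m\<bar> * (\<sigma> * Im (h z))" by (metis mult.assoc)
      then have "b / \<bar>m\<bar> \<le> \<sigma> * Im (h z)" using m by (simp add: pos_divide_le_eq mult.commute)
      then have "2 * pi * (- (\<sigma> * Im (h z))) \<le> 2 * pi * (- b / \<bar>m\<bar>)"
        by (intro mult_left_mono) auto
      then show ?thesis by (simp add: g_def mult.assoc)
    qed
    have e1: "exp (of_real (2 * pi * \<sigma>) * \<i>) = 1"
      using \<sigma> exp_two_pi_i' by (auto simp: exp_minus)
    have e2: "exp (of_real (2 * pi * \<sigma>) * \<i> * (1/2)) = -1"
      using \<sigma> by (auto simp: exp_minus)
    have g1: "g (\<psi> 1 z) = g z" if z: "z \<in> unit_disc" for z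
    proof -
      have "g (\<psi> 1 z) = exp (of_real (2 * pi * \<sigma>) * \<i> * h z + of_real (2 * pi * \<sigma>) * \<i>)"
        using h_\<psi>[of 1 z] z by (simp add: g_def distrib_left)
      then show ?thesis unfolding exp_add e1 by (simp add: g_def)
    qed
    have g2: "g (\<psi> (1/2) 0) = - g 0"
    proof -
      have "g (\<psi> (1/2) 0) = exp (of_real (2 * pi * \<sigma>) * \<i> * h 0 + of_real (2 * pi * \<sigma>) * \<i> * (1/2))"
        using h_\<psi>[of "1/2" 0] by (simp add: g_def distrib_left)
      then show ?thesis unfolding exp_add e2 by (simp add: g_def)
    qed
    \<comment> \<open>The divergence condition does not involve an exponent, so the contradiction
      can be drawn in H^1.\<close>
    have V: "on_disc g \<in> hardy_space 1" "on_disc (\<lambda>z. 1) \<in> hardy_space 1"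
      by (rule bounded_analytic_hardy[OF on_disc_bounded_analytic[OF ghol gb]], simp_all)
         (rule bounded_analytic_hardy[OF on_disc_bounded_analytic], auto)
    have "on_disc g (\<psi> (1/2) 0) = on_disc g 0 / on_disc (\<lambda>z. 1) 0 * on_disc (\<lambda>z. 1) (\<psi> (1/2) 0)"
    proof (rule eigenfunction_unique[OF sum _ V(1) _ V(2), of 1])
      show "on_disc g (\<psi> 1 z) = 1 * on_disc g z" if "z \<in> unit_disc" for z
        using that \<psi>_disc[of 1 z] g1[OF that] by (simp add: on_disc_def)
      show "on_disc (\<lambda>z. 1) (\<psi> 1 z) = 1 * on_disc (\<lambda>z. 1) z" if "z \<in> unit_disc" for z
        using that \<psi>_disc[of 1 z] by (simp add: on_disc_def)
    qed (simp_all add: on_disc_def)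
    then have "g (\<psi> (1/2) 0) = g 0" using \<psi>_disc[of "1/2" 0] by (simp add: on_disc_def)
    then show False unfolding g2 by (simp add: g_def)
  qed
qed

lemma has_functional_commutant:
  assumes sum: "\<not> summable (\<lambda>n. 1 - cmod ((\<psi> 1 ^^ Suc n) 0))"
    and H: "half_plane H" "h ` unit_disc \<subseteq> H"
    and reg: "interior (closure (h ` unit_disc)) = h ` unit_disc" and p: "p \<ge> 1"
  shows "functional_commutant_property (hardy_space p) (hardy_norm p) (composition_op p (\<psi> 1))"
proof -
  let ?V = "hardy_space p" and ?T = "composition_op p (\<psi> 1)"
  let ?C = "commutant ?V (hardy_norm p) ?T"
  have p0: "p > 0" using p by simp
  obtain a b where a: "a \<noteq> 0" "H = {w. a \<bullet> w > b}" using H(1) unfolding half_plane_def by blast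
  have ah: "b < a \<bullet> h z" if "z \<in> unit_disc" for z using H(2) that unfolding a(2) by blast
  have Rea: "0 < Re a" by (rule half_plane_normal[OF sum a(1) ah])
  \<comment> \<open>Multiplication by \<open>cnj a\<close> turns the inner product with
    \<open>a\<close> into a real part, so the half-plane becomes the right half-plane.\<close>
  define u where "u = (\<lambda>z. cnj a * h z - of_real b)"
  have uhol: "u holomorphic_on unit_disc" unfolding u_def by (intro holomorphic_intros h_hol)
  have uinj: "inj_on u unit_disc"
    using h_inj a(1) unfolding inj_on_def u_def by auto
  have Reu: "0 < Re (u z)" if "z \<in> unit_disc" for z
    using ah[OF that] by (simp add: u_def inner_complex_def)
  have u\<psi>: "u (\<psi> t z) = u z + of_real t * cnj a" if "0 \<le> t" "z \<in> unit_disc" for t z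
    by (simp add: u_def h_\<psi>[OF that] algebra_simps)
  have region: "right_half_plane_region (u ` unit_disc) (cnj a)"
  proof
    show "0 < Re v" if "v \<in> u ` unit_disc" for v using that Reu by blast
    show "v + of_real t * cnj a \<in> u ` unit_disc" if v: "v \<in> u ` unit_disc" "0 \<le> t" for v t
    proof -
      obtain z where z: "z \<in> unit_disc" "v = u z" using v(1) by blast
      show ?thesis unfolding z(2) u\<psi>[OF v(2) z(1), symmetric] by (rule imageI[OF \<psi>_disc[OF v(2) z(1)]])
    qed
    show "0 < Re (cnj a)" using Rea by simp
    show "u ` unit_disc \<noteq> {}" by simp
    \<comment> \<open>The map from h to u is an injective affine map of the plane; closure and
      interior commute with it, so regularity carries over.\<close>
    have lin: "linear ((*) (cnj a))" by (rule linear_times)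
    have inj: "inj ((*) (cnj a))" using a(1) by (auto simp: inj_on_def)
    have eq: "u ` unit_disc = (+) (- of_real b) ` ((*) (cnj a) ` (h ` unit_disc))"
      unfolding image_image by (rule image_cong) (simp_all add: u_def)
    show "interior (closure (u ` unit_disc)) = u ` unit_disc"
      unfolding eq closure_translation interior_translation closure_injective_linear_image[OF lin inj, symmetric]
        interior_injective_linear_image[OF lin inj] reg ..
  qed
  define e where "e = (\<lambda>s::real. on_disc (\<lambda>z. exp (- of_real s * u z)))"
  have eb: "e s \<in> bounded_analytic" "z \<in> unit_disc \<Longrightarrow> cmod (e s z) \<le> 1" if "0 \<le> s" for s z
  proof -
    have le: "cmod (exp (- of_real s * u z)) \<le> 1" if "z \<in> unit_disc" for z
      using \<open>0 \<le> s\<close> Reu[OF that] by simp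
    show "e s \<in> bounded_analytic"
      unfolding e_def by (rule on_disc_bounded_analytic[OF _ le]) (auto intro!: holomorphic_intros uhol)
    show "z \<in> unit_disc \<Longrightarrow> cmod (e s z) \<le> 1" using le[of z] by (simp add: e_def on_disc_def)
  qed
  have eV: "e s \<in> ?V" if "0 \<le> s" for s by (rule bounded_analytic_hardy[OF eb(1)[OF that] p0])
  have e0: "e s 0 \<noteq> 0" for s by (simp add: e_def on_disc_def)
  have e\<psi>: "e s (\<psi> 1 z) = exp (- of_real s * cnj a) * e s z" if "z \<in> unit_disc" for s z
    using that \<psi>_disc[of 1 z] u\<psi>[of 1 z] by (simp add: e_def on_disc_def algebra_simps flip: exp_add)
  have Tb: "?T \<in> bounded_ops ?V (hardy_norm p)" by (rule composition_\<psi>_bounded) (use p0 in auto)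
  note closed = hardy_commutant_closed[OF Tb p0]
  have Cb: "A \<in> bounded_ops ?V (hardy_norm p)" if "A \<in> ?C" for A using that by (simp add: commutant_iff)
  have Ae: "A (e s) z = A (e s) 0 / e s 0 * e s z" if A: "A \<in> ?C" and s: "0 \<le> s" for A s z
  proof (rule eigenfunction_unique[OF sum p0 bounded_opsD(2)[OF Cb[OF A] eV[OF s]] _ eV[OF s] e\<psi> e0])
    have Te: "?T (e s) = (\<lambda>z. exp (- of_real s * cnj a) * e s z)"
      using eV[OF s] e\<psi>[of _ s] by (auto simp: composition_op_def fun_eq_iff e_def on_disc_def)
    have "A (?T (e s)) = ?T (A (e s))" using A eV[OF s] by (simp add: commutant_iff)
    then have "?T (A (e s)) = (\<lambda>z. exp (- of_real s * cnj a) * A (e s) z)"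
      unfolding Te bounded_opsD(4)[OF Cb[OF A] eV[OF s]] by simp
    moreover fix z :: complex assume z: "z \<in> unit_disc"
    moreover have "?T (A (e s)) z = A (e s) (\<psi> 1 z)"
      using bounded_opsD(2)[OF Cb[OF A] eV[OF s]] z by (simp add: composition_op_def)
    ultimately show "A (e s) (\<psi> 1 z) = exp (- of_real s * cnj a) * A (e s) z" by simp
  qed
  \<comment> \<open>The parameter half-line, placed in the plane as the definition of the functional
    commutant property demands.\<close>
  define G :: "complex set" where "G = of_real ` {0..}"
  \<comment> \<open>The eigenvalue of A on \<open>e s\<close> is read off at the point 0, where
    \<open>e s\<close> is nonzero; the value 0 off \<open>G\<close> matches the representation of
    continuous functions.\<close>
  define \<alpha> where "\<alpha> = (\<lambda>A z. if z \<in> G then A (e (Re z)) (0::complex) / e (Re z) 0 else 0)"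
  have G: "z \<in> G \<Longrightarrow> 0 \<le> Re z" for z by (auto simp: G_def)
  have Ae': "A (e s) z = \<alpha> A (of_real s) * e s z" if "A \<in> ?C" "0 \<le> s" for A s z
    using Ae[OF that, of z] that(2) by (simp add: \<alpha>_def G_def)
  have \<alpha>I: "\<alpha> A z = c" if "z \<in> G" "A (e (Re z)) 0 = c * e (Re z) 0" for A z c
    using that e0[of "Re z"] by (simp add: \<alpha>_def)
  have connG: "connected G"
    unfolding G_def by (intro connected_continuous_image continuous_intros connected_Ici)
  have cont: "continuous_on G (\<alpha> A)" if A: "A \<in> ?C" for A
  proof -
    \<comment> \<open>Norm continuity of \<open>e\<close> in s is bypassed: as s varies,
      \<open>e s\<close> converges boundedly and pointwise, and bounded functionals respect
      this.\<close>
    have c1: "continuous_on {0..} (\<lambda>s. A (e s) 0)"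
      unfolding continuous_on_sequentially
    proof (intro allI ballI impI, elim conjE)
      fix x :: "nat \<Rightarrow> real" and s assume x: "s \<in> {0..}" "\<forall>n. x n \<in> {0..}" "x \<longlonglongrightarrow> s"
      have "(\<lambda>n. A (e (x n)) 0) \<longlonglongrightarrow> A (e s) 0"
      proof (rule bounded_functional_tendsto[OF op_point_functional[OF Cb[OF A] p0] p0])
        show "e (x n) \<in> bounded_analytic" for n using x(2) by (intro eb) auto
        show "cmod (e (x n) z) \<le> 1" if "z \<in> unit_disc" for n z using x(2) that by (intro eb) auto
        show "e s \<in> bounded_analytic" using x(1) by (intro eb) auto
        show "(\<lambda>n. e (x n) z) \<longlonglongrightarrow> e s z" if "z \<in> unit_disc" for z
          using that by (simp add: e_def on_disc_def) (intro tendsto_intros x)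
      qed
      then show "((\<lambda>s. A (e s) 0) \<circ> x) \<longlonglongrightarrow> A (e s) 0" by (simp add: o_def)
    qed
    have c2: "continuous_on {0..} (\<lambda>s. e s 0)"
      by (simp add: e_def on_disc_def) (intro continuous_intros)
    have "continuous_on G (\<lambda>z. A (e (Re z)) 0 / e (Re z) 0)"
      by (intro continuous_intros continuous_on_compose2[OF c1] continuous_on_compose2[OF c2])
         (use G e0 in auto)
    then show ?thesis by (rule continuous_on_eq) (simp add: \<alpha>_def)
  qed
  have inj: "inj_on \<alpha> ?C"
  proof (rule inj_onI)
    fix A B assume A: "A \<in> ?C" and B: "B \<in> ?C" and eq: "\<alpha> A = \<alpha> B"
    \<comment> \<open>The difference lies in the commutant too, and its point functionals kill every
      \<open>e s\<close>; totality then makes D zero.\<close>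
    define D where "D = op_add ?V A (op_scale ?V (-1) B)"
    have D: "D \<in> ?C" unfolding D_def by (rule closed(1)[OF A closed(2)[OF B]])
    have appD: "D f = (\<lambda>z. A f z - B f z)" if "f \<in> ?V" for f
      using that by (simp add: D_def op_add_def op_scale_def)
    show "A = B"
    proof (rule bounded_ops_eqI[OF Cb[OF A] Cb[OF B]])
      fix f assume f: "f \<in> ?V"
      have "D f z = 0" for z
      proof (rule exponentials_total[OF uhol uinj region op_point_functional[OF Cb[OF D] p0] p _ f])
        show "D (on_disc (\<lambda>z. exp (- of_real s * u z))) z = 0" if s: "0 \<le> s" for s
          unfolding e_def[symmetric] using appD[OF eV[OF s]] Ae'[OF A s, of z] Ae'[OF B s, of z] eq
          by (simp add: e_def)
      qed
      then show "A f = B f" unfolding appD[OF f] by (simp add: fun_eq_iff)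
    qed
  qed
  have \<alpha>_add: "\<alpha> (op_add ?V A B) = (\<lambda>z. \<alpha> A z + \<alpha> B z)" if "A \<in> ?C" "B \<in> ?C" for A B
    using eV[OF G] by (auto simp: \<alpha>_def op_add_def fun_eq_iff add_divide_distrib)
  have \<alpha>_scale: "\<alpha> (op_scale ?V c A) = (\<lambda>z. c * \<alpha> A z)" if "A \<in> ?C" for A c
    using eV[OF G] by (auto simp: \<alpha>_def op_scale_def fun_eq_iff)
  have \<alpha>_mult: "\<alpha> (compose ?V A B) = (\<lambda>z. \<alpha> A z * \<alpha> B z)" if A: "A \<in> ?C" and B: "B \<in> ?C" for A B
  proof
    fix z show "\<alpha> (compose ?V A B) z = \<alpha> A z * \<alpha> B z"
    proof (cases "z \<in> G")
      case True
      define s where "s = Re z"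
      have s: "0 \<le> s" "z = of_real s" using True by (auto simp: G_def s_def)
      have "B (e s) = (\<lambda>w. \<alpha> B z * e s w)" using Ae'[OF B s(1)] s(2) by auto
      then have "compose ?V A B (e s) = A (\<lambda>w. \<alpha> B z * e s w)" using eV[OF s(1)] by (simp add: compose_eq)
      also have "\<dots> = (\<lambda>w. \<alpha> B z * A (e s) w)" by (rule bounded_opsD(4)[OF Cb[OF A] eV[OF s(1)]])
      finally have "compose ?V A B (e s) 0 = \<alpha> A z * \<alpha> B z * e s 0"
        using Ae'[OF A s(1), of 0] s(2) by simp
      then show ?thesis using True by (intro \<alpha>I) (simp_all add: s_def)
    next
      case False
      then show ?thesis by (simp add: \<alpha>_def)
    qed
  qed
  define \<A> where "\<A> = \<alpha> ` ?C"
  define \<Phi> where "\<Phi> = inv_into ?C \<alpha>"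
  have \<Phi>: "\<Phi> (\<alpha> A) = A" if "A \<in> ?C" for A
    unfolding \<Phi>_def by (rule inv_into_f_f[OF inj that])
  have sub: "subalgebra_of_continuous G \<A>"
    unfolding subalgebra_of_continuous_def
  proof (intro conjI ballI allI)
    show "\<A> \<subseteq> continuous_functions G"
      unfolding \<A>_def continuous_functions_def using cont by (auto simp: \<alpha>_def)
    have "(\<lambda>z. 0 * \<alpha> (op_id ?V) z) \<in> \<A>"
      unfolding \<A>_def \<alpha>_scale[OF closed(4), symmetric] by (intro imageI closed)
    then show "(\<lambda>z. 0) \<in> \<A>" by simp
  next
    fix f g assume "f \<in> \<A>" "g \<in> \<A>"
    then obtain A B where AB: "A \<in> ?C" "B \<in> ?C" "f = \<alpha> A" "g = \<alpha> B" unfolding \<A>_def by blast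
    show "(\<lambda>z. f z + g z) \<in> \<A>"
      unfolding \<A>_def AB(3,4) \<alpha>_add[OF AB(1,2), symmetric] by (rule imageI[OF closed(1)[OF AB(1,2)]])
    show "(\<lambda>z. f z * g z) \<in> \<A>"
      unfolding \<A>_def AB(3,4) \<alpha>_mult[OF AB(1,2), symmetric] by (rule imageI[OF closed(3)[OF AB(1,2)]])
  next
    fix c f assume "f \<in> \<A>"
    then obtain A where A: "A \<in> ?C" "f = \<alpha> A" unfolding \<A>_def by blast
    show "(\<lambda>z. c * f z) \<in> \<A>"
      unfolding \<A>_def A(2) \<alpha>_scale[OF A(1), symmetric] by (rule imageI[OF closed(2)[OF A(1)]])
  qed
  have "algebra_iso_to_ops ?V \<A> ?C \<Phi>"
    unfolding algebra_iso_to_ops_def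
  proof (intro conjI ballI allI)
    have "bij_betw \<alpha> ?C \<A>" unfolding \<A>_def using inj by (rule inj_on_imp_bij_betw)
    then show "bij_betw \<Phi> \<A> ?C" unfolding \<Phi>_def by (rule bij_betw_inv_into)
  next
    fix f g assume "f \<in> \<A>" "g \<in> \<A>"
    then obtain A B where AB: "A \<in> ?C" "B \<in> ?C" "f = \<alpha> A" "g = \<alpha> B" unfolding \<A>_def by blast
    show "\<Phi> (\<lambda>z. f z + g z) = op_add ?V (\<Phi> f) (\<Phi> g)"
      unfolding AB(3,4) \<alpha>_add[OF AB(1,2), symmetric] by (simp only: \<Phi> AB(1,2) closed(1)[OF AB(1,2)])
    show "\<Phi> (\<lambda>z. f z * g z) = compose ?V (\<Phi> f) (\<Phi> g)"
      unfolding AB(3,4) \<alpha>_mult[OF AB(1,2), symmetric] by (simp only: \<Phi> AB(1,2) closed(3)[OF AB(1,2)])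
  next
    fix c f assume "f \<in> \<A>"
    then obtain A where A: "A \<in> ?C" "f = \<alpha> A" unfolding \<A>_def by blast
    show "\<Phi> (\<lambda>z. c * f z) = op_scale ?V c (\<Phi> f)"
      unfolding A(2) \<alpha>_scale[OF A(1), symmetric] by (simp only: \<Phi> A(1) closed(2)[OF A(1)])
  qed
  then show ?thesis unfolding functional_commutant_property_def using connG sub by blast
qed

end

lemma composition_op_cong:
  assumes "\<And>z. z \<in> unit_disc \<Longrightarrow> \<phi> z = \<phi>' z"
  shows "composition_op p \<phi> = composition_op p \<phi>'"
  unfolding composition_op_def using assms by (auto simp: restrict_def fun_eq_iff)

theorem theorem3:
  fixes \<phi> :: "complex \<Rightarrow> complex"
    and \<psi> :: "real \<Rightarrow> complex \<Rightarrow> complex"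
    and h :: "complex \<Rightarrow> complex"
    and \<Omega> :: "complex set"
  assumes "\<phi> holomorphic_on ball 0 1" and "\<phi> \<in> ball 0 1 \<rightarrow> ball 0 1"
    and "parabolic_semiflow \<psi>"
    and "\<forall>z\<in>ball 0 1. \<phi> z = \<psi> 1 z"
    and "koenigs_function \<psi> h"
    and "\<Omega> = h ` ball 0 1"
  shows
    "((\<exists>H. half_plane H \<and> \<Omega> \<subseteq> H) \<and> interior (closure \<Omega>) = \<Omega> \<and>
        \<not> summable (\<lambda>n. 1 - cmod ((\<phi> ^^ Suc n) 0)) \<longrightarrow>
        (\<forall>p::real. p \<ge> 1 \<longrightarrow>
          composition_op p \<phi> \<in> bounded_ops (hardy_space p) (hardy_norm p) \<and>
          functional_commutant_property (hardy_space p) (hardy_norm p) (composition_op p \<phi>) \<and>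
          \<not> (\<exists>J \<in> commutant (hardy_space p) (hardy_norm p) (composition_op p \<phi>).
                nontrivial_idempotent (hardy_space p) (hardy_norm p) J)))
     \<and>
     (\<forall>\<eta>::real. \<eta> > 0 \<and> \<Omega> \<subseteq> {w. Im w > - \<eta>} \<longrightarrow>
        (\<forall>p::real. p \<ge> 1 \<longrightarrow>
          composition_op p \<phi> \<in> bounded_ops (hardy_space p) (hardy_norm p) \<and>
          \<not> abelian_ops (hardy_space p)
                (commutant (hardy_space p) (hardy_norm p) (composition_op p \<phi>)) \<and>
          \<not> functional_commutant_property (hardy_space p) (hardy_norm p) (composition_op p \<phi>) \<and>
          \<not> minimal_commutant (hardy_space p) (hardy_norm p) (composition_op p \<phi>)))"
proof -
  have "holomorphic_semiflow \<psi>" using assms(3) unfolding parabolic_semiflow_def by blast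
  then interpret semiflow_model \<psi> h using assms(5) by unfold_locales
  have op: "composition_op p \<phi> = composition_op p (\<psi> 1)" for p
    using assms(4) by (intro composition_op_cong) blast
  \<comment> \<open>\<open>\<phi>\<close> and \<open>\<psi> 1\<close> are known to agree on the disc
    only, so the iterates are compared along the orbit of 0, which stays there.\<close>
  have iter: "(\<phi> ^^ n) 0 = (\<psi> 1 ^^ n) 0" for n
  proof (induction n)
    case (Suc n)
    then show ?case using assms(4) iterate_disc[of n] by simp
  qed simp
  show ?thesis
    unfolding op iter assms(6)
  proof (intro conjI impI allI; (elim conjE exE)?)
    fix p :: real and H
    assume p: "1 \<le> p"
    then have p0: "0 < p" by simp
    show bdd: "composition_op p (\<psi> 1) \<in> bounded_ops (hardy_space p) (hardy_norm p)"
      by (rule composition_\<psi>_bounded) (use p0 in auto)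
    assume H: "half_plane H" "h ` unit_disc \<subseteq> H"
      and reg: "interior (closure (h ` unit_disc)) = h ` unit_disc"
      and sum: "\<not> summable (\<lambda>n. 1 - cmod ((\<psi> 1 ^^ Suc n) 0))"
    show fcp: "functional_commutant_property (hardy_space p) (hardy_norm p) (composition_op p (\<psi> 1))"
      by (rule has_functional_commutant[OF sum H reg p])
    show "\<not> (\<exists>J\<in>commutant (hardy_space p) (hardy_norm p) (composition_op p (\<psi> 1)).
        nontrivial_idempotent (hardy_space p) (hardy_norm p) J)"
      using functional_commutant_no_idempotent[OF fcp hardy_commutant_closed(4)[OF bdd p0]] by blast
  next
    fix \<eta> p :: real
    assume p: "1 \<le> p" and sub: "h ` unit_disc \<subseteq> {w. - \<eta> < Im w}"
    then have p0: "0 < p" by simp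
    show bdd: "composition_op p (\<psi> 1) \<in> bounded_ops (hardy_space p) (hardy_norm p)"
      by (rule composition_\<psi>_bounded) (use p0 in auto)
    show nab: "\<not> abelian_ops (hardy_space p)
        (commutant (hardy_space p) (hardy_norm p) (composition_op p (\<psi> 1)))"
      by (rule commutant_not_abelian[OF sub p0])
    show "\<not> functional_commutant_property (hardy_space p) (hardy_norm p) (composition_op p (\<psi> 1))"
      using functional_commutant_imp_abelian nab by blast
    show "\<not> minimal_commutant (hardy_space p) (hardy_norm p) (composition_op p (\<psi> 1))"
      using minimal_commutant_imp_abelian[OF bdd p0] nab by blast
  qed
qed

end
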